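(* There is a length-preserving map $f\colon\mathbb{S}^2\to\mathbb{R}^2$.
   Context: $\mathbb{S}^2$ is the unit sphere in $\mathbb{R}^3$ equipped with its induced length metric, i.e. the angle metric $|x-y|_{\mathbb{S}^2}=\arccos\langle x,y\rangle$, where $\langle\cdot,\cdot\rangle$ is the standard inner product; $\mathbb{R}^2$ carries the standard Euclidean metric. A curve in a metric space $X$ is a continuous map $\alpha\colon\mathbb{I}\to X$ from a real interval (a convex subset of $\mathbb{R}$ with more than one point). Its length, $\operatorname{length}\alpha\in[0,\infty]$, is the supremum of $\sum_{i=1}^k|\alpha(t_{i-1})-\alpha(t_i)|_X$ over all positive integers $k$ and all $t_0<t_1<\dots<t_k$ in $\mathbb{I}$. A continuous map $f\colon X\to Y$ between metric spaces is length-preserving if $\operatorname{length}\alpha=\operatorname{length}(f\circ\alpha)$ for every curve $\alpha\colon\mathbb{I}\to X$. *)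

theory Defs
  imports "HOL-Analysis.Analysis"
begin

definition nontrivial_interval :: "real set \<Rightarrow> bool" where
  "nontrivial_interval I \<longleftrightarrow> convex I \<and> (\<exists>a\<in>I. \<exists>b\<in>I. a \<noteq> b)"

definition is_curve :: "'a metric \<Rightarrow> real set \<Rightarrow> (real \<Rightarrow> 'a) \<Rightarrow> bool" where
  "is_curve X I \<alpha> \<longleftrightarrow>
     nontrivial_interval I \<and> continuous_map (top_of_set I) (mtopology_of X) \<alpha>"

text \<open>Only the values \<open>t 0, \<dots>, t k\<close> of the sequence \<open>t\<close> matter.\<close>

definition curve_length :: "'a metric \<Rightarrow> real set \<Rightarrow> (real \<Rightarrow> 'a) \<Rightarrow> ennreal" where
  "curve_length X I \<alpha> =
     (SUP (k, t) \<in> {(k, t :: nat \<Rightarrow> real).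
                      k \<ge> 1 \<and> (\<forall>i\<le>k. t i \<in> I) \<and> (\<forall>i<k. t i < t (Suc i))}.
        ennreal (\<Sum>i=1..k. mdist X (\<alpha> (t (i - 1))) (\<alpha> (t i))))"

definition length_preserving :: "'a metric \<Rightarrow> 'b metric \<Rightarrow> ('a \<Rightarrow> 'b) \<Rightarrow> bool" where
  "length_preserving X Y f \<longleftrightarrow>
     continuous_map (mtopology_of X) (mtopology_of Y) f \<and>
     (\<forall>I \<alpha>. is_curve X I \<alpha> \<longrightarrow> curve_length X I \<alpha> = curve_length Y I (f \<circ> \<alpha>))"

text \<open>The locale \<open>Metric_space\<close> demands nonnegativity of the distance also outside the
  carrier, where \<^term>\<open>arccos (x \<bullet> y)\<close> may be unspecified; hence the dummy value \<open>0\<close> there.\<close>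

definition angle_dist :: "real ^ 3 \<Rightarrow> real ^ 3 \<Rightarrow> real" where
  "angle_dist x y =
     (if x \<in> sphere 0 1 \<and> y \<in> sphere 0 1 then arccos (x \<bullet> y) else 0)"

definition sphere2 :: "(real ^ 3) metric" where
  "sphere2 = metric (sphere 0 1, angle_dist)"

abbreviation plane :: "(real ^ 2) metric" where
  "plane \<equiv> euclidean_metric"

lemma inner_unit_bounds:
  fixes x y :: "'a::real_inner"
  assumes "norm x = 1" "norm y = 1"
  shows "- 1 \<le> x \<bullet> y" "x \<bullet> y \<le> 1"
  using Cauchy_Schwarz_ineq2[of x y] assms by auto

lemma angle_triangle:
  fixes x y z :: "'a::real_inner"
  assumes n: "norm x = 1" "norm y = 1" "norm z = 1"
  shows "arccos (x \<bullet> z) \<le> arccos (x \<bullet> y) + arccos (y \<bullet> z)"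
proof -
  define a b where "a = arccos (x \<bullet> y)" and "b = arccos (y \<bullet> z)"
  note bd = inner_unit_bounds[OF n(1,2)] inner_unit_bounds[OF n(2,3)] inner_unit_bounds[OF n(1,3)]
  have ab: "0 \<le> a" "0 \<le> b" "cos a = x \<bullet> y" "cos b = y \<bullet> z"
    "sin a = sqrt (1 - (x \<bullet> y)\<^sup>2)" "sin b = sqrt (1 - (y \<bullet> z)\<^sup>2)"
    using bd by (auto simp: a_def b_def sin_arccos arccos_lbound)
  have sq: "x \<bullet> x = 1" "y \<bullet> y = 1" "z \<bullet> z = 1"
    using n by (auto simp: norm_eq_1)
  show ?thesis
  proof (cases "a + b \<le> pi")
    case True
    define u v where "u = x - (x \<bullet> y) *\<^sub>R y" and "v = z - (y \<bullet> z) *\<^sub>R y"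
    have uv: "u \<bullet> v = x \<bullet> z - (x \<bullet> y) * (y \<bullet> z)"
      using sq by (simp add: u_def v_def inner_diff inner_commute algebra_simps)
    have "norm u = sin a" "norm v = sin b"
      using sq unfolding ab norm_eq_sqrt_inner
      by (simp_all add: u_def v_def inner_diff inner_commute power2_eq_square algebra_simps)
    with uv have "cos (a + b) \<le> x \<bullet> z"
      using Cauchy_Schwarz_ineq2[of u v] by (simp add: cos_add ab(3,4))
    then have "arccos (x \<bullet> z) \<le> arccos (cos (a + b))"
      using bd by (intro arccos_le_arccos) auto
    then show ?thesis
      using True ab(1,2) by (simp add: arccos_cos flip: a_def b_def)
  next
    case False
    then show ?thesis
      using arccos_ubound[OF bd(5,6)] by (simp flip: a_def b_def)
  qed
qed

lemma angle_eq_0_iff: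
  fixes x y :: "'a::real_inner"
  assumes n: "norm x = 1" "norm y = 1"
  shows "arccos (x \<bullet> y) = 0 \<longleftrightarrow> x = y"
proof
  assume "arccos (x \<bullet> y) = 0"
  then have "x \<bullet> y = 1"
    by (metis cos_arccos cos_zero inner_unit_bounds[OF n])
  moreover have "x \<bullet> x = 1" "y \<bullet> y = 1"
    using n by (auto simp: norm_eq_1)
  ultimately have "(x - y) \<bullet> (x - y) = 0"
    by (simp add: inner_diff inner_commute)
  then show "x = y" by simp
next
  assume "x = y"
  then show "arccos (x \<bullet> y) = 0" using n by (simp add: norm_eq_1)
qed

lemma Metric_space_angle_dist: "Metric_space (sphere 0 1) angle_dist"
proof
  show "0 \<le> angle_dist x y" for x y
    using inner_unit_bounds[of x y] by (auto simp: angle_dist_def arccos_lbound)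
  show "angle_dist x y = angle_dist y x" for x y
    by (simp add: angle_dist_def inner_commute)
  show "angle_dist x y = 0 \<longleftrightarrow> x = y" if "x \<in> sphere 0 1" "y \<in> sphere 0 1" for x y
    using that by (simp add: angle_dist_def angle_eq_0_iff)
  show "angle_dist x z \<le> angle_dist x y + angle_dist y z"
    if "x \<in> sphere 0 1" "y \<in> sphere 0 1" "z \<in> sphere 0 1" for x y z
    using that by (simp add: angle_dist_def angle_triangle)
qed

lemma mspace_sphere2 [simp]: "mspace sphere2 = sphere 0 1"
  unfolding sphere2_def by (rule Metric_space.mspace_metric[OF Metric_space_angle_dist])

lemma mdist_sphere2:
  "x \<in> sphere 0 1 \<Longrightarrow> y \<in> sphere 0 1 \<Longrightarrow> mdist sphere2 x y = arccos (x \<bullet> y)"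
  unfolding sphere2_def
  by (simp add: Metric_space.mdist_metric[OF Metric_space_angle_dist] angle_dist_def)

end

theory Submission
  imports Defs
begin

text \<open>
  The map is a uniform limit of strictly short maps, the \<open>n\<close>th of which multiplies distances by a factor
  close to \<open>1\<close> on each of finitely many closed pieces covering the domain. Shortness passes to the
  limit. So does the opposite bound: a curve can be cut in such a way that every piece is used only
  once, hence moving the map by \<open>\<delta>\<close> costs at most \<open>2 * \<delta>\<close> per piece in length, and
  the later maps are chosen that close.

  To improve a strictly short map, triangulate the domain finely and give each triangle a flat metric
  with the same edge lengths. Fold the edges into zigzags of ratio slightly below \<open>1\<close> approximating
  the given map; the folded boundary values are still short, and Brehm's theorem extends them to a
  piecewise similarity of each triangle. The extensions agree on common edges because the zigzags
  determine them there.

  The sphere is first folded onto a hemisphere and represented by stereographic coordinates.\<close>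

section \<open>Lower bounds for the length of a curve\<close>

text \<open>The obstacle is that uniform limits lose length: ever finer zigzags can converge to a
  constant curve. So the closeness demanded of later maps can be fixed only once the number of
  pieces of a map is known. Strictness is the currency of an improvement. It pays for the flat model
  of a cell, for folding the edges and for passing from cell to cell, and a positive rest must
  remain for the next step. Edges are folded because Brehm's theorem prescribes values at finitely
  many points only; a short map is forced at further points where they lie between two fully
  stretched ones. The delicate place is a vertex: two edges come arbitrarily close there and leave
  no room for an approximation error. On the square the distance is the chord, not the angle, since
  it is a product of weights and the Euclidean distance. Chords and angles agree infinitesimally, so
  lengths of curves do not see the difference, and angles return only at the end.\<close>

inductive chain :: "(real \<Rightarrow> 'a::metric_space) \<Rightarrow> real \<Rightarrow> real \<Rightarrow> real \<Rightarrow> bool" for g where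
  refl: "chain g s s 0"
| step: "chain g s u c \<Longrightarrow> u < t \<Longrightarrow> chain g s t (c + dist (g u) (g t))"

lemma chain_le: "chain g s t c \<Longrightarrow> s \<le> t"
  by (induction rule: chain.induct) auto

lemma chain_trans:
  assumes "chain g u t c'" "chain g s u c"
  shows "chain g s t (c + c')"
  using assms
proof (induction rule: chain.induct)
  case (step u v c' t)
  from chain.step[OF step.IH[OF step.prems] step.hyps(2)] show ?case
    by (simp add: add.assoc)
qed auto

lemma chain_single: "s \<le> t \<Longrightarrow> chain g s t (dist (g s) (g t))"
  using chain.step[OF chain.refl[of g s], of t] chain.refl[of g s] by (cases "s = t") auto

text \<open>Passage from the inductive polygons to the indexed partitions in
  \<open>curve_length\<close>, which demand at least one interval; hence the clause for
  \<open>s < t\<close>.\<close>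

lemma chain_partition:
  assumes "chain g s t c"
  shows "\<exists>k \<tau>. \<tau> 0 = s \<and> \<tau> k = t \<and> (s < t \<longrightarrow> k \<ge> 1) \<and> (\<forall>i\<le>k. s \<le> \<tau> i \<and> \<tau> i \<le> t) \<and>
           (\<forall>i<k. \<tau> i < \<tau> (Suc i)) \<and> c = (\<Sum>i=1..k. dist (g (\<tau> (i - 1))) (g (\<tau> i)))"
  using assms
proof (induction rule: chain.induct)
  case (refl s)
  show ?case by (rule exI[of _ 0], rule exI[of _ "\<lambda>_. s"]) auto
next
  case (step s u c t)
  then obtain k \<tau> where *: "\<tau> 0 = s" "\<tau> k = u" "\<forall>i\<le>k. s \<le> \<tau> i \<and> \<tau> i \<le> u"
    "\<forall>i<k. \<tau> i < \<tau> (Suc i)" "c = (\<Sum>i=1..k. dist (g (\<tau> (i - 1))) (g (\<tau> i)))"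
      by blast
  define \<sigma> where "\<sigma> = \<tau>(Suc k := t)"
  have "(\<Sum>i=1..k. dist (g (\<sigma> (i - 1))) (g (\<sigma> i))) = c"
    unfolding *(5) \<sigma>_def by (intro sum.cong) auto
  then have "c + dist (g u) (g t) = (\<Sum>i=1..Suc k. dist (g (\<sigma> (i - 1))) (g (\<sigma> i)))"
    using * by (simp add: \<sigma>_def)
  moreover have "s \<le> t" using chain_le[OF step(1)] step(2) by simp
  ultimately show ?case
    using * step(2)
      by (intro exI[of _ "Suc k"] exI[of _ \<sigma>]) (auto simp: \<sigma>_def le_Suc_eq less_Suc_eq)
qed

text \<open>The length of \<open>g\<close> on \<open>{s..t}\<close> is at least \<open>l\<close>,
  said through inscribed polygons: no supremum is formed, so curves of infinite length are
  covered.\<close>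

definition length_ge :: "(real \<Rightarrow> 'a::metric_space) \<Rightarrow> real \<Rightarrow> real \<Rightarrow> real \<Rightarrow> bool" where
  "length_ge g s t l \<longleftrightarrow> (\<forall>e>0. \<exists>c. chain g s t c \<and> l \<le> c + e)"

lemma length_ge_trans:
  assumes "length_ge g s u l" "length_ge g u t l'"
  shows "length_ge g s t (l + l')"
  unfolding length_ge_def
proof (intro allI impI)
  fix e :: real assume "e > 0"
  then have "e/2 > 0" by simp
  obtain c where c: "chain g s u c" "l \<le> c + e/2"
    using assms(1) \<open>e/2 > 0\<close> unfolding length_ge_def by blast
  obtain c' where c': "chain g u t c'" "l' \<le> c' + e/2"
    using assms(2) \<open>e/2 > 0\<close> unfolding length_ge_def by blast
  show "\<exists>c. chain g s t c \<and> l + l' \<le> c + e"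
    using chain_trans[OF c'(1) c(1)] c(2) c'(2) by (intro exI[of _ "c + c'"]) auto
qed

lemma length_ge_refl: "length_ge g s s 0"
  unfolding length_ge_def by (auto intro!: exI[of _ 0] chain.refl)

lemma length_ge_mono: "length_ge g s t l \<Longrightarrow> l' \<le> l \<Longrightarrow> length_ge g s t l'"
  unfolding length_ge_def by (meson order_trans)

lemma length_ge_sum:
  assumes "\<And>i. i < k \<Longrightarrow> length_ge g (\<tau> i) (\<tau> (Suc i)) (l i)"
  shows "length_ge g (\<tau> 0) (\<tau> k) (\<Sum>i<k. l i)"
  using assms
proof (induction k)
  case 0 then show ?case by (simp add: length_ge_refl)
next
  case (Suc k)
  then show ?case using length_ge_trans[of g "\<tau> 0" "\<tau> k" _ "\<tau> (Suc k)"] by simp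
qed

text \<open>Follow the curve to the last time it visits the piece containing its starting point, then
  repeat with the remaining pieces: each piece is used once, so the error is paid once per piece,
  no matter how often the curve revisits it.\<close>

lemma chain_cover:
  fixes \<alpha> :: "real \<Rightarrow> 'a::metric_space" and g :: "'a \<Rightarrow> 'b::metric_space"
    and D :: "'a \<Rightarrow> 'a \<Rightarrow> real" and \<beta> :: real
  assumes "finite \<C>" and "s \<le> t" and "continuous_on {s..t} \<alpha>" and "\<alpha> ` {s..t} \<subseteq> \<Union>\<C>"
    and "\<And>C. C \<in> \<C> \<Longrightarrow> closed C"
    and lower: "\<And>C x y. C \<in> \<C> \<Longrightarrow> x \<in> C \<Longrightarrow> y \<in> C \<Longrightarrow> D x y \<le> dist (g x) (g y) + \<beta>"
    and tri: "\<And>x y z. D x z \<le> D x y + D y z" and "\<beta> \<ge> 0"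
  shows "\<exists>c. chain (g \<circ> \<alpha>) s t c \<and> D (\<alpha> s) (\<alpha> t) \<le> c + card \<C> * \<beta>"
  using assms(1-5) lower
proof (induction \<C> arbitrary: s rule: finite_psubset_induct)
  case (psubset \<C>)
  have "\<alpha> s \<in> \<Union>\<C>" using psubset.prems(1,3)
    by (meson atLeastAtMost_iff image_subset_iff order_refl)
  then obtain C where C: "C \<in> \<C>" "\<alpha> s \<in> C" by blast
  define T where "T = {x \<in> {s..t}. \<alpha> x \<in> C}"
  have "closed C" using psubset.prems C by auto
  then have "closed T"
    unfolding T_def using continuous_closed_preimage[OF psubset.prems(2), of C]
    by (simp add: Int_def vimage_def)
  moreover have "bounded T"
    by (rule bounded_subset[of "{s..t}"]) (auto simp: T_def)
  ultimately have "compact T" by (simp add: compact_eq_bounded_closed)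
  moreover have "s \<in> T" using C psubset.prems by (simp add: T_def)
  ultimately obtain u where u: "u \<in> T" "\<And>x. x \<in> T \<Longrightarrow> x \<le> u"
    using compact_attains_sup[of T] by auto
  have su: "s \<le> u" "u \<le> t" "\<alpha> u \<in> C" using u by (auto simp: T_def)
  have ch: "chain (g \<circ> \<alpha>) s u (dist (g (\<alpha> s)) (g (\<alpha> u)))"
    using chain_single[OF su(1), of "g \<circ> \<alpha>"] by simp
  have D1: "D (\<alpha> s) (\<alpha> u) \<le> dist (g (\<alpha> s)) (g (\<alpha> u)) + \<beta>"
    using psubset.prems(5) C su by blast
  have card: "card \<C> = Suc (card (\<C> - {C}))"
    using psubset.hyps C by (metis card.remove)
  show ?case
  proof (cases "u = t")
    case True
    have "\<beta> \<le> card \<C> * \<beta>" using card \<open>\<beta> \<ge> 0\<close>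
      by (simp add: algebra_simps)
    then show ?thesis using ch D1 True
      by (intro exI[of _ "dist (g (\<alpha> s)) (g (\<alpha> u))"]) (auto simp: o_def)
  next
    case False
    then have ut: "u < t" using su by simp
    let ?K = "\<Union>(\<C> - {C})"
    have "closed ?K" using psubset.prems psubset.hyps by (intro closed_Union) auto
    have sub: "\<alpha> ` {u<..<t} \<subseteq> ?K"
    proof
      fix y assume "y \<in> \<alpha> ` {u<..<t}"
      then obtain x where x: "u < x" "x < t" "y = \<alpha> x" by auto
      then have "x \<notin> T" using u(2)[of x] by auto
      then have "\<alpha> x \<notin> C" using x su by (auto simp: T_def)
      moreover have "\<alpha> x \<in> \<Union>\<C>"
        by (rule subsetD[OF psubset.prems(3)], rule imageI) (use x su in auto)
      ultimately show "y \<in> ?K" using x by auto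
    qed
    have cont: "continuous_on {u..t} \<alpha>"
      by (rule continuous_on_subset[OF psubset.prems(2)]) (use su in auto)
    \<comment> \<open>\<open>\<alpha> u\<close> lies in \<open>C\<close>, and only later points are
      known to avoid it. The union of the other pieces is closed, so it contains the limit
      \<open>\<alpha> u\<close> as well, and the induction restarts at \<open>u\<close> without a
      gap.\<close>
    have "\<alpha> ` closure {u<..<t} \<subseteq> closure (\<alpha> ` {u<..<t})"
      using cont ut by (intro image_closure_subset[of "{u<..<t}", OF _ closed_closure closure_subset]) auto
    also have "\<dots> \<subseteq> ?K" using sub \<open>closed ?K\<close> by (simp add: closure_minimal)
    finally have "\<alpha> ` {u..t} \<subseteq> ?K" using ut by simp
    then obtain c where c: "chain (g \<circ> \<alpha>) u t c" "D (\<alpha> u) (\<alpha> t) \<le> c + card (\<C> - {C}) * \<beta>"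
      using psubset.IH[of "\<C> - {C}" u] C su cont psubset.prems by blast
    show ?thesis
    proof (intro exI conjI)
      show "chain (g \<circ> \<alpha>) s t (dist (g (\<alpha> s)) (g (\<alpha> u)) + c)"
        by (rule chain_trans[OF c(1) ch])
      have "D (\<alpha> s) (\<alpha> t) \<le> D (\<alpha> s) (\<alpha> u) + D (\<alpha> u) (\<alpha> t)"
        by (rule tri)
      then show "D (\<alpha> s) (\<alpha> t) \<le> dist (g (\<alpha> s)) (g (\<alpha> u)) + c + card \<C> * \<beta>"
        using D1 c(2) card by (simp add: algebra_simps)
    qed
  qed
qed

section \<open>Piecewise isometries of the plane\<close>

text \<open>Finiteness is asked on balls only, since a folding of the whole plane with bounded image
  has infinitely many pieces.\<close>

definition pw_isometry :: "('a::euclidean_space \<Rightarrow> 'b::euclidean_space) \<Rightarrow> bool" where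
  "pw_isometry f \<longleftrightarrow> 1-lipschitz_on UNIV f \<and> bounded (range f) \<and>
     (\<forall>R. \<exists>\<C>. finite \<C> \<and> cball 0 R \<subseteq> \<Union>\<C> \<and>
        (\<forall>C\<in>\<C>. closed C \<and> (\<forall>x\<in>C. \<forall>y\<in>C. dist (f x) (f y) = dist x y)))"

text \<open>With equal norms the squares differ only in the inner product, which by polarization is
  governed by the distance of the end points. So a cone over a short map is short, and a cone over
  an isometry is isometric.\<close>

lemma cone_dist:
  fixes u v :: "'a::real_inner" and u' v' :: "'b::real_inner"
  assumes "norm u' = norm u" "norm v' = norm v"
  shows "norm (s *\<^sub>R u' - t *\<^sub>R v')^2 =
    norm (s *\<^sub>R u - t *\<^sub>R v)^2 + s * t * (norm (u' - v')^2 - norm (u - v)^2)"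
proof -
  have sq: "u' \<bullet> u' = u \<bullet> u" "v' \<bullet> v' = v \<bullet> v"
    using assms by (metis power2_norm_eq_inner)+
  show ?thesis
    unfolding power2_norm_eq_inner
    by (simp add: inner_diff inner_commute sq power2_eq_square algebra_simps)
qed

text \<open>Two closed balls whose radii add up to the distance of their centres touch in one point.
  The computation is Stewart's identity.\<close>

lemma segment_point_eq:
  fixes p q :: "'a::real_inner"
  assumes P: "norm q \<le> t * norm p" "norm (p - q) \<le> (1 - t) * norm p" and t: "0 \<le> t" "t \<le> 1"
  shows "q = t *\<^sub>R p"
proof -
  have "norm q ^2 \<le> (t * norm p)^2" "norm (p - q)^2 \<le> ((1 - t) * norm p)^2"
    using P by (auto intro!: power_mono)
  then have "q \<bullet> q \<le> t^2 * (p \<bullet> p)" "p \<bullet> p + q \<bullet> q - 2 * (p \<bullet> q) \<le> (1 - t)^2 * (p \<bullet> p)"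
    unfolding power_mult_distrib power2_norm_eq_inner
    by (simp_all add: inner_diff inner_commute)
  moreover have "(q - t *\<^sub>R p) \<bullet> (q - t *\<^sub>R p) = (1 - t) * (q \<bullet> q) + t * (p \<bullet> p + q \<bullet> q - 2 * (p \<bullet> q)) - t * (1-t) * (p \<bullet> p)"
    by (simp add: inner_diff inner_commute algebra_simps power2_eq_square)
  moreover have "(1 - t) * (q \<bullet> q) \<le> (1 - t) * (t^2 * (p \<bullet> p))"
    using calculation(1) t by (intro mult_left_mono) auto
  moreover have "t * (p \<bullet> p + q \<bullet> q - 2 * (p \<bullet> q)) \<le> t * ((1 - t)^2 * (p \<bullet> p))"
    using calculation(2) t by (intro mult_left_mono) auto
  moreover have "(1 - t) * (t^2 * (p \<bullet> p)) + t * ((1 - t)^2 * (p \<bullet> p)) = t * (1-t) * (p \<bullet> p)"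
    by (simp add: algebra_simps power2_eq_square)
  ultimately have "(q - t *\<^sub>R p) \<bullet> (q - t *\<^sub>R p) \<le> 0" by linarith
  then show ?thesis using inner_ge_zero[of "q - t *\<^sub>R p"]
    by (metis antisym inner_eq_zero_iff right_minus_eq)
qed

text \<open>Brehm's extension step. The region \<open>\<Omega>\<close> where \<open>f\<close> is incompatible with the new
  value \<open>b\<close> at \<open>a\<close> is star-shaped about \<open>a\<close>; there \<open>f\<close> is replaced by the cone with apex
  \<open>b\<close> over its values on the boundary. On the boundary \<open>dist (f z) b = dist z a\<close>, so the cone over a
  piece on which \<open>f\<close> is isometric is again isometric. Boundedness of \<open>f\<close> makes every ray
  leave \<open>\<Omega>\<close>.\<close>

lemma pw_isometry_step:
  fixes f :: "'a::euclidean_space \<Rightarrow> 'b::euclidean_space"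
  assumes f: "pw_isometry f"
  obtains h where "pw_isometry h" "h a = b" "\<And>x. dist (f x) b \<le> dist x a \<Longrightarrow> h x = f x"
proof -
  have lip: "dist (f x) (f y) \<le> dist x y" for x y
    using f by (auto simp: pw_isometry_def lipschitz_on_def)
  have contf: "continuous_on S f" for S
    using lipschitz_on_continuous_on[of 1 UNIV f] continuous_on_subset[of UNIV f S] f
    by (simp add: pw_isometry_def)
  define \<Omega> where "\<Omega> = {x. dist x a < dist (f x) b}"
  define Z where "Z = {z. dist (f z) b = dist z a}"
  obtain B where B: "\<And>x. dist (f x) b \<le> B" "B > 0"
  proof -
    have "bounded (range f)" using f by (simp add: pw_isometry_def)
    then obtain e where "\<forall>y\<in>range f. dist b y \<le> e" unfolding bounded_any_center[of _ b]
      by blast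
    then have "dist (f x) b \<le> max e 1" for x by (auto simp: dist_commute le_max_iff_disj)
    then show thesis by (rule that) simp
  qed
  have Z_bd: "dist z a \<le> B" if "z \<in> Z" for z using B(1)[of z] that by (simp add: Z_def)
  define onray where "onray x z t \<longleftrightarrow> z \<in> Z \<and> 0 \<le> t \<and> t \<le> 1 \<and> x = a + t *\<^sub>R (z - a)"
    for x z and t :: real
  have key: "norm (s *\<^sub>R (f z - b) - t *\<^sub>R (f w - b)) \<le> norm (s *\<^sub>R (z - a) - t *\<^sub>R (w - a))"
    if "z \<in> Z" "w \<in> Z" "s \<ge> 0" "t \<ge> 0" for z w s t
  proof (rule power2_le_imp_le)
    have "norm (f z - f w)^2 \<le> norm (z - w)^2"
      using lip[of z w] by (intro power_mono) (auto simp: dist_norm)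
    then have "s * t * (norm (f z - b - (f w - b))^2 - norm (z - a - (w - a))^2) \<le> 0"
      using that by (intro mult_nonneg_nonpos) auto
    then show "norm (s *\<^sub>R (f z - b) - t *\<^sub>R (f w - b))^2 \<le> norm (s *\<^sub>R (z - a) - t *\<^sub>R (w - a))^2"
      using cone_dist[of "f z - b" "z - a" "f w - b" "w - a" s t] that by (simp add: Z_def dist_norm)
  qed simp
  have ray_ex: "\<exists>z t. onray x z t" if "x \<in> \<Omega>" for x
  proof -
    obtain v where v: "norm v = 1" "x = a + norm (x - a) *\<^sub>R v"
    proof (cases "x = a")
      case True
      obtain e :: 'a where "norm e = 1" using vector_choose_size[of 1] by auto
      then show thesis using that True by simp
    next
      case False
      then show thesis using that[of "sgn (x - a)"] by (simp add: norm_sgn sgn_div_norm)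
    qed
    let ?s = "norm (x - a)"
    \<comment> \<open>Along the ray, \<open>\<phi>\<close> is nonnegative at \<open>x\<close>
      because \<open>x\<close> lies in \<open>\<Omega>\<close>, and nonpositive at distance
      \<open>B\<close> from \<open>a\<close> because \<open>f\<close> never leaves the ball of
      radius \<open>B\<close> about \<open>b\<close>. Its zero is a point of
      \<open>Z\<close>.\<close>
    define \<phi> where "\<phi> t = dist (f (a + t *\<^sub>R v)) b - dist (a + t *\<^sub>R v) a" for t
    have "?s \<le> B" using that B(1)[of x] by (simp add: \<Omega>_def dist_norm)
    moreover have "\<phi> B \<le> 0" using B(1)[of "a + B *\<^sub>R v"] B(2) v
      by (simp add: \<phi>_def dist_norm)
    moreover have "\<phi> ?s \<ge> 0" unfolding \<phi>_def v(2)[symmetric] using that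
      by (simp add: \<Omega>_def)
    moreover have "continuous_on {?s..B} \<phi>"
      unfolding \<phi>_def by (intro continuous_intros continuous_on_compose2[OF contf[of UNIV]]) auto
    ultimately obtain t where t: "?s \<le> t" "\<phi> t = 0" using IVT2'[of \<phi> B 0 ?s] by auto
    then have "onray x (a + t *\<^sub>R v) (?s / t)"
      using v order_trans[OF norm_ge_zero t(1)]
      by (cases "t = 0") (auto simp: onray_def Z_def \<phi>_def divide_le_eq_1)
    then show ?thesis by blast
  qed
  \<comment> \<open>The pair is not unique: at \<open>x = a\<close> every \<open>z\<close> in
    \<open>Z\<close> with \<open>t = 0\<close> qualifies. Applied to two pairs for one point,
    \<open>key\<close> shows that the value does not depend on the choice.\<close>
  define h where "h x = (if \<exists>z t. onray x z t
      then (let (z, t) = (SOME (z, t). onray x z t) in b + t *\<^sub>R (f z - b)) else f x)" for x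
  have h_ray: "h x = b + t *\<^sub>R (f z - b)" if "onray x z t" for x z t
  proof -
    obtain z' t' where zt: "(SOME (z, t). onray x z t) = (z', t')" by fastforce
    have "case (SOME (z, t). onray x z t) of (z, t) \<Rightarrow> onray x z t"
      by (rule someI[of "\<lambda>(z, t). onray x z t" "(z, t)"]) (use that in simp)
    then have r: "onray x z' t'" using zt by simp
    have "norm (t' *\<^sub>R (f z' - b) - t *\<^sub>R (f z - b)) \<le> norm (t' *\<^sub>R (z' - a) - t *\<^sub>R (z - a))"
      by (rule key) (use that r in \<open>auto simp: onray_def\<close>)
    also have "t' *\<^sub>R (z' - a) - t *\<^sub>R (z - a) = 0"
      using that r unfolding onray_def by (metis add_diff_cancel_left' right_minus_eq)
    finally have "t' *\<^sub>R (f z' - b) = t *\<^sub>R (f z - b)" by simp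
    then show ?thesis using that zt by (auto simp: h_def)
  qed
  have h_out: "h x = f x" if "x \<notin> \<Omega>" for x
  proof (cases "\<exists>z t. onray x z t")
    case True
    then obtain z t where r: "onray x z t" by blast
    text \<open>Beyond the boundary point the triangle inequality is an equality, which forces
      \<open>f\<close> to agree with the cone.\<close>
    have zZ: "norm (f z - b) = norm (z - a)" and t: "0 \<le> t" "t \<le> 1" and x: "x = a + t *\<^sub>R (z - a)"
      using r by (auto simp: onray_def Z_def dist_norm)
    have fx: "norm (f x - b) \<le> t * norm (z - a)"
      using that x t by (simp add: \<Omega>_def dist_norm)
    have "norm (f z - f x) \<le> norm (z - x)" using lip[of z x] by (simp add: dist_norm)
    also have "z - x = (1 - t) *\<^sub>R (z - a)" by (simp add: x algebra_simps)
    finally have fz: "norm (f z - f x) \<le> (1 - t) * norm (z - a)" using t by simp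
    have "f x - b = t *\<^sub>R (f z - b)"
      by (rule segment_point_eq[OF _ _ t]) (use fx fz zZ in simp_all)
    then have "f x = b + t *\<^sub>R (f z - b)" by (simp add: algebra_simps)
    then show ?thesis using h_ray[OF r] by simp
  qed (simp add: h_def)
  have ray_dist: "dist (h x) (h y) = norm (s *\<^sub>R (f z - b) - t *\<^sub>R (f w - b))"
    "dist x y = norm (s *\<^sub>R (z - a) - t *\<^sub>R (w - a))"
      if "onray x z s" "onray y w t" for x y z w s t
  proof -
    show "dist (h x) (h y) = norm (s *\<^sub>R (f z - b) - t *\<^sub>R (f w - b))"
      by (simp add: h_ray[OF that(1)] h_ray[OF that(2)] dist_norm)
    show "dist x y = norm (s *\<^sub>R (z - a) - t *\<^sub>R (w - a))"
      using that by (simp add: onray_def dist_norm)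
  qed
  have inner: "dist (h x) (h y) \<le> dist x y" if "onray x z s" "onray y w t" for x y z w s t
    unfolding ray_dist[OF that] by (rule key) (use that in \<open>auto simp: onray_def\<close>)
  have mixed: "dist (h x) (h y) \<le> dist x y" if "x \<in> \<Omega>" "y \<notin> \<Omega>" for x y
  proof -
    \<comment> \<open>The segment from \<open>x\<close> to \<open>y\<close> meets \<open>Z\<close>
      in a point \<open>z\<close> where the cone and \<open>f\<close> agree. The cone estimate
      handles the part up to \<open>z\<close>, shortness of \<open>f\<close> the rest, and the
      distances add.\<close>
    define \<phi> where "\<phi> t = dist (f (x + t *\<^sub>R (y - x))) b - dist (x + t *\<^sub>R (y - x)) a" for t
    have "\<phi> 1 \<le> 0" "\<phi> 0 \<ge> 0" using that by (auto simp: \<phi>_def \<Omega>_def)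
    moreover have "continuous_on {0..1} \<phi>"
      unfolding \<phi>_def by (intro continuous_intros continuous_on_compose2[OF contf[of UNIV]]) auto
    ultimately obtain t where t: "0 \<le> t" "t \<le> 1" "\<phi> t = 0"
      using IVT2'[of \<phi> 1 0 0] by auto
    define z where "z = x + t *\<^sub>R (y - x)"
    have z: "onray z z 1" "z \<notin> \<Omega>" using t
      by (auto simp: onray_def Z_def \<phi>_def z_def \<Omega>_def)
    obtain w s where "onray x w s" using ray_ex \<open>x \<in> \<Omega>\<close> by blast
    then have "dist (h x) (h z) \<le> dist x z" using inner z by blast
    moreover have "dist (h z) (h y) \<le> dist z y" using lip[of z y] h_out z that by simp
    moreover have "dist x z + dist z y = dist x y"
    proof -
      have "x - z = t *\<^sub>R (x - y)" "z - y = (1 - t) *\<^sub>R (x - y)"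
        by (simp_all add: z_def algebra_simps)
      then have "dist x z = t * dist x y" "dist z y = (1 - t) * dist x y" using t by (simp_all add: dist_norm)
      then show ?thesis by (simp add: algebra_simps)
    qed
    ultimately show ?thesis using dist_triangle[of "h x" "h y" "h z"] by linarith
  qed
  have h_lip: "dist (h x) (h y) \<le> dist x y" for x y
  proof (cases "x \<in> \<Omega>"; cases "y \<in> \<Omega>")
    assume "x \<in> \<Omega>" "y \<in> \<Omega>" then show ?thesis using inner ray_ex by meson
  next
    assume "x \<in> \<Omega>" "y \<notin> \<Omega>" then show ?thesis by (rule mixed)
  next
    assume "x \<notin> \<Omega>" "y \<in> \<Omega>" then show ?thesis using mixed[of y x]
      by (simp add: dist_commute)
  next
    assume "x \<notin> \<Omega>" "y \<notin> \<Omega>" then show ?thesis using lip by (simp add: h_out)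
  qed
  have contd: "continuous_on UNIV (\<lambda>x. dist (f x) b - dist x a)"
    by (intro continuous_intros contf)
  have "closed {x. dist (f x) b - dist x a \<le> 0}" "closed {x. dist (f x) b - dist x a = 0}"
    by (intro closed_Collect_le closed_Collect_eq contd continuous_on_const)+
  moreover have "{x. dist (f x) b - dist x a \<le> 0} = - \<Omega>" "{x. dist (f x) b - dist x a = 0} = Z"
    by (auto simp: \<Omega>_def Z_def)
  ultimately have cl: "closed (- \<Omega>)" "closed Z" by simp_all
  show thesis
  proof (rule that)
    have "dist b (h x) \<le> B" for x
    proof (cases "\<exists>z t. onray x z t")
      case True
      then obtain z t where r: "onray x z t" by blast
      then have "t * norm (f z - b) \<le> 1 * B"
        using B by (intro mult_mono) (auto simp: onray_def dist_norm)
      moreover have "dist b (h x) = t * norm (f z - b)"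
        using r unfolding h_ray[OF r] by (auto simp: dist_norm onray_def)
      ultimately show ?thesis by simp
    next
      case False
      then show ?thesis using B by (simp add: h_def dist_commute)
    qed
    then have "bounded (range h)" unfolding bounded_def by blast
    moreover have "1-lipschitz_on UNIV h" using h_lip by (auto simp: lipschitz_on_def)
    moreover have "\<exists>\<C>. finite \<C> \<and> cball 0 R \<subseteq> \<Union>\<C> \<and>
        (\<forall>C\<in>\<C>. closed C \<and> (\<forall>x\<in>C. \<forall>y\<in>C. dist (h x) (h y) = dist x y))" for R
    proof -
      \<comment> \<open>The cone through a point of the ball may have its base point outside the
        ball; base points are within \<open>B\<close> of \<open>a\<close>.\<close>
      define R' where "R' = max R (norm a + B)"
      obtain \<C> where \<C>: "finite \<C>" "cball 0 R' \<subseteq> \<Union>\<C>"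
        "\<And>C. C \<in> \<C> \<Longrightarrow> closed C"
        "\<And>C x y. C \<in> \<C> \<Longrightarrow> x \<in> C \<Longrightarrow> y \<in> C \<Longrightarrow> dist (f x) (f y) = dist x y"
        using f unfolding pw_isometry_def by metis
      define cone where "cone C = (\<lambda>(t, z). a + t *\<^sub>R (z - a)) ` ({0..1} \<times> (C \<inter> Z))" for C
      define \<D> where "\<D> = ((\<lambda>C. C - \<Omega>) ` \<C>) \<union> cone ` \<C>"
      have "finite \<D>" using \<C>(1) by (simp add: \<D>_def)
      moreover have "cball 0 R \<subseteq> \<Union>\<D>"
      proof
        fix x :: 'a assume "x \<in> cball 0 R"
        then have "x \<in> cball 0 R'" by (simp add: R'_def)
        then obtain C where C: "C \<in> \<C>" "x \<in> C" using \<C>(2) by blast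
        show "x \<in> \<Union>\<D>"
        proof (cases "x \<in> \<Omega>")
          case True
          then obtain z t where r: "onray x z t" using ray_ex by blast
          then have z: "z \<in> Z" by (simp add: onray_def)
          have "norm z \<le> R'" using Z_bd[OF z] norm_triangle_sub[of z a] by (simp add: R'_def dist_norm)
          then obtain C' where "C' \<in> \<C>" "z \<in> C'" using \<C>(2) by fastforce
          then have "x \<in> cone C'" "C' \<in> \<C>" using r by (auto simp: cone_def onray_def)
          then show ?thesis by (auto simp: \<D>_def)
        qed (use C in \<open>auto simp: \<D>_def\<close>)
      qed
      moreover have "closed E \<and> (\<forall>x\<in>E. \<forall>y\<in>E. dist (h x) (h y) = dist x y)"
        if E: "E \<in> \<D>" for E
      proof -
        consider C where "C \<in> \<C>" "E = C - \<Omega>" | C where "C \<in> \<C>" "E = cone C"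
          using E by (auto simp: \<D>_def)
        then show ?thesis
        proof cases
          case 1
          then have "closed E" using cl \<C>(3) by (metis Diff_eq closed_Int)
          then show ?thesis using 1 \<C>(4) by (auto simp: h_out)
        next
          case 2
          have "bounded Z" unfolding bounded_def using Z_bd by (metis dist_commute)
          then have "compact (C \<inter> Z)"
            using cl \<C>(3)[OF 2(1)] by (simp add: compact_eq_bounded_closed closed_Int bounded_Int)
          then have "compact (cone C)" unfolding cone_def
            by (intro compact_continuous_image compact_Times) (auto simp: case_prod_beta intro!: continuous_intros)
          then have "closed E" using 2 by (simp add: compact_imp_closed)
          moreover have "dist (h x) (h y) = dist x y" if xy: "x \<in> E" "y \<in> E" for x y
          proof -
            obtain s z where z: "onray x z s" "z \<in> C" using xy 2 by (auto simp: cone_def onray_def)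
            obtain t w where w: "onray y w t" "w \<in> C" using xy 2 by (auto simp: cone_def onray_def)
            have "norm (s *\<^sub>R (f z - b) - t *\<^sub>R (f w - b))^2 = norm (s *\<^sub>R (z - a) - t *\<^sub>R (w - a))^2"
              using cone_dist[of "f z - b" "z - a" "f w - b" "w - a" s t] z w \<C>(4)[OF 2(1), of z w]
              by (simp add: onray_def Z_def dist_norm)
            then show ?thesis by (simp add: ray_dist[OF z(1) w(1)])
          qed
          ultimately show ?thesis by blast
        qed
      qed
      ultimately show ?thesis by blast
    qed
    ultimately show "pw_isometry h" unfolding pw_isometry_def by blast
    show "h a = b"
    proof (cases "a \<in> \<Omega>")
      case True
      then obtain z t where r: "onray a z t" using ray_ex by blast
      then have "t *\<^sub>R (z - a) = 0" by (simp add: onray_def)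
      then have "t = 0 \<or> norm (f z - b) = 0" using r by (auto simp: onray_def Z_def dist_norm)
      then show ?thesis using h_ray[OF r] by auto
    qed (simp add: h_out \<Omega>_def)
    show "h x = f x" if "dist (f x) b \<le> dist x a" for x
      using h_out that by (simp add: \<Omega>_def)
  qed
qed

text \<open>Brehm's theorem, one point at a time: shortness of \<open>y\<close> places the earlier
  points outside the region that the step for \<open>a\<close> modifies. The map \<open>f\<close>
  starts the induction.\<close>

theorem pw_isometry_extension:
  fixes y :: "'a::euclidean_space \<Rightarrow> 'b::euclidean_space"
  assumes "finite S" "pw_isometry (f :: 'a \<Rightarrow> 'b)" "1-lipschitz_on S y"
  obtains h where "pw_isometry h" "\<And>x. x \<in> S \<Longrightarrow> h x = y x"
proof -
  have "\<exists>h. pw_isometry h \<and> (\<forall>x\<in>S. h x = y x)"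
    using assms(1,3)
  proof (induction S rule: finite_induct)
    case empty then show ?case using assms(2) by blast
  next
    case (insert a S)
    then obtain f where f: "pw_isometry f" "\<forall>x\<in>S. f x = y x"
      using lipschitz_on_subset[OF insert.prems, of S] by blast
    obtain h where h: "pw_isometry h" "h a = y a" "\<And>x. dist (f x) (y a) \<le> dist x a \<Longrightarrow> h x = f x"
      using pw_isometry_step[OF f(1), of a "y a"] by blast
    have "h x = y x" if "x \<in> S" for x
      using h(3)[of x] f(2) that lipschitz_onD[OF insert.prems, of x a] by simp
    then show ?case using h by blast
  qed
  then show thesis using that by blast
qed

section \<open>Folding the plane by triangle waves\<close>

definition triangle_wave :: "real \<Rightarrow> real \<Rightarrow> real" where
  "triangle_wave u s = infdist s (range (\<lambda>k::int. 2 * u * of_int k))"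

lemma triangle_wave_lipschitz: "\<bar>triangle_wave u s - triangle_wave u t\<bar> \<le> \<bar>s - t\<bar>"
  using infdist_triangle[of s "range (\<lambda>k::int. 2 * u * of_int k)" t]
    infdist_triangle[of t "range (\<lambda>k::int. 2 * u * of_int k)" s]
  unfolding triangle_wave_def dist_real_def by linarith

text \<open>Being a distance, the wave is Lipschitz at once; this makes its zigzag of slopes 1 and
  -1 explicit. Between consecutive multiples of \<open>u\<close>, the nearest multiple of
  \<open>2 * u\<close> is the even end point.\<close>

lemma triangle_wave_cell:
  assumes u: "u > 0" and s: "u * of_int k \<le> s" "s \<le> u * of_int (k + 1)"
  shows "triangle_wave u s = (if even k then s - u * of_int k else u * of_int (k + 1) - s)"
proof -
  define m where "m = (if even k then k else k + 1)"
  obtain j where j: "m = 2 * j" unfolding m_def by (metis evenE odd_one odd_even_add)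
  have sm: "\<bar>s - u * of_int m\<bar> \<le> u"
    using s u by (auto simp: m_def algebra_simps)
  have A: "range (\<lambda>k::int. 2 * u * of_int k) \<noteq> {}" by simp
  have "infdist s (range (\<lambda>k::int. 2 * u * of_int k)) \<le> dist s (2 * u * of_int j)"
    by (rule infdist_le[OF rangeI])
  then have le: "triangle_wave u s \<le> \<bar>s - u * of_int m\<bar>"
    by (simp add: triangle_wave_def dist_real_def j mult_ac)
  have ge: "\<bar>s - u * of_int m\<bar> \<le> triangle_wave u s"
    unfolding triangle_wave_def infdist_notempty[OF A]
  proof (rule cINF_greatest[OF A], clarsimp simp: dist_real_def)
    fix l :: int
    show "\<bar>s - u * of_int m\<bar> \<le> \<bar>s - 2 * u * of_int l\<bar>"
    proof (cases "l = j")
      case False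
      then have "\<bar>of_int m - 2 * of_int l :: real\<bar> \<ge> 2" unfolding j by linarith
      then have "u * \<bar>of_int m - 2 * of_int l\<bar> \<ge> u * 2" using u by (intro mult_left_mono) auto
      then have "\<bar>u * of_int m - 2 * u * of_int l\<bar> \<ge> 2 * u"
        using u abs_mult[of u "of_int m - 2 * of_int l"] by (simp add: algebra_simps)
      then show ?thesis using sm by linarith
    qed (simp add: j mult_ac)
  qed
  show ?thesis using le ge s by (auto simp: m_def)
qed

lemma triangle_wave_0: "triangle_wave u 0 = 0"
proof -
  have "(0::real) \<in> range (\<lambda>k::int. 2 * u * of_int k)" by (rule range_eqI[of _ _ 0]) simp
  then show ?thesis unfolding triangle_wave_def by simp
qed

lemma triangle_wave_bounds:
  assumes "u > 0" shows "0 \<le> triangle_wave u s" "triangle_wave u s \<le> u"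
proof -
  define k where "k = \<lfloor>s / u\<rfloor>"
  have "of_int k \<le> s / u" "s / u \<le> of_int (k + 1)"
    unfolding k_def by linarith+
  then have k: "u * of_int k \<le> s" "s \<le> u * of_int (k + 1)"
    using assms by (simp_all add: pos_le_divide_eq pos_divide_le_eq mult.commute)
  show "0 \<le> triangle_wave u s" "triangle_wave u s \<le> u"
    unfolding triangle_wave_cell[OF assms k] using k by (auto simp: algebra_simps)
qed

lemma triangle_wave_even: "u > 0 \<Longrightarrow> triangle_wave u (2 * u * of_int k) = 0"
  using triangle_wave_cell[of u "2 * k" "2 * u * of_int k"] by (simp add: algebra_simps)

lemma dist_complex_le:
  fixes z w z' w' :: complex
  assumes "\<bar>Re z - Re w\<bar> \<le> \<bar>Re z' - Re w'\<bar>" "\<bar>Im z - Im w\<bar> \<le> \<bar>Im z' - Im w'\<bar>"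
  shows "dist z w \<le> dist z' w'"
  unfolding dist_complex_def cmod_def
  using abs_le_square_iff[THEN iffD1, OF assms(1)] abs_le_square_iff[THEN iffD1, OF assms(2)]
  by (intro real_sqrt_le_mono) auto

text \<open>Fold the plane like a sheet along all lines with an integer coordinate, onto the unit
  square; each unit cell is moved isometrically.\<close>

lemma pw_isometry_exists: "\<exists>f::complex \<Rightarrow> complex. pw_isometry f"
proof
  define f where "f z = Complex (triangle_wave 1 (Re z)) (triangle_wave 1 (Im z))" for z
  have lip: "dist (f z) (f w) \<le> dist z w" for z w
    by (rule dist_complex_le) (auto simp: f_def intro: triangle_wave_lipschitz)
  define C where "C = (\<lambda>(i::int, j::int). {z. of_int i \<le> Re z \<and> Re z \<le> of_int (i + 1) \<and>
      of_int j \<le> Im z \<and> Im z \<le> of_int (j + 1)})"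
  have iso: "dist (f z) (f w) = dist z w" if "z \<in> C p" "w \<in> C p" for z w p
  proof -
    obtain i j where p: "p = (i, j)" by (cases p)
    have "\<bar>triangle_wave 1 (Re z) - triangle_wave 1 (Re w)\<bar> = \<bar>Re z - Re w\<bar>"
      "\<bar>triangle_wave 1 (Im z) - triangle_wave 1 (Im w)\<bar> = \<bar>Im z - Im w\<bar>"
      using that by (auto simp: p C_def triangle_wave_cell[of 1 i] triangle_wave_cell[of 1 j])
    then show ?thesis by (intro antisym dist_complex_le) (simp_all add: f_def)
  qed
  show "pw_isometry f"
    unfolding pw_isometry_def
  proof (intro conjI allI)
    show "1-lipschitz_on UNIV f" using lip by (auto simp: lipschitz_on_def)
    have "norm (f z) \<le> 1 + 1" for z
      using cmod_le[of "f z"] triangle_wave_bounds[of 1] abs_le_iff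
      by (intro order_trans[OF cmod_le] add_mono) (auto simp: f_def)
    then show "bounded (range f)" by (auto simp: bounded_iff)
    fix R :: real
    let ?N = "{-\<lceil>R\<rceil>-1..\<lceil>R\<rceil>}"
    show "\<exists>\<C>. finite \<C> \<and> cball 0 R \<subseteq> \<Union>\<C> \<and>
        (\<forall>C\<in>\<C>. closed C \<and> (\<forall>x\<in>C. \<forall>y\<in>C. dist (f x) (f y) = dist x y))"
    proof (intro exI conjI ballI)
      show "finite (C ` (?N \<times> ?N))" by simp
      show "cball 0 R \<subseteq> \<Union> (C ` (?N \<times> ?N))"
      proof
        fix z :: complex assume "z \<in> cball 0 R"
        then have "\<bar>Re z\<bar> \<le> R" "\<bar>Im z\<bar> \<le> R"
          using abs_Re_le_cmod[of z] abs_Im_le_cmod[of z] by (simp_all add: dist_norm)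
        then have "\<lfloor>Re z\<rfloor> \<in> ?N" "\<lfloor>Im z\<rfloor> \<in> ?N" by (auto; linarith)+
        moreover have "z \<in> C (\<lfloor>Re z\<rfloor>, \<lfloor>Im z\<rfloor>)"
          unfolding C_def by (auto; linarith)
        ultimately show "z \<in> \<Union> (C ` (?N \<times> ?N))" by blast
      qed
      show "closed E" if "E \<in> C ` (?N \<times> ?N)" for E
        using that by (auto simp: C_def intro!: closed_Collect_conj closed_Collect_le continuous_intros)
      show "dist (f x) (f y) = dist x y" if "E \<in> C ` (?N \<times> ?N)" "x \<in> E" "y \<in> E" for E x y
        using that iso by blast
    qed
  qed
qed

section \<open>Folded curves\<close>

text \<open>Full stretch between \<open>b\<close> and \<open>b'\<close> together with the Lipschitz
  bound forces a Euclidean curve to be straight in between, so the values on the finite set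
  \<open>B\<close> determine it. This makes edges accessible to an extension theorem for finite
  sets.\<close>

definition folded_on :: "real \<Rightarrow> real \<Rightarrow> real \<Rightarrow> (real \<Rightarrow> 'a::metric_space) \<Rightarrow> bool" where
  "folded_on \<mu> p q c \<longleftrightarrow> \<mu>-lipschitz_on {p..q} c \<and>
     (\<exists>B. finite B \<and> B \<subseteq> {p..q} \<and>
        (\<forall>s\<in>{p..q}. \<exists>b\<in>B. \<exists>b'\<in>B. b \<le> s \<and> s \<le> b' \<and> dist (c b) (c b') = \<mu> * (b' - b)))"

lemma folded_on_concat:
  assumes c: "folded_on \<mu> p q c" and d: "folded_on \<mu> q w d" and eq: "c q = d q"
    and le: "p \<le> q" "q \<le> w"
  shows "folded_on \<mu> p w (\<lambda>s. if s \<le> q then c s else d s)" (is "folded_on _ _ _ ?e")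
proof -
  obtain B where B: "finite B" "B \<subseteq> {p..q}"
    "\<forall>s\<in>{p..q}. \<exists>b\<in>B. \<exists>b'\<in>B. b \<le> s \<and> s \<le> b' \<and> dist (c b) (c b') = \<mu> * (b' - b)"
    using c by (auto simp: folded_on_def)
  obtain B' where B': "finite B'" "B' \<subseteq> {q..w}"
    "\<forall>s\<in>{q..w}. \<exists>b\<in>B'. \<exists>b'\<in>B'. b \<le> s \<and> s \<le> b' \<and> dist (d b) (d b') = \<mu> * (b' - b)"
    using d by (auto simp: folded_on_def)
  have e: "?e s = c s" if "s \<in> {p..q}" for s using that by simp
  have e': "?e s = d s" if "s \<in> {q..w}" for s using that eq by auto
  have f2: "\<exists>b\<in>B\<union>B'. \<exists>b'\<in>B\<union>B'. b \<le> s \<and> s \<le> b' \<and> dist (?e b) (?e b') = \<mu> * (b' - b)"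
    if s: "s \<in> {p..w}" for s
  proof (cases "s \<le> q")
    case True
    then have "s \<in> {p..q}" using s by simp
    then obtain b b' where "b \<in> B" "b' \<in> B" "b \<le> s" "s \<le> b'" "dist (c b) (c b') = \<mu> * (b' - b)"
      using B(3) by blast
    moreover from this have "b \<in> {p..q}" "b' \<in> {p..q}" using B(2) by auto
    ultimately show ?thesis
      by (intro bexI[of _ b] bexI[of _ b']) (auto simp del: atLeastAtMost_iff simp: e)
  next
    case False
    then have "s \<in> {q..w}" using s by simp
    then obtain b b' where "b \<in> B'" "b' \<in> B'" "b \<le> s" "s \<le> b'" "dist (d b) (d b') = \<mu> * (b' - b)"
      using B'(3) by blast
    moreover from this have "b \<in> {q..w}" "b' \<in> {q..w}" using B'(2) by auto
    ultimately show ?thesis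
      by (intro bexI[of _ b] bexI[of _ b']) (auto simp del: atLeastAtMost_iff simp: e')
  qed
  have f1: "\<mu>-lipschitz_on {p..w} ?e"
    using lipschitz_on_concat[of \<mu> p q c w d] c d eq by (simp add: folded_on_def)
  have "{p..q} \<subseteq> {p..w}" "{q..w} \<subseteq> {p..w}" using le by auto
  then have f3: "B \<union> B' \<subseteq> {p..w}" using B(2) B'(2) by blast
  show ?thesis unfolding folded_on_def
    by (intro conjI exI[of _ "B \<union> B'"] ballI f1 f2 f3 finite_UnI B(1) B'(1))
qed

lemma folded_on_reflect:
  assumes "folded_on \<mu> p q c"
  shows "folded_on \<mu> (w - q) (w - p) (\<lambda>s. c (w - s))"
proof -
  obtain B where B: "finite B" "B \<subseteq> {p..q}"
    "\<forall>s\<in>{p..q}. \<exists>b\<in>B. \<exists>b'\<in>B. b \<le> s \<and> s \<le> b' \<and> dist (c b) (c b') = \<mu> * (b' - b)"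
    using assms by (auto simp: folded_on_def)
  let ?B = "(\<lambda>b. w - b) ` B"
  have "\<exists>b\<in>?B. \<exists>b'\<in>?B. b \<le> s \<and> s \<le> b' \<and> dist (c (w - b)) (c (w - b')) = \<mu> * (b' - b)"
    if s: "s \<in> {w-q..w-p}" for s
  proof -
    have "w - s \<in> {p..q}" using s by auto
    then obtain b b' where "b \<in> B" "b' \<in> B" "b \<le> w - s" "w - s \<le> b'" "dist (c b) (c b') = \<mu> * (b' - b)"
      using B(3) by blast
    then show ?thesis by (intro bexI[of _ "w - b'"] bexI[of _ "w - b"]) (auto simp: dist_commute)
  qed
  moreover have "\<mu>-lipschitz_on {w-q..w-p} (\<lambda>s. c (w - s))"
  proof (rule lipschitz_onI)
    have c: "\<mu>-lipschitz_on {p..q} c" using assms by (simp add: folded_on_def)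
    show "0 \<le> \<mu>" using c by (simp add: lipschitz_on_def)
    show "dist (c (w - x)) (c (w - y)) \<le> \<mu> * dist x y"
      if "x \<in> {w-q..w-p}" "y \<in> {w-q..w-p}" for x y
      using lipschitz_onD[OF c, of "w - x" "w - y"] that by (auto simp: dist_real_def abs_minus_commute)
  qed
  ultimately show ?thesis unfolding folded_on_def using B(1,2)
    by (intro conjI exI[of _ ?B]) auto
qed

lemma lipschitz_on_affine:
  fixes A D :: "'a::real_normed_vector"
  assumes "norm D \<le> \<mu>" shows "\<mu>-lipschitz_on S (\<lambda>s::real. A + (s - p) *\<^sub>R D)"
proof -
  have "norm ((s - p) *\<^sub>R D - (t - p) *\<^sub>R D) \<le> \<mu> * \<bar>s - t\<bar>" for s t
    using mult_left_mono[OF assms, of "\<bar>s - t\<bar>"]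
    by (simp add: mult.commute flip: scaleR_diff_left)
  then show ?thesis using order_trans[OF norm_ge_zero assms]
    by (auto simp: lipschitz_on_def dist_norm)
qed

lemma folded_on_affine:
  fixes A D :: "'a::real_normed_vector"
  assumes "norm D = \<mu>" "p \<le> q"
  shows "folded_on \<mu> p q (\<lambda>s. A + (s - p) *\<^sub>R D)"
  unfolding folded_on_def
  using assms
  by (intro conjI exI[of _ "{p, q}"] lipschitz_on_affine) (auto simp: dist_norm)

lemma folded_on_triangle_wave:
  assumes "u > 0" "\<mu> \<ge> 0"
  shows "folded_on \<mu> 0 (u * real n) (\<lambda>s. P + complex_of_real (\<mu> * triangle_wave u s))"
proof (cases "n = 0")
  case True
  then show ?thesis unfolding folded_on_def using assms(2)
    by (intro conjI exI[of _ "{0}"]) (auto simp: lipschitz_on_def)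
next
  case n: False
  let ?c = "\<lambda>s. P + complex_of_real (\<mu> * triangle_wave u s)"
  have d: "dist (?c s) (?c t) = \<mu> * \<bar>triangle_wave u s - triangle_wave u t\<bar>" for s t
  proof -
    have "?c s - ?c t = complex_of_real (\<mu> * (triangle_wave u s - triangle_wave u t))"
      by (simp add: algebra_simps)
    then show ?thesis using assms(2) unfolding dist_norm by (simp only: norm_of_real abs_mult)
  qed
  have f1: "\<mu>-lipschitz_on {0..u * real n} ?c"
  proof (rule lipschitz_onI[OF _ assms(2)])
    show "dist (?c x) (?c y) \<le> \<mu> * dist x y" for x y
      unfolding d dist_real_def by (rule mult_left_mono[OF triangle_wave_lipschitz assms(2)])
  qed
  define B where "B = (\<lambda>k. u * real k) ` {0..n}"
  have f2: "\<exists>b\<in>B. \<exists>b'\<in>B. b \<le> s \<and> s \<le> b' \<and> dist (?c b) (?c b') = \<mu> * (b' - b)"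
    if s: "s \<in> {0..u * real n}" for s
  proof -
    have "\<exists>k. k < n \<and> u * real k \<le> s \<and> s \<le> u * real (Suc k)"
    proof (cases "s = u * real n")
      case True then show ?thesis using n assms by (intro exI[of _ "n - 1"]) (auto simp: of_nat_diff)
    next
      case False
      define k where "k = nat \<lfloor>s / u\<rfloor>"
      have "0 \<le> s / u" using s assms by simp
      then have "real k \<le> s / u" "s / u < real (Suc k)" by (auto simp: k_def; linarith)+
      then have "u * real k \<le> s" "s < u * real (Suc k)"
        using assms by (simp_all add: pos_le_divide_eq pos_divide_less_eq mult.commute)
      moreover from this have "u * real k < u * real n" using s False by simp
      ultimately show ?thesis using assms by (intro exI[of _ k]) auto
    qed
    then obtain k where k: "k < n" "u * real k \<le> s" "s \<le> u * real (Suc k)" by blast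
    have "triangle_wave u (u * real k) = (if even k then 0 else u)"
      "triangle_wave u (u * real (Suc k)) = (if even k then u else 0)"
      using triangle_wave_cell[OF assms(1), of "int k"] assms(1)
      by (auto simp: algebra_simps)
    then have "dist (?c (u * real k)) (?c (u * real (Suc k))) = \<mu> * (u * real (Suc k) - u * real k)"
      unfolding d using assms by (auto simp: algebra_simps)
    moreover have "u * real k \<in> B" "u * real (Suc k) \<in> B"
      unfolding B_def by (rule imageI, use k in simp)+
    ultimately show ?thesis using k by blast
  qed
  have "finite B" "B \<subseteq> {0..u * real n}" using assms by (auto simp: B_def)
  then show ?thesis unfolding folded_on_def
    by (intro conjI exI[of _ B] ballI f1 f2)
qed

text \<open>An isosceles triangle over the segment from \<open>A\<close> to \<open>B\<close> with
  both legs \<open>\<mu> * h\<close>: what the distance falls short of goes into the height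
  \<open>y\<close>, and each leg is run through at speed \<open>\<mu>\<close>.\<close>

lemma folded_on_tent:
  fixes A B :: complex
  assumes "\<mu> > 0" "h > 0" "dist A B \<le> 2 * \<mu> * h"
  obtains c where "folded_on \<mu> p (p + 2 * h) c" "c p = A" "c (p + 2 * h) = B"
proof -
  \<comment> \<open>The unit normal of \<open>B - A\<close>; if the end points coincide, the tent
    goes out and back in an arbitrary direction.\<close>
  define w where "w = (if A = B then 1 else \<i> * sgn (B - A))"
  define y where "y = sqrt ((\<mu> * h)^2 - (norm (B - A) / 2)^2)"
  have "(norm (B - A) / 2)^2 \<le> (\<mu> * h)^2"
    using assms by (intro power_mono) (auto simp: dist_norm norm_minus_commute)
  then have y2: "y^2 = (\<mu> * h)^2 - (norm (B - A) / 2)^2" by (simp add: y_def)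
  have w: "norm w = 1" by (simp add: w_def norm_mult norm_sgn)
  have "z \<bullet> (\<i> * sgn z) = 0" for z
    by (simp add: sgn_div_norm inner_complex_def)
  then have w': "(B - A) \<bullet> w = 0" by (simp add: w_def)
  define X where "X = (A + B) / 2 + y *\<^sub>R w"
  have n: "norm (v + y *\<^sub>R w) = \<mu> * h"
    if "v = (1/2) *\<^sub>R (B - A) \<or> v = - (1/2) *\<^sub>R (B - A)" for v
  proof -
    have "v \<bullet> w = 0" "norm v = norm (B - A) / 2" using w' that by auto
    then have "norm (v + y *\<^sub>R w)^2 = (norm (B - A) / 2)^2 + y^2"
      using w norm_add_Pythagorean[of v "y *\<^sub>R w"] by (simp add: orthogonal_def)
    also have "\<dots> = (\<mu> * h)^2" by (simp add: y2)
    finally show ?thesis by (rule power2_eq_imp_eq) (use assms in simp_all)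
  qed
  have XA: "norm (X - A) = \<mu> * h"
  proof -
    have "X - A = (1/2) *\<^sub>R (B - A) + y *\<^sub>R w"
      by (simp add: X_def scaleR_conv_of_real field_simps)
    then show ?thesis using n[of "(1/2) *\<^sub>R (B - A)"] by simp
  qed
  have XB: "norm (B - X) = \<mu> * h"
  proof -
    have "X - B = - (1/2) *\<^sub>R (B - A) + y *\<^sub>R w"
      by (simp add: X_def scaleR_conv_of_real field_simps)
    then show ?thesis using n[of "- (1/2) *\<^sub>R (B - A)"] norm_minus_commute[of B X] by simp
  qed
  define c1 where "c1 s = A + (s - p) *\<^sub>R ((X - A) /\<^sub>R h)" for s
  define c2 where "c2 s = X + (s - (p + h)) *\<^sub>R ((B - X) /\<^sub>R h)" for s
  have c1: "folded_on \<mu> p (p + h) c1" unfolding c1_def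
    using assms by (intro folded_on_affine) (auto simp: XA)
  have c2: "folded_on \<mu> (p + h) (p + 2 * h) c2" unfolding c2_def
    using assms by (intro folded_on_affine) (auto simp: XB)
  have "c1 (p + h) = c2 (p + h)" using assms by (simp add: c1_def c2_def)
  then have "folded_on \<mu> p (p + 2 * h) (\<lambda>s. if s \<le> p + h then c1 s else c2 s)"
    using assms by (intro folded_on_concat[OF c1 c2]) simp_all
  moreover have "c1 p = A" "c2 (p + 2 * h) = B" "p \<le> p + h" "\<not> p + 2 * h \<le> p + h"
    using assms(2) by (simp_all add: c1_def c2_def)
  ultimately show thesis using that by simp
qed

text \<open>Put a tent over each stretch of length \<open>2 * h\<close>. It agrees with
  \<open>f\<close> at its start, and both move by at most \<open>2 * \<mu> * h\<close> along the
  stretch, which gives the 4.\<close>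

lemma folded_on_approx:
  fixes f :: "real \<Rightarrow> complex"
  assumes "\<mu> > 0" "h > 0" "\<mu>-lipschitz_on {p..p + 2 * h * real n} f"
  shows "\<exists>c. folded_on \<mu> p (p + 2 * h * real n) c \<and> c p = f p \<and>
    c (p + 2 * h * real n) = f (p + 2 * h * real n) \<and>
    (\<forall>s\<in>{p..p + 2 * h * real n}. dist (c s) (f s) \<le> 4 * \<mu> * h)"
  using assms(3)
proof (induction n arbitrary: p)
  case 0
  have "folded_on \<mu> p p f"
    unfolding folded_on_def
  proof (intro conjI exI[of _ "{p}"])
    show "\<mu>-lipschitz_on {p..p} f" by (rule lipschitz_onI) (use assms(1) in auto)
  qed auto
  moreover have "4 * \<mu> * h \<ge> 0" using assms by simp
  ultimately show ?case by (intro exI[of _ f]) simp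
next
  case (Suc n)
  let ?q = "p + 2 * h" and ?w = "p + 2 * h * real (Suc n)"
  have w: "?w = ?q + 2 * h * real n" by (simp add: algebra_simps)
  have qw: "p \<le> ?q" "?q \<le> ?w" unfolding w using assms by auto
  have "\<mu>-lipschitz_on {?q..?w} f"
    by (rule lipschitz_on_subset[OF Suc.prems]) (use assms in auto)
  then obtain d where d: "folded_on \<mu> ?q ?w d" "d ?q = f ?q" "d ?w = f ?w"
    "\<forall>s\<in>{?q..?w}. dist (d s) (f s) \<le> 4 * \<mu> * h"
    using Suc.IH[of ?q] unfolding w by blast
  have lip: "dist (f s) (f t) \<le> \<mu> * \<bar>s - t\<bar>" if "s \<in> {p..?w}" "t \<in> {p..?w}" for s t
    using lipschitz_onD[OF Suc.prems that] by (simp add: dist_real_def)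
  have "dist (f p) (f ?q) \<le> 2 * \<mu> * h" using lip[of p ?q] qw assms by (auto simp: algebra_simps)
  then obtain c where c: "folded_on \<mu> p ?q c" "c p = f p" "c ?q = f ?q"
    using folded_on_tent[OF assms(1,2), of "f p" "f ?q" p] by metis
  let ?e = "\<lambda>s. if s \<le> ?q then c s else d s"
  have "dist (?e s) (f s) \<le> 4 * \<mu> * h" if s: "s \<in> {p..?w}" for s
  proof (cases "s \<le> ?q")
    case True
    have "dist (c s) (c p) \<le> \<mu> * (s - p)"
      using c(1) lipschitz_onD[of \<mu> "{p..?q}" c s p] s True by (auto simp: folded_on_def dist_real_def)
    moreover have "dist (f p) (f s) \<le> \<mu> * (s - p)" using lip[of p s] s qw by auto
    moreover have "\<mu> * (s - p) \<le> \<mu> * (2 * h)" using True assms by (intro mult_left_mono) auto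
    ultimately show ?thesis using True dist_triangle[of "c s" "f s" "c p"] c(2) by simp
  next
    case False then show ?thesis using d(4) s by auto
  qed
  moreover have "folded_on \<mu> p ?w ?e"
    by (rule folded_on_concat[OF c(1) d(1)]) (use c d qw in auto)
  moreover have "?e ?w = f ?w" using c d qw by auto
  moreover have "?e p = f p" using c qw by auto
  ultimately show ?case by blast
qed

text \<open>Constant on the two end stretches of length \<open>r\<close>; the middle is spread over
  \<open>{0..l}\<close> at slope \<open>l / (l - 2 * r)\<close>, which tends to 1 as
  \<open>r\<close> shrinks.\<close>

definition collapse_ends :: "real \<Rightarrow> real \<Rightarrow> real \<Rightarrow> real" where
  "collapse_ends l r s = max 0 (min l ((s - r) * (l / (l - 2 * r))))"

text \<open>Values prescribed along an edge of length \<open>l\<close> on which the given map is \<open>\<gamma>\<close>. Within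
  distance \<open>r\<close> of a vertex they depend only on the distance to it, so that all edges at that vertex
  agree there; farther away two edges are so far apart that the error \<open>2 * \<eta>\<close> is absorbed by the
  slack between the Lipschitz constants of \<open>\<gamma>\<close> and of the folded curves. Collapsing the ends of the
  edge first allows \<open>\<eta>\<close> to be much smaller than \<open>r\<close>.\<close>

definition edge_curve :: "real \<Rightarrow> real \<Rightarrow> real \<Rightarrow> real \<Rightarrow> real \<Rightarrow> (real \<Rightarrow> complex) \<Rightarrow> (real \<Rightarrow> complex) \<Rightarrow> bool" where
  "edge_curve \<mu> r u \<eta> l \<gamma> c \<longleftrightarrow> folded_on \<mu> 0 l c \<and>
     (\<forall>s\<in>{0..l}. dist (c s) (\<gamma> (collapse_ends l r s)) \<le> \<eta>) \<and>
     (\<forall>s\<in>{0..r}. c s = \<gamma> 0 + of_real (\<mu> * triangle_wave u s)) \<and>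
     (\<forall>s\<in>{0..r}. c (l - s) = \<gamma> l + of_real (\<mu> * triangle_wave u s))"

text \<open>A wave on either end and a folded approximation in the middle. By
  \<open>r = 2 * u * real k\<close> the wave has completed whole periods and is back at the vertex
  value where the middle starts; the bound on \<open>L\<close> absorbs the slope of the
  collapse.\<close>

lemma edge_curve_exists:
  fixes \<gamma> :: "real \<Rightarrow> complex"
  assumes "u > 0" "r = 2 * u * real k" "2 * r < l" "\<mu> > 0" "\<mu> * u \<le> \<eta>"
    and \<gamma>: "L-lipschitz_on {0..l} \<gamma>" and L: "L * (l / (l - 2 * r)) \<le> \<mu>"
  obtains c where "edge_curve \<mu> r u \<eta> l \<gamma> c"
proof -
  let ?a = "l / (l - 2 * r)" and ?K = "collapse_ends l r"
  have r: "0 \<le> r" using assms by simp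
  have l: "0 < l" "0 < l - 2 * r" using assms(3) r by linarith+
  have L0: "L \<ge> 0" using \<gamma> by (simp add: lipschitz_on_def)
  have a: "0 < ?a" using l by simp
  have \<eta>: "\<eta> > 0" using assms mult_pos_pos[of \<mu> u] by linarith
  have Kin: "?K s \<in> {0..l}" for s using l by (auto simp: collapse_ends_def)
  have Klip: "\<bar>?K s - ?K t\<bar> \<le> ?a * \<bar>s - t\<bar>" for s t
  proof -
    have "\<bar>?K s - ?K t\<bar> \<le> \<bar>(s - r) * ?a - (t - r) * ?a\<bar>" unfolding collapse_ends_def
      by linarith
    also have "(s - r) * ?a - (t - r) * ?a = ?a * (s - t)"
      by (simp only: left_diff_distrib right_diff_distrib mult.commute)
    also have "\<bar>?a * (s - t)\<bar> = ?a * \<bar>s - t\<bar>" using a by (simp only: abs_mult abs_of_pos)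
    finally show ?thesis .
  qed
  have gk: "\<mu>-lipschitz_on S (\<gamma> \<circ> ?K)" for S
  proof (rule lipschitz_onI)
    fix s t
    have "dist (\<gamma> (?K s)) (\<gamma> (?K t)) \<le> L * \<bar>?K s - ?K t\<bar>"
      using lipschitz_onD[OF \<gamma> Kin Kin] by (simp add: dist_real_def)
    also have "\<dots> \<le> L * (?a * \<bar>s - t\<bar>)" using Klip L0 by (intro mult_left_mono) auto
    also have "\<dots> \<le> \<mu> * \<bar>s - t\<bar>"
      using mult_right_mono[OF L, of "\<bar>s - t\<bar>"] by (simp only: mult.assoc)
    finally show "dist ((\<gamma> \<circ> ?K) s) ((\<gamma> \<circ> ?K) t) \<le> \<mu> * dist s t"
      by (simp add: dist_real_def)
  qed (use assms in simp)
  have K0: "?K s = 0" if "s \<le> r" for s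
  proof -
    have "(s - r) * ?a \<le> 0" using that a by (intro mult_nonpos_nonneg) auto
    then show ?thesis using l by (simp add: collapse_ends_def)
  qed
  have Kl: "?K s = l" if "s \<ge> l - r" for s
  proof -
    have "(l - 2 * r) * ?a \<le> (s - r) * ?a" using that a by (intro mult_right_mono) auto
    moreover have "(l - 2 * r) * ?a = l" using l by simp
    ultimately show ?thesis using l by (simp add: collapse_ends_def)
  qed
  define n where "n = nat \<lceil>2 * \<mu> * (l - 2 * r) / \<eta>\<rceil> + 1"
  have n: "real n > 0" "2 * \<mu> * (l - 2 * r) / \<eta> \<le> real n" unfolding n_def by linarith+
  define h where "h = (l - 2 * r) / (2 * real n)"
  have h: "h > 0" "2 * h * real n = l - 2 * r" "4 * \<mu> * h \<le> \<eta>"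
    using n l \<eta> by (auto simp: h_def field_simps)
  have end': "r + 2 * h * real n = l - r" using h by simp
  obtain m where m: "folded_on \<mu> r (l - r) m" "m r = (\<gamma> \<circ> ?K) r" "m (l - r) = (\<gamma> \<circ> ?K) (l - r)"
    "\<forall>s\<in>{r..l - r}. dist (m s) ((\<gamma> \<circ> ?K) s) \<le> 4 * \<mu> * h"
    using folded_on_approx[OF assms(4) h(1) gk, of r n] unfolding end' by blast
  then have m: "folded_on \<mu> r (l - r) m" "m r = \<gamma> 0" "m (l - r) = \<gamma> l"
    "\<And>s. s \<in> {r..l - r} \<Longrightarrow> dist (m s) (\<gamma> (?K s)) \<le> \<eta>"
    using h(3) K0[of r] Kl[of "l - r"] by (simp_all add: order_trans[OF _ h(3)])
  define T where "T P s = P + complex_of_real (\<mu> * triangle_wave u s)" for P s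
  have Tr: "T P r = P" for P using triangle_wave_even[OF assms(1), of "int k"] assms(2) by (simp add: T_def)
  have Td: "dist (T P s) P \<le> \<eta>" for P s
  proof -
    have "norm (complex_of_real (\<mu> * triangle_wave u s)) \<le> \<mu> * u"
      using triangle_wave_bounds[OF assms(1), of s] assms(4) unfolding norm_of_real
      by (simp add: abs_mult)
    then show ?thesis using assms(5) by (simp add: T_def dist_norm)
  qed
  have T1: "folded_on \<mu> 0 r (T P)" for P
    using folded_on_triangle_wave[OF assms(1), of \<mu> "2 * k" P] assms unfolding T_def
      by (simp add: mult_ac)
  have T2: "folded_on \<mu> (l - r) l (\<lambda>s. T (\<gamma> l) (l - s))"
    using folded_on_reflect[OF T1, of l "\<gamma> l"] by simp
  define e where "e s = (if s \<le> r then T (\<gamma> 0) s else m s)" for s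
  define c where "c s = (if s \<le> l - r then e s else T (\<gamma> l) (l - s))" for s
  have "folded_on \<mu> 0 (l - r) e" unfolding e_def
    by (rule folded_on_concat[OF T1 m(1)]) (use Tr m r l in auto)
  then have "folded_on \<mu> 0 l c" unfolding c_def
    by (rule folded_on_concat[OF _ T2]) (use Tr m r l in \<open>auto simp: e_def\<close>)
  moreover have "dist (c s) (\<gamma> (?K s)) \<le> \<eta>" if "s \<in> {0..l}" for s
    using that m(4) Td by (auto simp: c_def e_def K0 Kl)
  moreover have "c s = T (\<gamma> 0) s" if "s \<in> {0..r}" for s using that l by (auto simp: c_def e_def)
  moreover have "c (l - s) = T (\<gamma> l) s" if s: "s \<in> {0..r}" for s
  proof (cases "s = r")
    case True
    then show ?thesis using l m Tr by (auto simp: c_def e_def)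
  qed (use s in \<open>auto simp: c_def\<close>)
  ultimately show thesis using that[of c] unfolding T_def edge_curve_def by simp
qed

section \<open>Folding a flat triangle\<close>

definition pw_similarity :: "real \<Rightarrow> (complex \<Rightarrow> complex) \<Rightarrow> bool" where
  "pw_similarity \<mu> H \<longleftrightarrow> \<mu>-lipschitz_on UNIV H \<and>
     (\<forall>R. \<exists>\<C>. finite \<C> \<and> cball 0 R \<subseteq> \<Union>\<C> \<and>
        (\<forall>C\<in>\<C>. closed C \<and> (\<forall>x\<in>C. \<forall>y\<in>C. dist (H x) (H y) = \<mu> * dist x y)))"

lemma pw_similarity_scale:
  assumes "pw_isometry h" "\<mu> > 0"
  shows "pw_similarity \<mu> (\<lambda>x. \<mu> *\<^sub>R h x)"
proof -
  have d: "dist (\<mu> *\<^sub>R h x) (\<mu> *\<^sub>R h y) = \<mu> * dist (h x) (h y)" for x y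
    using assms(2) by (simp add: dist_norm flip: scaleR_diff_right)
  have "1-lipschitz_on UNIV h" using assms(1) by (simp add: pw_isometry_def)
  then have "\<mu>-lipschitz_on UNIV (\<lambda>x. \<mu> *\<^sub>R h x)"
    using assms(2) by (auto simp: lipschitz_on_def d)
  moreover have "\<exists>\<C>. finite \<C> \<and> cball 0 R \<subseteq> \<Union>\<C> \<and>
        (\<forall>C\<in>\<C>. closed C \<and> (\<forall>x\<in>C. \<forall>y\<in>C. dist (\<mu> *\<^sub>R h x) (\<mu> *\<^sub>R h y) = \<mu> * dist x y))" for R
    using assms(1) unfolding pw_isometry_def d by (metis (no_types, lifting))
  ultimately show ?thesis by (simp add: pw_similarity_def)
qed

text \<open>Brehm's theorem treats \<open>V\<close>. Every other \<open>x j\<close> lies between two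
  fully stretched points of \<open>V\<close>, so a \<open>\<mu>\<close>-Lipschitz map with the right
  values there has no choice at \<open>x j\<close>. Indices instead of points allow a position to be
  named twice, as a vertex is by its two edges.\<close>

lemma pw_similarity_extension:
  fixes x y :: "'j \<Rightarrow> complex"
  assumes "\<mu> > 0" and fin: "finite V" "V \<subseteq> J"
    and lip: "\<And>j k. j \<in> J \<Longrightarrow> k \<in> J \<Longrightarrow> dist (y j) (y k) \<le> \<mu> * dist (x j) (x k)"
    and seg: "\<And>j. j \<in> J \<Longrightarrow> \<exists>p\<in>V. \<exists>q\<in>V. x j \<in> closed_segment (x p) (x q) \<and>
                dist (y p) (y q) = \<mu> * dist (x p) (x q)"
  obtains H where "pw_similarity \<mu> H" "\<And>j. j \<in> J \<Longrightarrow> H (x j) = y j"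
proof -
  \<comment> \<open>Well defined on positions, since \<open>lip\<close> gives equal values to
    indices with the same position; division by \<open>\<mu>\<close> normalizes the ratio to
    1.\<close>
  define Y where "Y z = y (SOME j. j \<in> J \<and> x j = z) /\<^sub>R \<mu>" for z
  have Y: "Y (x j) = y j /\<^sub>R \<mu>" if "j \<in> J" for j
  proof -
    define k where "k = (SOME k. k \<in> J \<and> x k = x j)"
    have "k \<in> J \<and> x k = x j" unfolding k_def by (rule someI[of _ j]) (use that in simp)
    then have "dist (y k) (y j) \<le> 0" using lip[of k j] that by simp
    then show ?thesis by (simp add: Y_def flip: k_def)
  qed
  have "1-lipschitz_on (x ` V) Y"
  proof (rule lipschitz_onI)
    fix a b assume "a \<in> x ` V" "b \<in> x ` V"
    then obtain j k where jk: "j \<in> J" "k \<in> J" "a = x j" "b = x k" using fin by blast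
    have "dist (Y a) (Y b) = dist (y j) (y k) / \<mu>"
      using assms(1) by (simp add: jk Y dist_norm divide_inverse mult.commute flip: scaleR_diff_right)
    also have "\<dots> \<le> dist a b" using lip[OF jk(1,2)] assms(1)
      by (simp add: jk pos_divide_le_eq mult.commute)
    finally show "dist (Y a) (Y b) \<le> 1 * dist a b" by simp
  qed simp
  then obtain h where h: "pw_isometry h" "\<And>z. z \<in> x ` V \<Longrightarrow> h z = Y z"
    using pw_isometry_extension[of "x ` V"] fin pw_isometry_exists by blast
  define H where "H z = \<mu> *\<^sub>R h z" for z
  have H: "pw_similarity \<mu> H" unfolding H_def by (rule pw_similarity_scale[OF h(1) assms(1)])
  have HV: "H (x p) = y p" if "p \<in> V" for p
  proof -
    have "h (x p) = y p /\<^sub>R \<mu>" using h(2)[of "x p"] Y[of p] that fin(2) by auto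
    then show ?thesis using assms(1) by (simp add: H_def)
  qed
  have Hlip: "dist (H a) (H b) \<le> \<mu> * dist a b" for a b
    using H lipschitz_onD[of \<mu> UNIV H a b] by (simp add: pw_similarity_def)
  have "H (x j) = y j" if j: "j \<in> J" for j
  proof -
    obtain p q where pq: "p \<in> V" "q \<in> V" "x j \<in> closed_segment (x p) (x q)"
      "dist (y p) (y q) = \<mu> * dist (x p) (x q)" using seg[OF j] by blast
    obtain t where t: "0 \<le> t" "t \<le> 1" "x j = (1 - t) *\<^sub>R x p + t *\<^sub>R x q"
      using pq(3) unfolding closed_segment_def by blast
    have "x j - x p = t *\<^sub>R (x q - x p)" "x q - x j = (1 - t) *\<^sub>R (x q - x p)"
      by (simp_all add: t(3) algebra_simps)
    then have d: "dist (x j) (x p) = t * dist (x p) (x q)" "dist (x q) (x j) = (1 - t) * dist (x p) (x q)"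
      using t(1,2) by (simp_all add: dist_norm norm_minus_commute)
    have "Z - y p = t *\<^sub>R (y q - y p)"
      if "dist Z (y p) \<le> \<mu> * dist (x j) (x p)" "dist (y q) Z \<le> \<mu> * dist (x q) (x j)" for Z
    proof (rule segment_point_eq[OF _ _ t(1,2)])
      have n: "norm (y q - y p) = \<mu> * dist (x p) (x q)" using pq(4)
        by (simp add: dist_norm norm_minus_commute)
      show "norm (Z - y p) \<le> t * norm (y q - y p)" "norm (y q - y p - (Z - y p)) \<le> (1 - t) * norm (y q - y p)"
        using that unfolding n d by (simp_all add: dist_norm mult_ac)
    qed
    from this[of "H (x j)"] this[of "y j"]
    have "H (x j) - y p = y j - y p"
      using Hlip[of "x j" "x p"] Hlip[of "x q" "x j"] lip[of j p] lip[of q j] HV pq(1,2) fin(2) j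
      by (auto simp: subset_iff)
    then show ?thesis by simp
  qed
  then show thesis using that H by blast
qed

section \<open>Two folded edges at a common vertex\<close>

lemma norm_ray_diff:
  fixes e e' :: "'a::real_inner"
  assumes "norm e = 1" "norm e' = 1"
  shows "norm (s *\<^sub>R e - t *\<^sub>R e')^2 = (s - t)^2 + s * t * norm (e - e')^2"
proof -
  have "e \<bullet> e = 1" "e' \<bullet> e' = 1" using assms by (simp_all add: norm_eq_1)
  then show ?thesis unfolding power2_norm_eq_inner
    by (simp add: inner_diff inner_commute algebra_simps power2_eq_square)
qed

text \<open>Both terms in \<open>norm_ray_diff\<close> are monotone. The case of interest is
  \<open>a = max 0 (s - r)\<close> and \<open>b = max 0 (t - r)\<close>: moving both points towards
  the vertex by the same amount does not part them.\<close>

lemma norm_ray_diff_mono: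
  fixes e e' :: "'a::real_inner"
  assumes "norm e = 1" "norm e' = 1" "0 \<le> a" "a \<le> s" "0 \<le> b" "b \<le> t" "\<bar>a - b\<bar> \<le> \<bar>s - t\<bar>"
  shows "norm (a *\<^sub>R e - b *\<^sub>R e') \<le> norm (s *\<^sub>R e - t *\<^sub>R e')"
proof (rule power2_le_imp_le)
  have "(a - b)^2 \<le> (s - t)^2" using assms(7) by (simp add: abs_le_square_iff)
  moreover have "a * b * norm (e - e')^2 \<le> s * t * norm (e - e')^2"
    using assms by (intro mult_right_mono mult_mono) auto
  ultimately show "norm (a *\<^sub>R e - b *\<^sub>R e')^2 \<le> norm (s *\<^sub>R e - t *\<^sub>R e')^2"
    unfolding norm_ray_diff[OF assms(1,2)] by linarith
qed simp

lemma collapse_ends_reflect: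
  assumes "0 < l" "2 * r < l"
  shows "collapse_ends l r (l - s) = l - collapse_ends l r s"
proof -
  have "(l - s - r) * (l / (l - 2 * r)) = l - (s - r) * (l / (l - 2 * r))"
    using assms by (simp add: field_simps)
  moreover have "max 0 (min l (l - z)) = l - max 0 (min l z)" for z
    using assms(1) by (auto simp: max_def min_def)
  ultimately show ?thesis unfolding collapse_ends_def by simp
qed

lemma collapse_ends_range: "0 < l \<Longrightarrow> collapse_ends l r s \<in> {0..l}"
  by (auto simp: collapse_ends_def)

lemma edge_curve_reflect:
  assumes "edge_curve \<mu> r u \<eta> l \<gamma> c" "0 < l" "2 * r < l"
  shows "edge_curve \<mu> r u \<eta> l (\<lambda>s. \<gamma> (l - s)) (\<lambda>s. c (l - s))"
  unfolding edge_curve_def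
proof (intro conjI ballI)
  show "folded_on \<mu> 0 l (\<lambda>s. c (l - s))"
    using folded_on_reflect[of \<mu> 0 l c l] assms(1) by (simp add: edge_curve_def)
  show "dist (c (l - s)) (\<gamma> (l - collapse_ends l r s)) \<le> \<eta>" if "s \<in> {0..l}" for s
  proof -
    have "l - s \<in> {0..l}" using that by auto
    then have "dist (c (l - s)) (\<gamma> (collapse_ends l r (l - s))) \<le> \<eta>"
      using assms(1) by (simp add: edge_curve_def del: atLeastAtMost_iff)
    then show ?thesis by (simp add: collapse_ends_reflect[OF assms(2,3)])
  qed
qed (use assms in \<open>auto simp: edge_curve_def\<close>)

text \<open>The shift \<open>max 0 (s - r)\<close> does not mention \<open>l\<close>, so it is a
  common reference for edges of different lengths at one vertex. The error is proportional to
  \<open>s\<close>, hence harmless near the vertex.\<close>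

lemma collapse_ends_near:
  assumes "0 < l" "0 \<le> r" "2 * r < l" "l / (l - 2 * r) \<le> 1 + \<theta>" "s \<in> {0..l}"
  shows "\<bar>collapse_ends l r s - max 0 (s - r)\<bar> \<le> \<theta> * s"
proof -
  let ?a = "l / (l - 2 * r)"
  have a: "1 \<le> ?a" using assms by (simp add: field_simps)
  have \<theta>: "0 \<le> \<theta>" using a assms(4) by linarith
  consider "s \<le> r" | "r < s" "s \<le> l - r" | "l - r < s" by linarith
  then show ?thesis
  proof cases
    case 1
    then have "(s - r) * ?a \<le> 0" using a by (intro mult_nonpos_nonneg) auto
    then have "collapse_ends l r s = 0" using assms by (simp add: collapse_ends_def)
    then show ?thesis using 1 \<theta> assms by simp
  next
    case 2
    have "(s - r) * ?a \<le> (l - 2 * r) * ?a" using 2 a by (intro mult_right_mono) auto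
    also have "\<dots> = l" using assms by simp
    finally have "(s - r) * ?a \<le> l" .
    moreover have "0 \<le> (s - r) * ?a" using 2 a by (intro mult_nonneg_nonneg) auto
    ultimately have "collapse_ends l r s = (s - r) * ?a" using assms by (simp add: collapse_ends_def)
    then have "\<bar>collapse_ends l r s - max 0 (s - r)\<bar> = \<bar>(s - r) * (?a - 1)\<bar>"
      using 2 by (simp add: algebra_simps)
    also have "\<dots> = (s - r) * (?a - 1)" using 2 a by (intro abs_of_nonneg mult_nonneg_nonneg) auto
    also have "\<dots> \<le> s * \<theta>" using 2 a assms by (intro mult_mono) auto
    finally show ?thesis by (simp add: mult.commute)
  next
    case 3
    have "(l - 2 * r) * ?a \<le> (s - r) * ?a" using 3 a by (intro mult_right_mono) auto
    moreover have "(l - 2 * r) * ?a = l" using assms by simp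
    ultimately have "collapse_ends l r s = l" using assms by (simp add: collapse_ends_def)
    then have "\<bar>collapse_ends l r s - max 0 (s - r)\<bar> = l - (s - r)" using 3 assms by auto
    also have "\<dots> \<le> 2 * r" using 3 by simp
    \<comment> \<open>\<open>?a - 1\<close> equals \<open>2 * r / (l - 2 * r)\<close>, so over a
      stretch of length \<open>l - r\<close> the excess slope makes up for the lag
      \<open>2 * r\<close>.\<close>
    also have "\<dots> \<le> (?a - 1) * (l - r)"
    proof -
      have "(?a - 1) * (l - r) = 2 * r * ((l - r) / (l - 2 * r))" using assms by (simp add: field_simps)
      moreover have "2 * r * 1 \<le> 2 * r * ((l - r) / (l - 2 * r))"
        using assms by (intro mult_left_mono) auto
      ultimately show ?thesis by simp
    qed
    also have "\<dots> \<le> \<theta> * s" using 3 \<theta> assms by (intro mult_mono) simp_all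
    finally show ?thesis .
  qed
qed

text \<open>A quantitative positive angle between the rays: a point far from the vertex on one ray
  is far from the other ray.\<close>

definition ray_gap :: "real \<Rightarrow> complex \<Rightarrow> complex \<Rightarrow> bool" where
  "ray_gap K a b \<longleftrightarrow> (\<forall>s\<ge>0. \<forall>t\<ge>0. max s t \<le> K * norm (s *\<^sub>R a - t *\<^sub>R b))"

text \<open>Within \<open>r\<close> of the vertex both curves are the same wave, and
  \<open>\<bar>s - t\<bar>\<close> bounds everything. Otherwise the points are at least
  \<open>r / K\<close> apart: collapsing raises the constant from \<open>L\<close> to at most
  \<open>L2\<close>, and the two approximation errors fit into the remaining
  \<open>\<mu> - L2\<close> over that distance.\<close>

lemma edge_curves_at_vertex:
  fixes e e' :: complex
  assumes e: "norm e = 1" "norm e' = 1"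
    and K: "ray_gap K e e'" "K > 0"
    and c: "edge_curve \<mu> r u \<eta> l \<gamma> c" "edge_curve \<mu> r u \<eta> l' \<gamma>' c'" "\<gamma> 0 = \<gamma>' 0"
    and l: "0 < r" "2 * r < l" "2 * r < l'" "l / (l - 2 * r) \<le> 1 + \<theta>" "l' / (l' - 2 * r) \<le> 1 + \<theta>"
    and \<gamma>: "\<And>s t. s \<in> {0..l} \<Longrightarrow> t \<in> {0..l'} \<Longrightarrow> dist (\<gamma> s) (\<gamma>' t) \<le> L * norm (s *\<^sub>R e - t *\<^sub>R e')"
    and num: "0 \<le> L" "0 \<le> \<mu>" "L * (1 + 2 * K * \<theta>) \<le> L2" "2 * \<eta> \<le> (\<mu> - L2) * (r / K)" "L2 \<le> \<mu>"
    and st: "s \<in> {0..l}" "t \<in> {0..l'}"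
  shows "dist (c s) (c' t) \<le> \<mu> * norm (s *\<^sub>R e - t *\<^sub>R e')"
proof (cases "s \<le> r \<and> t \<le> r")
  case True
  have "c s = \<gamma> 0 + of_real (\<mu> * triangle_wave u s)"
    "c' t = \<gamma> 0 + of_real (\<mu> * triangle_wave u t)"
    using c True st by (auto simp: edge_curve_def)
  then have "c s - c' t = complex_of_real (\<mu> * (triangle_wave u s - triangle_wave u t))"
    by (simp add: algebra_simps)
  then have "dist (c s) (c' t) = \<mu> * \<bar>triangle_wave u s - triangle_wave u t\<bar>"
    using num unfolding dist_norm by (simp only: norm_of_real abs_mult abs_of_nonneg)
  also have "\<bar>triangle_wave u s - triangle_wave u t\<bar> \<le> \<bar>s - t\<bar>"
    by (rule triangle_wave_lipschitz)
  also have "\<bar>s - t\<bar> \<le> norm (s *\<^sub>R e - t *\<^sub>R e')"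
    using norm_triangle_ineq3[of "s *\<^sub>R e" "t *\<^sub>R e'"] st e by simp
  finally show ?thesis using num by (simp add: mult_left_mono)
next
  case False
  let ?d = "norm (s *\<^sub>R e - t *\<^sub>R e')"
  define a b where "a = collapse_ends l r s" and "b = collapse_ends l' r t"
  have mx: "max s t \<le> K * ?d" using K(1) st by (simp add: ray_gap_def)
  have "r \<le> K * ?d" using False mx by auto
  then have rd: "r / K \<le> ?d" using K(2) by (simp add: pos_divide_le_eq mult.commute)
  have lp: "0 < l" "0 < l'" using l by auto
  have ab: "a \<in> {0..l}" "b \<in> {0..l'}" unfolding a_def b_def by (intro collapse_ends_range lp)+
  have near: "\<bar>a - max 0 (s - r)\<bar> \<le> \<theta> * s" "\<bar>b - max 0 (t - r)\<bar> \<le> \<theta> * t"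
    unfolding a_def b_def by (intro collapse_ends_near; use l lp st in simp)+
  have "1 \<le> l / (l - 2 * r)" using l by (simp add: field_simps)
  then have \<theta>: "0 \<le> \<theta>" using l by linarith
  have "\<theta> * s \<le> \<theta> * (K * ?d)" "\<theta> * t \<le> \<theta> * (K * ?d)" using mx \<theta>
    by (auto intro!: mult_left_mono)
  with near have n2: "\<bar>a - max 0 (s - r)\<bar> \<le> K * \<theta> * ?d" "\<bar>b - max 0 (t - r)\<bar> \<le> K * \<theta> * ?d"
    by (simp_all add: mult_ac)
  \<comment> \<open>The first summand is the common shift towards the vertex, which does not
    increase the distance; the second holds the errors of the collapse, each at most
    \<open>K * \<theta>\<close> times the distance.\<close>
  have "a *\<^sub>R e - b *\<^sub>R e' = (max 0 (s - r) *\<^sub>R e - max 0 (t - r) *\<^sub>R e')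
      + ((a - max 0 (s - r)) *\<^sub>R e - (b - max 0 (t - r)) *\<^sub>R e')"
    by (simp add: algebra_simps)
  also have "norm \<dots> \<le> norm (max 0 (s - r) *\<^sub>R e - max 0 (t - r) *\<^sub>R e')
      + (norm ((a - max 0 (s - r)) *\<^sub>R e) + norm ((b - max 0 (t - r)) *\<^sub>R e'))"
    by (intro order_trans[OF norm_triangle_ineq] add_left_mono norm_triangle_ineq4)
  also have "norm (max 0 (s - r) *\<^sub>R e - max 0 (t - r) *\<^sub>R e') \<le> ?d"
    by (rule norm_ray_diff_mono) (use e l st in auto)
  also have "norm ((a - max 0 (s - r)) *\<^sub>R e) \<le> K * \<theta> * ?d"
    using n2(1) e by (simp only: norm_scaleR mult_1_right)
  also have "norm ((b - max 0 (t - r)) *\<^sub>R e') \<le> K * \<theta> * ?d"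
    using n2(2) e by (simp only: norm_scaleR mult_1_right)
  also have "?d + (K * \<theta> * ?d + K * \<theta> * ?d) = (1 + 2 * K * \<theta>) * ?d"
    by (simp only: algebra_simps)
  finally have "norm (a *\<^sub>R e - b *\<^sub>R e') \<le> (1 + 2 * K * \<theta>) * ?d" by simp
  then have "L * norm (a *\<^sub>R e - b *\<^sub>R e') \<le> L * ((1 + 2 * K * \<theta>) * ?d)"
    using num by (intro mult_left_mono) auto
  also have "\<dots> \<le> L2 * ?d" using mult_right_mono[OF num(3), of ?d] by (simp add: mult.assoc)
  finally have g: "dist (\<gamma> a) (\<gamma>' b) \<le> L2 * ?d" using \<gamma>[OF ab] by linarith
  have "dist (c s) (\<gamma> a) \<le> \<eta>" "dist (c' t) (\<gamma>' b) \<le> \<eta>"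
    using c st by (simp_all add: edge_curve_def a_def b_def)
  moreover have "dist (c s) (c' t) \<le> dist (c s) (\<gamma> a) + dist (\<gamma> a) (\<gamma>' b) + dist (c' t) (\<gamma>' b)"
    using dist_triangle[of "c s" "c' t" "\<gamma> a"] dist_triangle[of "\<gamma> a" "c' t" "\<gamma>' b"]
    by (simp add: dist_commute)
  moreover have "2 * \<eta> \<le> (\<mu> - L2) * ?d"
    using num(4) mult_left_mono[OF rd, of "\<mu> - L2"] num(5) by linarith
  ultimately show ?thesis using g by (simp add: algebra_simps)
qed

text \<open>One choice for all edges of length at least \<open>l0\<close>: edges that meet in a
  vertex must carry the same wave there, whatever their lengths.\<close>

definition fold_params :: "real \<Rightarrow> real \<Rightarrow> real \<Rightarrow> real \<Rightarrow> real \<Rightarrow> real \<Rightarrow> real \<Rightarrow> bool" where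
  "fold_params L \<mu> K l0 r u \<eta> \<longleftrightarrow> 0 < r \<and> 0 \<le> L \<and> 0 < \<mu> \<and> 0 < K \<and> (\<forall>l\<ge>l0. 2 * r < l) \<and>
     (\<exists>\<theta> L2. (\<forall>l\<ge>l0. l / (l - 2 * r) \<le> 1 + \<theta>) \<and> L * (1 + 2 * K * \<theta>) \<le> L2 \<and>
        2 * \<eta> \<le> (\<mu> - L2) * (r / K) \<and> L2 \<le> \<mu>)"

text \<open>Order of choice: \<open>L2\<close> halves the slack between \<open>L\<close> and
  \<open>\<mu>\<close>; \<open>\<theta>\<close> is so small that the collapse costs at most the
  first half; \<open>r\<close> follows from \<open>\<theta>\<close> and \<open>l0\<close>;
  \<open>\<eta>\<close> spends the second half at distance \<open>r / K\<close>; \<open>u\<close>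
  comes last, a fraction of \<open>r\<close> with \<open>\<mu> * u \<le> \<eta>\<close>.\<close>

lemma fold_params_exist:
  assumes "0 \<le> L" "L < \<mu>" "K \<ge> 1" "l0 > 0"
  obtains r u \<eta> where "fold_params L \<mu> K l0 r u \<eta>"
    "\<And>l \<gamma>. l \<ge> l0 \<Longrightarrow> L-lipschitz_on {0..l} \<gamma> \<Longrightarrow> \<exists>c. edge_curve \<mu> r u \<eta> l \<gamma> c"
proof -
  define L2 where "L2 = (L + \<mu>) / 2"
  have L2: "L < L2" "L2 < \<mu>" using assms by (auto simp: L2_def)
  define \<theta> where "\<theta> = (L2 - L) / (2 * K * (L + 1))"
  have \<theta>: "\<theta> > 0" using L2 assms by (simp add: \<theta>_def)
  have "2 * K * \<theta> = (L2 - L) / (L + 1)" using assms by (simp add: \<theta>_def)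
  then have "L * (2 * K * \<theta>) = (L2 - L) * (L / (L + 1))" by simp
  also have "\<dots> \<le> (L2 - L) * 1" using assms L2 by (intro mult_left_mono) auto
  finally have a1: "L * (1 + 2 * K * \<theta>) \<le> L2" by (simp add: algebra_simps)
  \<comment> \<open>Gives \<open>2 * r * (1 + \<theta>) < l * \<theta>\<close> for all
    \<open>l \<ge> l0\<close>, a rearrangement of
    \<open>l / (l - 2 * r) < 1 + \<theta>\<close>.\<close>
  define r where "r = l0 * \<theta> / (4 * (1 + \<theta>))"
  have r: "r > 0" using \<theta> assms by (simp add: r_def)
  have "4 * r * (1 + \<theta>) = l0 * \<theta>" using \<theta> by (simp add: r_def field_simps)
  then have r2: "2 * r * (1 + \<theta>) < l * \<theta>" if "l \<ge> l0" for l
    using mult_right_mono[OF that, of \<theta>] \<theta> r mult_pos_pos[OF r, of "1 + \<theta>"] by linarith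
  have r3: "2 * r < l" if "l \<ge> l0" for l
  proof -
    have "2 * r * (1 + \<theta>) < l * (1 + \<theta>)"
      using r2[OF that] \<theta> that assms mult_pos_pos[of l \<theta>] by (simp add: algebra_simps)
    then show ?thesis using \<theta> by simp
  qed
  have a2: "l / (l - 2 * r) \<le> 1 + \<theta>" if "l \<ge> l0" for l
    using r2[OF that] r3[OF that] by (simp add: pos_divide_le_eq algebra_simps)
  define \<eta> where "\<eta> = (\<mu> - L2) * (r / K) / 2"
  have \<eta>: "\<eta> > 0" using L2 r assms by (simp add: \<eta>_def)
  define k where "k = nat \<lceil>\<mu> * r / (2 * \<eta>)\<rceil> + 1"
  have k: "real k > 0" "\<mu> * r / (2 * \<eta>) \<le> real k" unfolding k_def by linarith+
  define u where "u = r / (2 * real k)"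
  have u: "u > 0" "r = 2 * u * real k" "\<mu> * u \<le> \<eta>" using r k \<eta>
    by (auto simp: u_def field_simps)
  show thesis
  proof (rule that)
    show "fold_params L \<mu> K l0 r u \<eta>"
      unfolding fold_params_def
      by (intro conjI exI[of _ \<theta>] exI[of _ L2] allI impI) (use r assms L2 a1 a2 r3 in \<open>auto simp: \<eta>_def\<close>)
    fix l and \<gamma> :: "real \<Rightarrow> complex" assume l: "l \<ge> l0" and \<gamma>: "L-lipschitz_on {0..l} \<gamma>"
    have "L * (l / (l - 2 * r)) \<le> L * (1 + 2 * K * \<theta>)"
    proof (rule mult_left_mono[OF order_trans[OF a2[OF l]] assms(1)])
      have "1 * \<theta> \<le> (2 * K) * \<theta>" using assms \<theta> by (intro mult_right_mono) auto
      then show "1 + \<theta> \<le> 1 + 2 * K * \<theta>" by simp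
    qed
    then have "L * (l / (l - 2 * r)) \<le> \<mu>" using a1 L2 by linarith
    moreover have "0 < \<mu>" using assms by simp
    ultimately show "\<exists>c. edge_curve \<mu> r u \<eta> l \<gamma> c"
      using edge_curve_exists[OF u(1,2) r3[OF l] _ u(3) \<gamma>] by blast
  qed
qed

lemma edge_curve_ends:
  assumes "edge_curve \<mu> r u \<eta> l \<gamma> c" "r \<ge> 0" shows "c 0 = \<gamma> 0" "c l = \<gamma> l"
proof -
  have "0 \<in> {0..r}" using assms by simp
  then have "c 0 = \<gamma> 0 + of_real (\<mu> * triangle_wave u 0)"
    "c (l - 0) = \<gamma> l + of_real (\<mu> * triangle_wave u 0)"
    using assms(1) unfolding edge_curve_def by blast+
  then show "c 0 = \<gamma> 0" "c l = \<gamma> l" by (simp_all add: triangle_wave_0)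
qed

definition edge_point :: "complex \<Rightarrow> complex \<Rightarrow> real \<Rightarrow> complex" where
  "edge_point A B s = A + s *\<^sub>R sgn (B - A)"

lemma edge_point_reflect: "A \<noteq> B \<Longrightarrow> edge_point A B (dist A B - s) = edge_point B A s"
proof -
  assume "A \<noteq> B"
  then have "dist A B *\<^sub>R sgn (B - A) = B - A" by (simp add: sgn_div_norm dist_norm norm_minus_commute)
  moreover have "sgn (A - B) = - sgn (B - A)" by (metis minus_diff_eq sgn_minus)
  ultimately show ?thesis by (simp add: edge_point_def algebra_simps)
qed

lemma dist_edge_point: "A \<noteq> B \<Longrightarrow> dist (edge_point A B s) (edge_point A B t) = \<bar>s - t\<bar>"
  by (simp add: edge_point_def dist_norm norm_sgn flip: scaleR_diff_left)

lemma edge_point_in_segment: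
  assumes "b \<le> s" "s \<le> b'"
  shows "edge_point A B s \<in> closed_segment (edge_point A B b) (edge_point A B b')"
proof (cases "b = b'")
  case False
  define t where "t = (s - b) / (b' - b)"
  have t: "0 \<le> t" "t \<le> 1" using assms False by (auto simp: t_def field_simps)
  have "t * (b' - b) = s - b" using assms False by (simp add: t_def)
  then have s: "s = (1 - t) * b + t * b'" by (simp add: algebra_simps)
  have "edge_point A B ((1 - t) * b + t * b') = (1 - t) *\<^sub>R edge_point A B b + t *\<^sub>R edge_point A B b'"
    by (simp add: edge_point_def algebra_simps)
  then have "edge_point A B s = (1 - t) *\<^sub>R edge_point A B b + t *\<^sub>R edge_point A B b'"
    unfolding s[symmetric] .
  then show ?thesis using t unfolding closed_segment_def by blast
qed (use assms in auto)

lemma edge_curves_meet: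
  assumes "fold_params L \<mu> K l0 r u \<eta>" "l0 \<le> dist A B" "l0 \<le> dist A C" "A \<noteq> B" "A \<noteq> C"
    and K: "ray_gap K (sgn (B - A)) (sgn (C - A))"
    and c: "edge_curve \<mu> r u \<eta> (dist A B) (g \<circ> edge_point A B) c" "edge_curve \<mu> r u \<eta> (dist A C) (g \<circ> edge_point A C) c'"
    and g: "\<And>s t. s \<in> {0..dist A B} \<Longrightarrow> t \<in> {0..dist A C} \<Longrightarrow>
              dist (g (edge_point A B s)) (g (edge_point A C t)) \<le> L * dist (edge_point A B s) (edge_point A C t)"
    and st: "s \<in> {0..dist A B}" "t \<in> {0..dist A C}"
  shows "dist (c s) (c' t) \<le> \<mu> * dist (edge_point A B s) (edge_point A C t)"
proof -
  obtain \<theta> L2 where num: "0 < r" "0 \<le> L" "0 < \<mu>" "0 < K" "\<And>l. l \<ge> l0 \<Longrightarrow> 2 * r < l"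
    "\<And>l. l \<ge> l0 \<Longrightarrow> l / (l - 2 * r) \<le> 1 + \<theta>" "L * (1 + 2 * K * \<theta>) \<le> L2"
    "2 * \<eta> \<le> (\<mu> - L2) * (r / K)" "L2 \<le> \<mu>"
    using assms(1) unfolding fold_params_def by blast
  have d: "dist (edge_point A B s) (edge_point A C t) = norm (s *\<^sub>R sgn (B - A) - t *\<^sub>R sgn (C - A))" for s t
    by (simp add: edge_point_def dist_norm)
  show ?thesis unfolding d
  proof (rule edge_curves_at_vertex[OF _ _ K num(4) c])
    show "dist ((g \<circ> edge_point A B) s) ((g \<circ> edge_point A C) t) \<le> L * norm (s *\<^sub>R sgn (B - A) - t *\<^sub>R sgn (C - A))"
      if "s \<in> {0..dist A B}" "t \<in> {0..dist A C}" for s t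
      using g[OF that] by (simp add: d)
  qed (use assms num in \<open>auto simp: norm_sgn edge_point_def\<close>)
qed

text \<open>Any two edges of a triangle share a vertex. With curves reversed so that both start
  there, \<open>edge_curves_meet\<close> compares them; within one edge the Lipschitz bound
  suffices. So the boundary values are short, and finitely many break points determine them.\<close>

lemma triangle_fill:
  fixes X0 X1 X2 :: complex
  assumes par: "fold_params L \<mu> K l0 r u \<eta>" and l0: "l0 > 0"
    and len: "l0 \<le> dist X0 X1" "l0 \<le> dist X1 X2" "l0 \<le> dist X0 X2"
    and K0: "ray_gap K (sgn (X1 - X0)) (sgn (X2 - X0))"
    and K1: "ray_gap K (sgn (X0 - X1)) (sgn (X2 - X1))"
    and K2: "ray_gap K (sgn (X1 - X2)) (sgn (X0 - X2))"
    and c: "edge_curve \<mu> r u \<eta> (dist X0 X1) (g \<circ> edge_point X0 X1) c01"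
      "edge_curve \<mu> r u \<eta> (dist X1 X2) (g \<circ> edge_point X1 X2) c12"
      "edge_curve \<mu> r u \<eta> (dist X0 X2) (g \<circ> edge_point X0 X2) c02"
    and T: "\<And>s. s \<in> {0..dist X0 X1} \<Longrightarrow> edge_point X0 X1 s \<in> T" "\<And>s. s \<in> {0..dist X1 X2} \<Longrightarrow> edge_point X1 X2 s \<in> T"
      "\<And>s. s \<in> {0..dist X0 X2} \<Longrightarrow> edge_point X0 X2 s \<in> T"
    and g: "\<And>x y. x \<in> T \<Longrightarrow> y \<in> T \<Longrightarrow> dist (g x) (g y) \<le> L * dist x y"
  obtains H where "pw_similarity \<mu> H"
    "\<And>s. s \<in> {0..dist X0 X1} \<Longrightarrow> H (edge_point X0 X1 s) = c01 s"
    "\<And>s. s \<in> {0..dist X1 X2} \<Longrightarrow> H (edge_point X1 X2 s) = c12 s"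
    "\<And>s. s \<in> {0..dist X0 X2} \<Longrightarrow> H (edge_point X0 X2 s) = c02 s"
proof -
  have ne: "X0 \<noteq> X1" "X1 \<noteq> X2" "X0 \<noteq> X2" using l0 len by auto
  have mu: "\<mu> > 0" and r2: "\<And>l. l \<ge> l0 \<Longrightarrow> 2 * r < l" using par
    by (auto simp: fold_params_def)
  have rev: "edge_curve \<mu> r u \<eta> (dist B A) (g \<circ> edge_point B A) (\<lambda>s. c (dist A B - s))"
    if "edge_curve \<mu> r u \<eta> (dist A B) (g \<circ> edge_point A B) c" "A \<noteq> B" "l0 \<le> dist A B" for A B c
    using edge_curve_reflect[OF that(1)] that(2,3) r2 by (simp add: edge_point_reflect dist_commute o_def)
  have revT: "edge_point B A s \<in> T"
    if "\<And>s. s \<in> {0..dist A B} \<Longrightarrow> edge_point A B s \<in> T" "A \<noteq> B" "s \<in> {0..dist B A}" for A B s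
    using that(1)[of "dist A B - s"] that(2,3) by (simp add: edge_point_reflect dist_commute)
  have same: "dist (c s) (c t) \<le> \<mu> * dist (edge_point A B s) (edge_point A B t)"
    if "edge_curve \<mu> r u \<eta> (dist A B) (g \<circ> edge_point A B) c" "A \<noteq> B" "s \<in> {0..dist A B}" "t \<in> {0..dist A B}" for A B c s t
    using that lipschitz_onD[of \<mu> "{0..dist A B}" c s t]
    by (simp add: edge_curve_def folded_on_def dist_edge_point dist_real_def)
  have p02: "dist (c01 s) (c02 t) \<le> \<mu> * dist (edge_point X0 X1 s) (edge_point X0 X2 t)"
    if "s \<in> {0..dist X0 X1}" "t \<in> {0..dist X0 X2}" for s t
    by (rule edge_curves_meet[OF par len(1,3) ne(1,3) K0 c(1,3) _ that]) (auto intro!: g T)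
  have p01: "dist (c01 s) (c12 t) \<le> \<mu> * dist (edge_point X0 X1 s) (edge_point X1 X2 t)"
    if "s \<in> {0..dist X0 X1}" "t \<in> {0..dist X1 X2}" for s t
  proof -
    have "dist (c01 (dist X0 X1 - s')) (c12 t) \<le> \<mu> * dist (edge_point X1 X0 s') (edge_point X1 X2 t)"
      if "s' \<in> {0..dist X1 X0}" for s'
      by (rule edge_curves_meet[OF par _ _ _ _ K1 rev[OF c(1) ne(1) len(1)] c(2) _ that \<open>t \<in> {0..dist X1 X2}\<close>])
        (use len ne T(2) revT[OF T(1) ne(1)] g in \<open>simp_all add: dist_commute\<close>)
    from this[of "dist X0 X1 - s"] show ?thesis
      using that(1) edge_point_reflect[OF ne(1)[symmetric], of s] by (simp add: dist_commute)
  qed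
  have p12: "dist (c12 s) (c02 t) \<le> \<mu> * dist (edge_point X1 X2 s) (edge_point X0 X2 t)"
    if "s \<in> {0..dist X1 X2}" "t \<in> {0..dist X0 X2}" for s t
  proof -
    have "dist (c12 (dist X1 X2 - s')) (c02 (dist X0 X2 - t')) \<le> \<mu> * dist (edge_point X2 X1 s') (edge_point X2 X0 t')"
      if "s' \<in> {0..dist X2 X1}" "t' \<in> {0..dist X2 X0}" for s' t'
      by (rule edge_curves_meet[OF par _ _ _ _ K2 rev[OF c(2) ne(2) len(2)] rev[OF c(3) ne(3) len(3)] _ that])
        (use len ne revT[OF T(2) ne(2)] revT[OF T(3) ne(3)] g in \<open>simp_all add: dist_commute\<close>)
    from this[of "dist X1 X2 - s" "dist X0 X2 - t"] show ?thesis
      using that edge_point_reflect[OF ne(2)[symmetric], of s] edge_point_reflect[OF ne(3)[symmetric], of t]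
      by (simp add: dist_commute)
  qed
  define A where "A k = (if k = 1 then X1 else X0)" for k :: nat
  define B where "B k = (if k = 0 then X1 else X2)" for k :: nat
  define c where "c k = (if k = 0 then c01 else if k = 1 then c12 else c02)" for k :: nat
  \<comment> \<open>A boundary point is addressed by an edge number and a parameter; each vertex has
    two addresses.\<close>
  define J where "J = {(k, s). k < (3::nat) \<and> s \<in> {0..dist (A k) (B k)}}"
  define x where "x j = edge_point (A (fst j)) (B (fst j)) (snd j)" for j
  define y where "y j = c (fst j) (snd j)" for j :: "nat \<times> real"
  have k3: "k = 0 \<or> k = 1 \<or> k = 2" if "k < (3::nat)" for k using that by auto
  have ce: "edge_curve \<mu> r u \<eta> (dist (A k) (B k)) (g \<circ> edge_point (A k) (B k)) (c k)" "A k \<noteq> B k" if "k < 3" for k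
    using k3[OF that] c ne by (auto simp: A_def B_def c_def)
  have "\<exists>V. finite V \<and> V \<subseteq> {0..dist (A k) (B k)} \<and>
        (\<forall>s\<in>{0..dist (A k) (B k)}. \<exists>b\<in>V. \<exists>b'\<in>V. b \<le> s \<and> s \<le> b' \<and> dist (c k b) (c k b') = \<mu> * (b' - b))"
    if "k < 3" for k
    using ce[OF that] by (simp add: edge_curve_def folded_on_def)
  then obtain W where W: "\<And>k. k < 3 \<Longrightarrow> finite (W k)" "\<And>k. k < 3 \<Longrightarrow> W k \<subseteq> {0..dist (A k) (B k)}"
    "\<And>k s. k < 3 \<Longrightarrow> s\<in>{0..dist (A k) (B k)} \<Longrightarrow> \<exists>b\<in>W k. \<exists>b'\<in>W k. b \<le> s \<and> s \<le> b' \<and> dist (c k b) (c k b') = \<mu> * (b' - b)"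
    by metis
  have lip: "dist (y j) (y k) \<le> \<mu> * dist (x j) (x k)" if jk: "j \<in> J" "k \<in> J" for j k
  proof -
    obtain j1 s k1 t where jk': "j = (j1, s)" "k = (k1, t)" by (cases j, cases k) blast
    have lt: "j1 < 3" "k1 < 3" "s \<in> {0..dist (A j1) (B j1)}" "t \<in> {0..dist (A k1) (B k1)}"
      using jk by (auto simp: jk' J_def)
    show ?thesis
    proof (cases "j1 = k1")
      case True
      then show ?thesis using same[OF ce(1)[OF lt(1)] ce(2)[OF lt(1)] lt(3)] lt
        by (simp add: x_def y_def jk' del: atLeastAtMost_iff)
    next
      case False
      then consider "j1 = 0" "k1 = 1" | "j1 = 0" "k1 = 2" | "j1 = 1" "k1 = 2"
        | "j1 = 1" "k1 = 0" | "j1 = 2" "k1 = 0" | "j1 = 2" "k1 = 1"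
        using k3[OF lt(1)] k3[OF lt(2)] by blast
      then show ?thesis
        using lt(3,4) p01[of s t] p02[of s t] p12[of s t] p01[of t s] p02[of t s] p12[of t s]
        by cases (simp_all add: x_def y_def jk' A_def B_def c_def dist_commute)
    qed
  qed
  have fin: "finite (SIGMA k:{..<3}. W k)" using W(1) by (intro finite_SigmaI) auto
  have sub: "(SIGMA k:{..<3}. W k) \<subseteq> J" using W(2) by (fastforce simp: J_def)
  have seg: "\<exists>p\<in>(SIGMA k:{..<3}. W k). \<exists>q\<in>(SIGMA k:{..<3}. W k). x j \<in> closed_segment (x p) (x q) \<and>
                dist (y p) (y q) = \<mu> * dist (x p) (x q)" if jJ: "j \<in> J" for j
  proof -
    obtain k s where j: "j = (k, s)" "k < 3" "s \<in> {0..dist (A k) (B k)}" using jJ by (auto simp: J_def)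
    obtain b b' where b: "b \<in> W k" "b' \<in> W k" "b \<le> s" "s \<le> b'" "dist (c k b) (c k b') = \<mu> * (b' - b)"
      using W(3)[OF j(2,3)] by blast
    show ?thesis
    proof (rule bexI[of _ "(k, b)"], rule bexI[of _ "(k, b')"], rule conjI)
      show "x j \<in> closed_segment (x (k, b)) (x (k, b'))"
        by (simp add: x_def j edge_point_in_segment b)
      show "dist (y (k, b)) (y (k, b')) = \<mu> * dist (x (k, b)) (x (k, b'))"
        using b by (simp add: y_def x_def dist_edge_point[OF ce(2)[OF j(2)]])
    qed (use b j in auto)
  qed
  obtain H where H: "pw_similarity \<mu> H" "\<And>j. j \<in> J \<Longrightarrow> H (x j) = y j"
    using pw_similarity_extension[OF mu fin sub lip seg] by blast
  show thesis
    by (rule that[OF H(1)])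
      (use H(2)[of "(0, _)"] H(2)[of "(1, _)"] H(2)[of "(2, _)"] in
        \<open>simp_all add: J_def x_def y_def A_def B_def c_def\<close>)
qed

section \<open>Folding a triangulated square\<close>

text \<open>\<open>(i, j, b)\<close> stands for half of the unit square with lower left corner
  \<open>(i, j)\<close>, cut along the rising diagonal; \<open>b\<close> selects the half above
  it.\<close>

type_synonym cell = "int \<times> int \<times> bool"

definition corner :: "cell \<Rightarrow> complex" where
  "corner T = Complex (of_int (fst T)) (of_int (fst (snd T)))"
definition leg1 :: "cell \<Rightarrow> complex" where "leg1 T = (if snd (snd T) then \<i> else 1)"
definition leg2 :: "cell \<Rightarrow> complex" where "leg2 T = (if snd (snd T) then 1 else \<i>)"

definition tri :: "cell \<Rightarrow> complex set" where
  "tri T = {p. (let x = Re p - of_int (fst T); y = Im p - of_int (fst (snd T)) in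
      if snd (snd T) then 0 \<le> x \<and> x \<le> y \<and> y \<le> 1 else 0 \<le> y \<and> y \<le> x \<and> x \<le> 1)}"

definition edges :: "cell \<Rightarrow> (complex \<times> complex) set" where
  "edges T = {(corner T, leg1 T), (corner T + leg1 T, leg2 T), (corner T, 1 + \<i>)}"

lemma edge_in_tri: "(v, d) \<in> edges T \<Longrightarrow> 0 \<le> t \<Longrightarrow> t \<le> 1 \<Longrightarrow> v + t *\<^sub>R d \<in> tri T"
  by (cases T) (auto simp: edges_def tri_def corner_def leg1_def leg2_def Let_def split: if_splits)

lemma edges_lattice:
  assumes "(v, d) \<in> edges T"
  shows "\<exists>a b. v = Complex (of_int a) (of_int b)" "d \<in> {1, \<i>, 1 + \<i>}"
proof -
  obtain i j b where T: "T = (i, j, b)" by (cases T)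
  show "d \<in> {1, \<i>, 1 + \<i>}" using assms by (auto simp: edges_def leg1_def leg2_def split: if_splits)
  have "v = Complex (of_int i) (of_int j) \<or> v = Complex (of_int (i + 1)) (of_int j) \<or> v = Complex (of_int i) (of_int (j + 1))"
    using assms by (auto simp: T edges_def corner_def leg1_def leg2_def complex_eq_iff split: if_splits)
  then show "\<exists>a b. v = Complex (of_int a) (of_int b)" by blast
qed

lemma int_frac_unique:
  fixes t t' :: real
  assumes "of_int a + t = of_int b + t'" "0 < t" "t < 1" "0 \<le> t'" "t' \<le> 1"
  shows "a = b \<and> t = t'"
proof -
  have "real_of_int (a - b) < 1" "real_of_int (a - b) > -1" using assms unfolding of_int_diff by linarith+
  then have "a - b < 1" "a - b > -1" by linarith+
  then have "a = b" by linarith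
  then show ?thesis using assms(1) by simp
qed

lemma int_frac_False:
  fixes t :: real
  shows "of_int a + t = of_int b \<Longrightarrow> 0 < t \<Longrightarrow> t < 1 \<Longrightarrow> False"
  using int_frac_unique[of a t b 0] by auto

lemma lattice_edge_unique_aux:
  assumes v: "v = Complex (of_int a) (of_int b)" "v' = Complex (of_int a') (of_int b')"
    and d: "d \<in> {1, \<i>, 1 + \<i>}" "d' \<in> {1, \<i>, 1 + \<i>}"
    and t: "0 < t" "t < 1" "0 \<le> t'" "t' \<le> 1"
    and eq: "v + t *\<^sub>R d = v' + t' *\<^sub>R d'"
  shows "v = v' \<and> d = d' \<and> t = t'"
proof -
  have re: "of_int a + t * Re d = of_int a' + t' * Re d'" and im: "of_int b + t * Im d = of_int b' + t' * Im d'"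
    using eq by (auto simp: v complex_eq_iff)
  have fu: "x = y \<and> t = t'" if "real_of_int x + t = of_int y + t'" for x y
    using int_frac_unique[OF that t] .
  have ff: False if "real_of_int x + t = of_int y" for x y using int_frac_False[OF that t(1,2)] .
  have fi: "t' = 0 \<or> t' = 1" if "real_of_int x = of_int y + t'" for x y
    using int_frac_False[of y t' x] that t(3,4) by force
  show ?thesis
    using d by (elim insertE emptyE)
      (use re im fu[of a a'] fu[of b b'] ff[of a a'] ff[of a "a' + 1"] ff[of b b'] ff[of b "b' + 1"]
        fi[of a a'] fi[of b b'] in \<open>auto simp: v\<close>)
qed

text \<open>Inside an edge just the first coordinate, just the second, or both are fractional,
  according to the direction, and the fractional part is the parameter. So only end points can
  belong to different edges.\<close>

lemma lattice_edge_unique: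
  assumes "(v, d) \<in> edges T" "(v', d') \<in> edges S" "t \<in> {0..1}" "t' \<in> {0..1}"
    and eq: "v + t *\<^sub>R d = v' + t' *\<^sub>R d'"
  shows "v = v' \<and> d = d' \<and> t = t' \<or> t \<in> {0, 1} \<and> t' \<in> {0, 1}"
proof -
  obtain a b where v: "v = Complex (of_int a) (of_int b)" using edges_lattice(1)[OF assms(1)] by blast
  obtain a' b' where v': "v' = Complex (of_int a') (of_int b')" using edges_lattice(1)[OF assms(2)] by blast
  note d = edges_lattice(2)[OF assms(1)] edges_lattice(2)[OF assms(2)]
  consider "0 < t \<and> t < 1" | "0 < t' \<and> t' < 1" | "t \<in> {0, 1} \<and> t' \<in> {0, 1}"
    using assms(3,4) by force
  then show ?thesis
  proof cases
    case 1 then show ?thesis using lattice_edge_unique_aux[OF v v' d _ _ _ _ eq] assms by auto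
  next
    case 2 then show ?thesis using lattice_edge_unique_aux[OF v' v d(2,1) _ _ _ _ eq[symmetric]] assms by auto
  qed blast
qed

text \<open>Off the edges of \<open>T\<close>, the integer parts of the coordinates recover the
  square, and comparing the fractional parts recovers the half.\<close>

lemma tri_overlap:
  assumes "p \<in> tri T" "p \<in> tri S" "T \<noteq> S"
  shows "\<exists>v d t. (v, d) \<in> edges T \<and> t \<in> {0..1} \<and> p = v + t *\<^sub>R d"
proof -
  obtain i j b where T: "T = (i, j, b)" by (cases T)
  obtain k l c where S: "S = (k, l, c)" by (cases S)
  define x y where "x = Re p - of_int i" and "y = Im p - of_int j"
  have p: "p = Complex (of_int i + x) (of_int j + y)" by (simp add: x_def y_def)
  have t: "if b then 0 \<le> x \<and> x \<le> y \<and> y \<le> 1 else 0 \<le> y \<and> y \<le> x \<and> x \<le> 1"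
    using assms(1) by (cases b) (simp_all add: T tri_def x_def y_def Let_def)
  have ex: ?thesis if "(v, d) \<in> edges T" "s \<in> {0..1}" "p = v + s *\<^sub>R d" for v d s using that
    by blast
  show ?thesis
  proof (cases "0 < x \<and> 0 < y \<and> x < 1 \<and> y < 1 \<and> x \<noteq> y")
    case True
    have s: "if c then 0 \<le> Re p - of_int k \<and> Re p - of_int k \<le> Im p - of_int l \<and> Im p - of_int l \<le> 1
       else 0 \<le> Im p - of_int l \<and> Im p - of_int l \<le> Re p - of_int k \<and> Re p - of_int k \<le> 1"
      using assms(2) by (cases c) (simp_all add: S tri_def Let_def)
    have "i = k" using int_frac_unique[of i x k "Re p - of_int k"] True s
      by (simp add: x_def split: if_splits)
    moreover have "j = l" using int_frac_unique[of j y l "Im p - of_int l"] True s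
      by (simp add: y_def split: if_splits)
    moreover have "b = c" using True s t calculation by (auto simp: x_def y_def split: if_splits)
    ultimately show ?thesis using assms(3) T S by simp
  next
    case False
    show ?thesis
    proof (cases b)
      case True
      then have "x = 0 \<or> y = 1 \<or> x = y" using t False by force
      then show ?thesis
        using True t ex[of "corner T" "leg1 T" y] ex[of "corner T + leg1 T" "leg2 T" x]
          ex[of "corner T" "1 + \<i>" x]
        by (auto simp: edges_def p corner_def leg1_def leg2_def T complex_eq_iff)
    next
      case b: False
      then have "y = 0 \<or> x = 1 \<or> x = y" using t False by force
      then show ?thesis
        using b t ex[of "corner T" "leg1 T" x] ex[of "corner T + leg1 T" "leg2 T" y]
          ex[of "corner T" "1 + \<i>" x]
        by (auto simp: edges_def p corner_def leg1_def leg2_def T complex_eq_iff)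
    qed
  qed
qed

lemma closed_tri: "closed (tri T)"
  by (cases "snd (snd T)")
    (auto simp: tri_def Let_def intro!: closed_Collect_conj closed_Collect_le continuous_intros)

lemma bounded_tri: "bounded (tri T)"
proof -
  have "norm p \<le> \<bar>of_int (fst T)\<bar> + \<bar>of_int (fst (snd T))\<bar> + 2"
    if "p \<in> tri T" for p
    using that cmod_le[of p] by (auto simp: tri_def Let_def split: if_splits)
  then show ?thesis by (auto simp: bounded_iff)
qed

text \<open>A linear map within a factor 2 of scaling by \<open>\<rho>\<close> keeps angles away
  from zero. Origin of 12: the images have norm at most \<open>2 * \<rho> * (3/2)\<close>, the gap
  of \<open>d\<close> and \<open>d'\<close> costs 2, and the lower bound \<open>\<rho> / 2\<close>
  divides.\<close>

lemma linear_ray_angle: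
  fixes M :: "complex \<Rightarrow> complex"
  assumes M: "linear M" "\<rho> > 0" "\<And>w. \<rho> / 2 * norm w \<le> norm (M w)" "\<And>w. norm (M w) \<le> 2 * \<rho> * norm w"
    and d: "ray_gap 2 d d'"
    and nd: "0 < norm d" "norm d \<le> 3/2" "0 < norm d'" "norm d' \<le> 3/2"
  shows "ray_gap 12 (sgn (M d)) (sgn (M d'))"
  unfolding ray_gap_def
proof (intro allI impI)
  fix s t :: real assume st: "s \<ge> 0" "t \<ge> 0"
  have pos: "0 < norm (M w)" if "0 < norm w" for w
    using M(2) M(3)[of w] that mult_pos_pos[of "\<rho>/2" "norm w"] by linarith
  define a b where "a = s / norm (M d)" and "b = t / norm (M d')"
  have ab: "0 \<le> a" "0 \<le> b" using st by (auto simp: a_def b_def)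
  have s: "s = a * norm (M d)" "t = b * norm (M d')" using pos[OF nd(1)] pos[OF nd(3)]
    by (auto simp: a_def b_def)
  have "norm (M d) \<le> 3 * \<rho>" "norm (M d') \<le> 3 * \<rho>"
    using M(4)[of d] M(4)[of d'] mult_left_mono[OF nd(2), of "2 * \<rho>"] mult_left_mono[OF nd(4), of "2 * \<rho>"] M(2) by linarith+
  then have "s \<le> max a b * (3 * \<rho>)" "t \<le> max a b * (3 * \<rho>)" unfolding s using ab
    by (auto intro!: mult_mono)
  then have 1: "max s t \<le> 3 * \<rho> * max a b" by (simp add: mult.commute)
  have "s *\<^sub>R sgn (M d) - t *\<^sub>R sgn (M d') = M (a *\<^sub>R d - b *\<^sub>R d')"
    by (simp add: linear_diff[OF M(1)] linear_scale[OF M(1)] a_def b_def sgn_div_norm divide_inverse)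
  moreover have "\<rho> / 2 * (max a b / 2) \<le> \<rho> / 2 * norm (a *\<^sub>R d - b *\<^sub>R d')"
    using d[unfolded ray_gap_def, rule_format, OF ab] M(2) by (intro mult_left_mono) auto
  ultimately show "max s t \<le> 12 * norm (s *\<^sub>R sgn (M d) - t *\<^sub>R sgn (M d'))"
    using 1 M(3)[of "a *\<^sub>R d - b *\<^sub>R d'"] by simp
qed

lemma grid_angles:
  "ray_gap 2 (leg1 T) (1 + \<i>)" "ray_gap 2 (- leg1 T) (leg2 T)" "ray_gap 2 (- leg2 T) (- (1 + \<i>))"
proof -
  have *: "max s t \<le> 2 * norm z" if "max s t \<le> \<bar>Re z\<bar> + \<bar>Im z\<bar>" for z s t
    using that abs_Re_le_cmod[of z] abs_Im_le_cmod[of z] by linarith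
  show "ray_gap 2 (leg1 T) (1 + \<i>)" "ray_gap 2 (- leg1 T) (leg2 T)" "ray_gap 2 (- leg2 T) (- (1 + \<i>))"
    unfolding ray_gap_def by (intro allI impI *; auto simp: leg1_def leg2_def)+
qed

lemma grid_norms: "norm (leg1 T) = 1" "norm (leg2 T) = 1" "0 < norm (1 + \<i>)" "norm (1 + \<i>) \<le> 3/2"
proof -
  have "norm (1 + \<i>) = sqrt 2" by (simp add: cmod_def)
  moreover have "sqrt 2 \<le> 3/2" by (rule real_le_lsqrt) (simp_all add: power2_eq_square)
  ultimately show "0 < norm (1 + \<i>)" "norm (1 + \<i>) \<le> 3/2" by simp_all
qed (auto simp: leg1_def leg2_def)

text \<open>Each cell carries a flat metric \<open>norm (M T w)\<close>; adjacent cells give their common edge the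
  same length, so the folded edge fits both.\<close>

lemma grid_fill:
  fixes I :: "cell set" and M :: "cell \<Rightarrow> complex \<Rightarrow> complex" and \<rho> :: "cell \<Rightarrow> real"
    and len :: "complex \<Rightarrow> complex \<Rightarrow> real" and g :: "complex \<Rightarrow> complex"
  assumes I: "finite I" and L: "0 \<le> L" "L < \<mu>"
    and lin: "\<And>T. T \<in> I \<Longrightarrow> linear (M T)" and \<rho>: "\<And>T. T \<in> I \<Longrightarrow> \<rho> T > 0"
    and lo: "\<And>T w. T \<in> I \<Longrightarrow> \<rho> T / 2 * norm w \<le> norm (M T w)"
    and hi: "\<And>T w. T \<in> I \<Longrightarrow> norm (M T w) \<le> 2 * \<rho> T * norm w"
    and len: "\<And>T v d. T \<in> I \<Longrightarrow> (v, d) \<in> edges T \<Longrightarrow> norm (M T d) = len v d"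
    and g: "\<And>T x y. T \<in> I \<Longrightarrow> x \<in> tri T \<Longrightarrow> y \<in> tri T \<Longrightarrow> dist (g x) (g y) \<le> L * norm (M T (x - y))"
  obtains G where "\<And>T. T \<in> I \<Longrightarrow> G (corner T) = g (corner T)"
    "\<And>T x y. T \<in> I \<Longrightarrow> x \<in> tri T \<Longrightarrow> y \<in> tri T \<Longrightarrow> dist (G x) (G y) \<le> \<mu> * norm (M T (x - y))"
    "\<And>T. T \<in> I \<Longrightarrow> \<exists>\<C>. finite \<C> \<and> tri T = \<Union>\<C> \<and> (\<forall>C\<in>\<C>. closed C \<and>
        (\<forall>x\<in>C. \<forall>y\<in>C. dist (G x) (G y) = \<mu> * norm (M T (x - y))))"
proof -
  \<comment> \<open>Below all edge lengths, as grid edges have norm at least 1; the inserted 1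
    covers an empty \<open>I\<close>.\<close>
  define l0 where "l0 = Min (insert 1 ((\<lambda>T. \<rho> T / 2) ` I))"
  have l0: "l0 > 0" unfolding l0_def using I \<rho> by (subst Min_gr_iff) auto
  have l0_le: "l0 \<le> \<rho> T / 2" if "T \<in> I" for T unfolding l0_def using I that
    by (intro Min_le) auto
  have normd: "1 \<le> norm d" "d \<noteq> 0" if "(v, d) \<in> edges T" for v d T
  proof -
    have "1 \<le> norm (1 + \<i>)" using abs_Re_le_cmod[of "1 + \<i>"] by simp
    then show "1 \<le> norm d" using that grid_norms(1,2)[of T] by (auto simp: edges_def)
    then show "d \<noteq> 0" by auto
  qed
  have l0_len: "l0 \<le> len v d" if "T \<in> I" "(v, d) \<in> edges T" for T v d
  proof -
    have "\<rho> T / 2 * 1 \<le> \<rho> T / 2 * norm d" using normd[OF that(2)] \<rho>[OF that(1)]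
      by (intro mult_left_mono) auto
    then show ?thesis using lo[OF that(1), of d] l0_le[OF that(1)] len[OF that] by linarith
  qed
  have K: "(12::real) \<ge> 1" by simp
  obtain r u \<eta> where par: "fold_params L \<mu> 12 l0 r u \<eta>"
    and ex: "\<And>l \<gamma>. l \<ge> l0 \<Longrightarrow> L-lipschitz_on {0..l} \<gamma> \<Longrightarrow> \<exists>c. edge_curve \<mu> r u \<eta> l \<gamma> c"
    by (rule fold_params_exist[OF L K l0]) blast
  have r: "0 < r" using par by (simp add: fold_params_def)
  define \<gamma> where "\<gamma> v d s = g (v + (s / len v d) *\<^sub>R d)" for v d s
  \<comment> \<open>Chosen for the edge alone and not for a cell; this is why the fillings of
    adjacent cells match.\<close>
  define c where "c v d = (SOME c. edge_curve \<mu> r u \<eta> (len v d) (\<gamma> v d) c)" for v d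
  have c: "edge_curve \<mu> r u \<eta> (len v d) (\<gamma> v d) (c v d)"
    if T: "T \<in> I" "(v, d) \<in> edges T" for T v d
  proof -
    have "L-lipschitz_on {0..len v d} (\<gamma> v d)"
    proof (rule lipschitz_onI)
      fix s t assume st: "s \<in> {0..len v d}" "t \<in> {0..len v d}"
    have lp: "len v d > 0" using l0 l0_len[OF T] by linarith
    have "dist (\<gamma> v d s) (\<gamma> v d t) \<le> L * norm (M T ((v + (s / len v d) *\<^sub>R d) - (v + (t / len v d) *\<^sub>R d)))"
      unfolding \<gamma>_def by (intro g[OF T(1)] edge_in_tri[OF T(2)]) (use st lp in auto)
    also have "(v + (s / len v d) *\<^sub>R d) - (v + (t / len v d) *\<^sub>R d) = ((s - t) / len v d) *\<^sub>R d"
      by (simp add: diff_divide_distrib scaleR_left_diff_distrib)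
    also have "norm (M T (((s - t) / len v d) *\<^sub>R d)) = dist s t"
      using lp by (simp add: linear_scale[OF lin[OF T(1)]] len[OF T] dist_real_def)
    finally show "dist (\<gamma> v d s) (\<gamma> v d t) \<le> L * dist s t" .
    qed (use L in simp)
    from ex[OF l0_len[OF T] this] show ?thesis unfolding c_def by (rule someI_ex)
  qed
  have c01: "c v d 0 = g v" "c v d (len v d) = g (v + d)" if T: "T \<in> I" "(v, d) \<in> edges T" for T v d
    using edge_curve_ends[OF c[OF T]] r l0 l0_len[OF T] by (simp_all add: \<gamma>_def)
  have "\<exists>H. pw_similarity \<mu> H \<and>
      (\<forall>v d t. (v, d) \<in> edges T \<longrightarrow> t \<in> {0..1} \<longrightarrow> H (M T (v + t *\<^sub>R d)) = c v d (t * len v d))"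
    if T: "T \<in> I" for T
  proof -
    interpret M: linear "M T" by (rule lin[OF T])
    have inj: "inj (M T)"
    proof (rule injI)
      fix x y assume "M T x = M T y"
      then have "M T (x - y) = 0" by (simp add: M.diff)
      then show "x = y" using lo[OF T, of "x - y"] \<rho>[OF T] by (simp add: mult_le_0_iff)
    qed
    let ?g = "g \<circ> inv (M T)"
    have inv: "inv (M T) (M T w) = w" for w by (rule inv_f_f[OF inj])
    let ?v0 = "corner T" and ?v1 = "corner T + leg1 T" and ?v2 = "corner T + (1 + \<i>)"
    have E: "(?v0, leg1 T) \<in> edges T" "(?v1, leg2 T) \<in> edges T" "(?v0, 1 + \<i>) \<in> edges T"
      by (simp_all add: edges_def)
    let ?X0 = "M T ?v0" and ?X1 = "M T ?v1" and ?X2 = "M T ?v2"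
    let ?on = "\<lambda>H A B c. \<forall>s\<in>{0..dist A B}. H (edge_point A B s) = c s"
    have v2: "?v1 + leg2 T = ?v2" by (simp add: leg1_def leg2_def)
    have dM: "dist (M T v) (M T (v + d)) = len v d" if "(v, d) \<in> edges T" for v d
      using len[OF T that] by (simp add: M.add dist_norm)
    have pM: "edge_point (M T v) (M T (v + d)) s = M T (v + (s / len v d) *\<^sub>R d)"
      if "(v, d) \<in> edges T" for v d s
      using len[OF T that] by (simp add: edge_point_def M.add M.scale sgn_div_norm divide_inverse)
    have gM: "?g \<circ> edge_point (M T v) (M T (v + d)) = \<gamma> v d" if "(v, d) \<in> edges T" for v d
      by (rule ext) (simp add: pM[OF that] inv \<gamma>_def)
    have cM: "edge_curve \<mu> r u \<eta> (dist (M T v) (M T (v + d))) (?g \<circ> edge_point (M T v) (M T (v + d))) (c v d)"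
      if "(v, d) \<in> edges T" for v d
      unfolding dM[OF that] gM[OF that] by (rule c[OF T that])
    have TM: "edge_point (M T v) (M T (v + d)) s \<in> M T ` tri T"
      if "(v, d) \<in> edges T" "s \<in> {0..dist (M T v) (M T (v + d))}" for v d s
      unfolding pM[OF that(1)] using that(2) l0 l0_len[OF T that(1)]
      by (intro imageI edge_in_tri[OF that(1)]) (simp_all add: dM[OF that(1)])
    note ang = linear_ray_angle[OF lin[OF T] \<rho>[OF T] lo[OF T] hi[OF T]]
    have s1: "?X1 - ?X0 = M T (leg1 T)" "?X2 - ?X0 = M T (1 + \<i>)"
      "?X0 - ?X1 = M T (- leg1 T)" "?X2 - ?X1 = M T (leg2 T)"
      "?X1 - ?X2 = M T (- leg2 T)" "?X0 - ?X2 = M T (- (1 + \<i>))"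
      unfolding M.diff[symmetric] by (rule arg_cong[of _ _ "M T"]; simp add: leg1_def leg2_def)+
    have "\<exists>H. pw_similarity \<mu> H \<and> ?on H ?X0 ?X1 (c ?v0 (leg1 T)) \<and>
        ?on H ?X1 ?X2 (c ?v1 (leg2 T)) \<and> ?on H ?X0 ?X2 (c ?v0 (1 + \<i>))"
    proof (rule triangle_fill[OF par l0])
      show "l0 \<le> dist ?X0 ?X1" "l0 \<le> dist ?X1 ?X2" "l0 \<le> dist ?X0 ?X2"
        using l0_len[OF T E(1)] l0_len[OF T E(2)] l0_len[OF T E(3)] dM[OF E(1)] dM[OF E(2)] dM[OF E(3)]
        by (simp_all add: v2)
      show "edge_curve \<mu> r u \<eta> (dist ?X0 ?X1) (?g \<circ> edge_point ?X0 ?X1) (c ?v0 (leg1 T))"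
        by (rule cM[OF E(1)])
      show "edge_curve \<mu> r u \<eta> (dist ?X1 ?X2) (?g \<circ> edge_point ?X1 ?X2) (c ?v1 (leg2 T))"
        by (rule cM[OF E(2), unfolded v2])
      show "edge_curve \<mu> r u \<eta> (dist ?X0 ?X2) (?g \<circ> edge_point ?X0 ?X2) (c ?v0 (1 + \<i>))"
        by (rule cM[OF E(3)])
      show "edge_point ?X0 ?X1 s \<in> M T ` tri T" if "s \<in> {0..dist ?X0 ?X1}" for s
        by (rule TM[OF E(1) that])
      show "edge_point ?X1 ?X2 s \<in> M T ` tri T" if "s \<in> {0..dist ?X1 ?X2}" for s
        by (rule TM[OF E(2), unfolded v2, OF that])
      show "edge_point ?X0 ?X2 s \<in> M T ` tri T" if "s \<in> {0..dist ?X0 ?X2}" for s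
        by (rule TM[OF E(3) that])
      show "dist (?g x) (?g y) \<le> L * dist x y" if "x \<in> M T ` tri T" "y \<in> M T ` tri T" for x y
        using that g[OF T] by (auto simp: inv dist_norm M.diff)
      show "ray_gap 12 (sgn (?X1 - ?X0)) (sgn (?X2 - ?X0))"
        unfolding s1 by (rule ang[OF grid_angles(1)]) (use grid_norms in auto)
      show "ray_gap 12 (sgn (?X0 - ?X1)) (sgn (?X2 - ?X1))"
        unfolding s1 by (rule ang[OF grid_angles(2)]) (use grid_norms in \<open>auto simp del: minus_add_distrib\<close>)
      show "ray_gap 12 (sgn (?X1 - ?X2)) (sgn (?X0 - ?X2))"
        unfolding s1 by (rule ang[OF grid_angles(3)])
          (unfold norm_minus_cancel grid_norms(1,2), use grid_norms(3,4) in simp_all)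
    qed blast
    then obtain H where H: "pw_similarity \<mu> H" "?on H ?X0 ?X1 (c ?v0 (leg1 T))"
        "?on H ?X1 ?X2 (c ?v1 (leg2 T))" "?on H ?X0 ?X2 (c ?v0 (1 + \<i>))" by blast
    have H': "?on H (M T v) (M T (v + d)) (c v d)"
      if "(v, d) \<in> edges T" for v d
    proof -
      have "(v, d) = (?v0, leg1 T) \<or> (v, d) = (?v1, leg2 T) \<or> (v, d) = (?v0, 1 + \<i>)"
        using that by (simp add: edges_def)
      then show ?thesis using H(2) H(3)[folded v2] H(4) by (elim disjE) (simp_all del: atLeastAtMost_iff)
    qed
    have "H (M T (v + t *\<^sub>R d)) = c v d (t * len v d)"
      if "(v, d) \<in> edges T" "t \<in> {0..1}" for v d t
    proof -
      have lp: "len v d > 0" using l0 l0_len[OF T that(1)] by linarith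
      have "t * len v d \<in> {0..dist (M T v) (M T (v + d))}"
        using that(2) lp mult_right_mono[of t 1 "len v d"] by (simp add: dM[OF that(1)])
      then have "H (edge_point (M T v) (M T (v + d)) (t * len v d)) = c v d (t * len v d)"
        using H'[OF that(1)] by blast
      then show ?thesis using lp by (simp add: pM[OF that(1)])
    qed
    then show ?thesis using H(1) by blast
  qed
  then obtain H where H: "\<And>T. T \<in> I \<Longrightarrow> pw_similarity \<mu> (H T)"
    and Hc: "\<And>T v d t. T \<in> I \<Longrightarrow> (v, d) \<in> edges T \<Longrightarrow> t \<in> {0..1} \<Longrightarrow>
      H T (M T (v + t *\<^sub>R d)) = c v d (t * len v d)"
    by metis
  \<comment> \<open>Two cells meet in edge points only. Either both see the same edge and parameter,
    hence the same value of \<open>c\<close>, or the point is a vertex for both and both values are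
    \<open>g p\<close>.\<close>
  have cons: "H T (M T p) = H S (M S p)"
    if TS: "T \<in> I" "S \<in> I" "p \<in> tri T" "p \<in> tri S" for T S p
  proof (cases "T = S")
    case False
    obtain v d t where 1: "(v, d) \<in> edges T" "t \<in> {0..1}" "p = v + t *\<^sub>R d"
      using tri_overlap[OF TS(3,4) False] by blast
    obtain v' d' t' where 2: "(v', d') \<in> edges S" "t' \<in> {0..1}" "p = v' + t' *\<^sub>R d'"
      using tri_overlap[OF TS(4,3)] False by blast
    have *: "H T (M T p) = c v d (t * len v d)" "H S (M S p) = c v' d' (t' * len v' d')"
      using Hc[OF TS(1) 1(1,2)] Hc[OF TS(2) 2(1,2)] 1(3) 2(3) by simp_all
    have "v = v' \<and> d = d' \<and> t = t' \<or> t \<in> {0, 1} \<and> t' \<in> {0, 1}"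
      using lattice_edge_unique[OF 1(1) 2(1) 1(2) 2(2)] 1(3) 2(3) by simp
    then show ?thesis
    proof
      assume tt: "t \<in> {0, 1} \<and> t' \<in> {0, 1}"
      have "c v d (t * len v d) = g p" using tt c01[OF TS(1) 1(1)] 1(3) by auto
      moreover have "c v' d' (t' * len v' d') = g p" using tt c01[OF TS(2) 2(1)] 2(3) by auto
      ultimately show ?thesis using * by simp
    qed (use * in simp)
  qed simp
  define G where "G p = (let T = SOME T. T \<in> I \<and> p \<in> tri T in H T (M T p))" for p
  have G: "G p = H T (M T p)" if "T \<in> I" "p \<in> tri T" for T p
  proof -
    have "(SOME T. T \<in> I \<and> p \<in> tri T) \<in> I \<and> p \<in> tri (SOME T. T \<in> I \<and> p \<in> tri T)"
      by (rule someI[of _ T]) (use that in simp)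
    then show ?thesis unfolding G_def Let_def using cons that by blast
  qed
  show thesis
  proof (rule that)
    fix T assume T: "T \<in> I"
    interpret M: linear "M T" by (rule lin[OF T])
    have E: "(corner T, 1 + \<i>) \<in> edges T" by (simp add: edges_def)
    have "corner T \<in> tri T" using edge_in_tri[OF E, of 0] by simp
    then show "G (corner T) = g (corner T)"
      using Hc[OF T E, of 0] c01[OF T E] by (simp add: G[OF T])
    show "dist (G x) (G y) \<le> \<mu> * norm (M T (x - y))" if "x \<in> tri T" "y \<in> tri T" for x y
    proof -
      have "\<mu>-lipschitz_on UNIV (H T)" using H[OF T] by (simp add: pw_similarity_def)
      from lipschitz_onD[OF this, of "M T x" "M T y"] show ?thesis
        by (simp add: G[OF T] that dist_norm M.diff)
    qed
    obtain R where R: "\<And>p. p \<in> tri T \<Longrightarrow> norm p \<le> R" using bounded_tri[of T]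
      by (auto simp: bounded_iff)
    obtain \<C> where \<C>: "finite \<C>" "cball 0 (2 * \<rho> T * R) \<subseteq> \<Union>\<C>"
      "\<forall>C\<in>\<C>. closed C \<and> (\<forall>x\<in>C. \<forall>y\<in>C. dist (H T x) (H T y) = \<mu> * dist x y)"
      using H[OF T] unfolding pw_similarity_def by blast
    have contM: "continuous_on UNIV (M T)"
      by (rule linear_continuous_on) (simp add: lin[OF T] linear_conv_bounded_linear[symmetric])
    show "\<exists>\<C>. finite \<C> \<and> tri T = \<Union>\<C> \<and> (\<forall>C\<in>\<C>. closed C \<and>
        (\<forall>x\<in>C. \<forall>y\<in>C. dist (G x) (G y) = \<mu> * norm (M T (x - y))))"
    proof (intro exI conjI ballI)
      let ?D = "(\<lambda>C. tri T \<inter> M T -` C) ` \<C>"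
      show "finite ?D" using \<C> by simp
      have "M T p \<in> \<Union>\<C>" if "p \<in> tri T" for p
      proof -
        have "norm (M T p) \<le> 2 * \<rho> T * R"
          using hi[OF T, of p] mult_left_mono[OF R[OF that], of "2 * \<rho> T"] \<rho>[OF T] by linarith
        then show ?thesis using \<C>(2) by auto
      qed
      then show "tri T = \<Union>?D" by auto
      fix D assume "D \<in> ?D"
      then obtain C where C: "C \<in> \<C>" "D = tri T \<inter> M T -` C" by auto
      then show "closed D" using \<C>(3) closed_vimage[OF _ contM] by (simp add: closed_Int[OF closed_tri])
      show "dist (G x) (G y) = \<mu> * norm (M T (x - y))" if "x \<in> D" "y \<in> D" for x y
        using that C \<C>(3) by (auto simp: G[OF T] dist_norm M.diff)
    qed
  qed
qed

section \<open>The chordal metric on a square, its flat models, and the improvement step\<close>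

definition square :: "complex set" where "square = {p. \<bar>Re p\<bar> \<le> 1 \<and> \<bar>Im p\<bar> \<le> 1}"

text \<open>The square of this is the conformal factor \<open>2 / (1 + (norm p)^2)\<close> of the
  round metric in stereographic coordinates; the root lets both end points contribute equally to
  \<open>cdist\<close>.\<close>

definition weight :: "complex \<Rightarrow> real" where "weight p = sqrt 2 / sqrt (1 + (norm p)^2)"

text \<open>The chordal distance of the unit sphere in stereographic coordinates, see \<open>cdist_stereo\<close> below.\<close>

definition cdist :: "complex \<Rightarrow> complex \<Rightarrow> real" where "cdist p q = weight p * weight q * dist p q"

lemma weight_pos: "weight p > 0"
  by (simp add: weight_def add_pos_nonneg)

lemma weight_le: "weight p ^2 \<le> 2"
  by (simp add: weight_def power_divide add_pos_nonneg pos_divide_le_eq)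

lemma convex_square: "convex square"
proof -
  have "square = {p. - 1 \<le> Re p} \<inter> {p. Re p \<le> 1} \<inter> {p. - 1 \<le> Im p} \<inter> {p. Im p \<le> 1}"
    by (auto simp: square_def)
  also have "convex \<dots>"
    by (intro convex_Int convex_halfspace_Re_ge convex_halfspace_Re_le convex_halfspace_Im_ge convex_halfspace_Im_le)
  finally show ?thesis .
qed

lemma compact_square: "compact square"
proof -
  have "closed square" unfolding square_def by (intro closed_Collect_conj closed_Collect_le continuous_intros)
  moreover have "norm p \<le> 2" if "p \<in> square" for p using that cmod_le[of p] by (simp add: square_def)
  ultimately show ?thesis by (auto simp: compact_eq_bounded_closed bounded_iff)
qed

text \<open>Uniform continuity gives an additive bound; the positive minimum of
  \<open>weight\<close> on the compact square turns it into a ratio.\<close>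

lemma weight_uniform:
  assumes "\<kappa> > 1"
  obtains h where "h > 0" "\<And>p q. p \<in> square \<Longrightarrow> q \<in> square \<Longrightarrow> dist p q \<le> h \<Longrightarrow> weight q \<le> \<kappa> * weight p"
proof -
  have "1 + (norm p)^2 \<noteq> 0" for p :: complex using add_pos_nonneg[of 1 "(norm p)^2"] by simp
  then have cont: "continuous_on square weight"
    unfolding weight_def by (intro continuous_intros) auto
  have "0 \<in> square" by (simp add: square_def)
  then obtain c where c: "c \<in> square" "\<And>p. p \<in> square \<Longrightarrow> weight c \<le> weight p"
    using continuous_attains_inf[OF compact_square _ cont] by blast
  have "uniformly_continuous_on square weight"
    using compact_uniformly_continuous[OF cont compact_square] .
  moreover have "(\<kappa> - 1) * weight c > 0" using assms weight_pos by simp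
  ultimately obtain d where d: "d > 0" "\<And>p q. p \<in> square \<Longrightarrow> q \<in> square \<Longrightarrow> dist q p < d \<Longrightarrow>
      dist (weight q) (weight p) < (\<kappa> - 1) * weight c"
    unfolding uniformly_continuous_on_def by metis
  show thesis
  proof (rule that[of "d / 2"])
    fix p q assume pq: "p \<in> square" "q \<in> square" "dist p q \<le> d / 2"
    then have "weight q < weight p + (\<kappa> - 1) * weight c"
      using d(2)[of p q] d(1) by (simp add: dist_commute dist_real_def)
    also have "(\<kappa> - 1) * weight c \<le> (\<kappa> - 1) * weight p"
      using c(2)[OF pq(1)] assms by (intro mult_left_mono) auto
    finally show "weight q \<le> \<kappa> * weight p" by (simp add: algebra_simps)
  qed (use d in simp)
qed

definition comparable :: "real \<Rightarrow> real \<Rightarrow> real \<Rightarrow> bool" where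
  "comparable k a b \<longleftrightarrow> a \<le> k * b \<and> b \<le> k * a"

lemma cdist_uniform:
  assumes "\<kappa> > 1"
  obtains h where "h > 0" "\<And>c p q. c \<in> square \<Longrightarrow> p \<in> square \<Longrightarrow> q \<in> square \<Longrightarrow> dist c p \<le> h \<Longrightarrow> dist c q \<le> h \<Longrightarrow>
      comparable (\<kappa>^2) (cdist p q) (weight c ^2 * dist p q)"
proof -
  obtain h where h: "h > 0" "\<And>p q. p \<in> square \<Longrightarrow> q \<in> square \<Longrightarrow> dist p q \<le> h \<Longrightarrow> weight q \<le> \<kappa> * weight p"
    using weight_uniform[OF assms] by blast
  show thesis
  proof (rule that[OF h(1)], unfold comparable_def, intro conjI)
    fix c p q assume a: "c \<in> square" "p \<in> square" "q \<in> square" "dist c p \<le> h" "dist c q \<le> h"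
    have "weight p \<le> \<kappa> * weight c" "weight q \<le> \<kappa> * weight c" "weight c \<le> \<kappa> * weight p" "weight c \<le> \<kappa> * weight q"
      using h(2)[of c p] h(2)[of c q] h(2)[of p c] h(2)[of q c] a by (auto simp: dist_commute)
    then have "weight p * weight q \<le> (\<kappa> * weight c) * (\<kappa> * weight c)"
      "weight c * weight c \<le> (\<kappa> * weight p) * (\<kappa> * weight q)"
      using weight_pos assms by (auto intro!: mult_mono simp: less_imp_le)
    then have "weight p * weight q \<le> \<kappa>^2 * weight c ^2" "weight c ^2 \<le> \<kappa>^2 * (weight p * weight q)"
      by (simp_all add: power2_eq_square mult_ac)
    from mult_right_mono[OF this(1), of "dist p q"] mult_right_mono[OF this(2), of "dist p q"]
    show "cdist p q \<le> \<kappa>^2 * (weight c ^2 * dist p q)" "weight c ^2 * dist p q \<le> \<kappa>^2 * cdist p q"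
      by (simp_all add: cdist_def mult.assoc)
  qed
qed

definition real_lin :: "complex \<Rightarrow> complex \<Rightarrow> complex \<Rightarrow> complex" where
  "real_lin A B w = Re w *\<^sub>R A + Im w *\<^sub>R B"

text \<open>Three lengths determine a quadratic form: by polarization, \<open>e\<close> is twice the
  inner product of \<open>A\<close> and \<open>B\<close>. Near the squared lengths \<open>R\<close>,
  \<open>R\<close>, \<open>2 * R\<close> of a right isosceles triangle it is near \<open>R\<close>
  times the standard form; the 3 is 1 from the square terms plus 2 from the mixed term.\<close>

lemma flat_triangle_metric:
  fixes a b c \<eta> :: real
  assumes pos: "a > 0" "b > 0" "c > 0" "R > 0" "0 < \<eta>" "\<eta> \<le> 1/8"
    and a: "\<bar>a^2 - R\<bar> \<le> \<eta> * R" and b: "\<bar>b^2 - R\<bar> \<le> \<eta> * R" and c: "\<bar>c^2 - 2 * R\<bar> \<le> 2 * \<eta> * R"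
  obtains A B :: complex where "norm A = a" "norm B = b" "norm (A + B) = c"
    "\<And>w. \<bar>(norm (real_lin A B w))^2 - R * (norm w)^2\<bar> \<le> 3 * \<eta> * (R * (norm w)^2)"
proof -
  define e where "e = c^2 - a^2 - b^2"
  have e: "\<bar>e\<bar> \<le> 4 * (\<eta> * R)" using a b c unfolding e_def by linarith
  have "\<eta> * R \<le> 1/8 * R" using pos by (intro mult_right_mono) auto
  then have e': "\<bar>e\<bar> \<le> R / 2" and a': "a^2 \<ge> 7/8 * R" and b': "b^2 \<ge> 7/8 * R"
    using e a b by linarith+
  define x where "x = e / (2 * a)"
  \<comment> \<open>Cauchy-Schwarz for the vectors sought, so that \<open>y\<close> exists:
    \<open>\<eta> \<le> 1/8\<close> keeps \<open>\<bar>e\<bar>\<close> at most \<open>R / 2\<close>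
    while \<open>a^2\<close> and \<open>b^2\<close> are at least \<open>7/8 * R\<close>.\<close>
  have "x^2 \<le> b^2"
  proof -
    have "e^2 \<le> (R/2)^2" using e'
      by (metis abs_le_square_iff abs_of_nonneg divide_nonneg_pos pos(4) less_imp_le zero_less_numeral)
    also have "\<dots> \<le> 4 * ((7/8 * R) * (7/8 * R))" by (simp add: power2_eq_square)
    also have "\<dots> \<le> 4 * (a^2 * b^2)" using a' b' pos by (intro mult_left_mono mult_mono) auto
    finally show ?thesis using pos by (simp add: x_def power_divide power_mult_distrib pos_divide_le_eq mult_ac)
  qed
  define y where "y = sqrt (b^2 - x^2)"
  have y: "y^2 = b^2 - x^2" using \<open>x^2 \<le> b^2\<close> by (simp add: y_def)
  define A B where "A = Complex a 0" and "B = Complex x y"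
  have n: "(norm (s *\<^sub>R A + t *\<^sub>R B))^2 = s^2 * a^2 + t^2 * b^2 + s * t * e" for s t
  proof -
    have "(norm (s *\<^sub>R A + t *\<^sub>R B))^2 = (s * a + t * x)^2 + (t * y)^2"
      unfolding cmod_power2 by (simp add: A_def B_def)
    also have "\<dots> = s^2 * a^2 + t^2 * (x^2 + y^2) + s * t * (2 * a * x)"
      by (simp add: power2_eq_square algebra_simps)
    finally show ?thesis using pos by (simp add: y x_def)
  qed
  show thesis
  proof (rule that)
    show "norm A = a" using pos by (simp add: A_def cmod_def)
    have "(norm B)^2 = b^2" using n[of 0 1] by simp
    then show "norm B = b" by (rule power2_eq_imp_eq) (use pos in auto)
    have "(norm (A + B))^2 = c^2" using n[of 1 1] by (simp add: e_def)
    then show "norm (A + B) = c" by (rule power2_eq_imp_eq) (use pos in auto)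
    fix w :: complex
    let ?s = "Re w" and ?t = "Im w"
    have "\<bar>?s^2 * (a^2 - R)\<bar> \<le> ?s^2 * (\<eta> * R)" "\<bar>?t^2 * (b^2 - R)\<bar> \<le> ?t^2 * (\<eta> * R)"
      using a b by (auto simp: abs_mult intro: mult_left_mono)
    moreover have "\<bar>?s * ?t * e\<bar> \<le> (?s^2 + ?t^2) / 2 * (4 * (\<eta> * R))"
    proof -
      have "\<bar>?s * ?t\<bar> \<le> (?s^2 + ?t^2) / 2"
        using sum_squares_bound[of "\<bar>?s\<bar>" "\<bar>?t\<bar>"] by (simp add: abs_mult)
      then show ?thesis unfolding abs_mult[of "?s * ?t"] using e by (intro mult_mono) auto
    qed
    moreover have "(norm (?s *\<^sub>R A + ?t *\<^sub>R B))^2 - R * (norm w)^2 = ?s^2 * (a^2 - R) + ?t^2 * (b^2 - R) + ?s * ?t * e"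
      unfolding n cmod_power2[of w] by (simp add: algebra_simps)
    moreover have "3 * \<eta> * (R * (norm w)^2) = ?s^2 * (\<eta> * R) + ?t^2 * (\<eta> * R) + (?s^2 + ?t^2) / 2 * (4 * (\<eta> * R))"
      unfolding cmod_power2[of w] by (simp add: algebra_simps)
    ultimately show "\<bar>(norm (real_lin A B w))^2 - R * (norm w)^2\<bar> \<le> 3 * \<eta> * (R * (norm w)^2)"
      unfolding real_lin_def by linarith
  qed
qed

text \<open>\<open>k\<close> absorbs both the distortion of the metric on a cell and that of the flat model.\<close>

lemma flat_triangle_metric_close:
  fixes k :: real
  assumes "k > 1"
  obtains \<kappa> where "\<kappa> > 1" "\<kappa>^2 \<le> k"
    "\<And>a b c R. a > 0 \<Longrightarrow> b > 0 \<Longrightarrow> c > 0 \<Longrightarrow> R > 0 \<Longrightarrow>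
      comparable (\<kappa>^2) a R \<Longrightarrow> comparable (\<kappa>^2) b R \<Longrightarrow> comparable (\<kappa>^2) c (sqrt 2 * R) \<Longrightarrow>
      \<exists>A B :: complex. norm A = a \<and> norm B = b \<and> norm (A + B) = c \<and>
        (\<forall>w. comparable k (norm (real_lin A B w)) (R * norm w))"
proof -
  \<comment> \<open>Guarantees \<open>1 - 3 * \<eta> \<ge> 1 / k^2\<close>; since
    \<open>(1 + 3 * \<eta>) * (1 - 3 * \<eta>) \<le> 1\<close>, the upper factor
    \<open>1 + 3 * \<eta>\<close> is then at most \<open>k^2\<close> too.\<close>
  define \<eta> where "\<eta> = min (1/8) ((1 - 1 / k^2) / 3)"
  have k2: "k^2 > 1" using assms by (simp add: one_less_power)
  then have "1 / k^2 < 1" using assms by (subst divide_less_eq_1_pos) simp_all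
  then have \<eta>: "0 < \<eta>" "\<eta> \<le> 1/8" "3 * \<eta> \<le> 1 - 1 / k^2"
    by (auto simp: \<eta>_def min_def)
  have "k^2 * (3 * \<eta>) \<le> k^2 * (1 - 1 / k^2)" using \<eta>(3) k2 by (intro mult_left_mono) auto
  also have "\<dots> = k^2 - 1" using assms by (simp add: field_simps)
  finally have k3: "1 \<le> k^2 * (1 - 3 * \<eta>)" by (simp add: algebra_simps)
  have k4: "1 + 3 * \<eta> \<le> k^2"
  proof -
    have "(1 + 3 * \<eta>) * (1 - 3 * \<eta>) \<le> 1" by (simp add: algebra_simps)
    also note k3
    finally have "(1 + 3 * \<eta>) * (1 - 3 * \<eta>) \<le> k^2 * (1 - 3 * \<eta>)" .
    then show ?thesis by (rule mult_right_le_imp_le) (use \<eta> in simp)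
  qed
  \<comment> \<open>A fourth root, because lengths agree up to \<open>\<kappa>^2\<close> and squared
    lengths must agree up to \<open>1 + \<eta>\<close>.\<close>
  define \<kappa> where "\<kappa> = sqrt (sqrt (1 + \<eta>))"
  have \<kappa>: "\<kappa> > 1" using \<eta> by (simp add: \<kappa>_def)
  have \<kappa>4: "(\<kappa>^2)^2 \<le> 1 + \<eta>" using \<eta> by (simp add: \<kappa>_def)
  show thesis
  proof (rule that[OF \<kappa>])
    have "(\<kappa>^2)^2 \<le> k^2" using \<kappa>4 k4 \<eta> by linarith
    then show "\<kappa>^2 \<le> k" by (rule power2_le_imp_le) (use assms in auto)
    fix a b c R :: real
    assume pos: "a > 0" "b > 0" "c > 0" "R > 0"
      and cmp: "comparable (\<kappa>^2) a R" "comparable (\<kappa>^2) b R" "comparable (\<kappa>^2) c (sqrt 2 * R)"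
    have sq: "\<bar>z^2 - S^2\<bar> \<le> \<eta> * S^2"
      if "z > 0" "S > 0" "comparable (\<kappa>^2) z S" for z S
    proof -
      have "z^2 \<le> (\<kappa>^2 * S)^2" "S^2 \<le> (\<kappa>^2 * z)^2" using that
        by (auto simp: comparable_def intro!: power_mono)
      then have "z^2 \<le> (\<kappa>^2)^2 * S^2" "S^2 \<le> (\<kappa>^2)^2 * z^2"
        by (simp_all add: power_mult_distrib)
      moreover have "(\<kappa>^2)^2 * S^2 \<le> (1 + \<eta>) * S^2" "(\<kappa>^2)^2 * z^2 \<le> (1 + \<eta>) * z^2"
        using \<kappa>4 by (auto intro!: mult_right_mono)
      ultimately have 1: "z^2 \<le> S^2 + \<eta> * S^2" and 2: "S^2 \<le> z^2 + \<eta> * z^2"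
        by (simp_all add: algebra_simps)
      show ?thesis
      proof (cases "z^2 \<le> S^2")
        case True
        then have "\<eta> * z^2 \<le> \<eta> * S^2" using \<eta> by (intro mult_left_mono) auto
        then show ?thesis using 1 2 by linarith
      next
        case False
        moreover have "0 \<le> \<eta> * S^2" using \<eta> by simp
        ultimately show ?thesis using 1 by linarith
      qed
    qed
    have "\<bar>c^2 - (sqrt 2 * R)^2\<bar> \<le> \<eta> * (sqrt 2 * R)^2"
      by (rule sq[OF _ _ cmp(3)]) (use pos in auto)
    then have c2: "\<bar>c^2 - 2 * R^2\<bar> \<le> 2 * \<eta> * R^2" by (simp add: power_mult_distrib mult_ac)
    obtain A B :: complex where AB: "norm A = a" "norm B = b" "norm (A + B) = c"
      "\<And>w. \<bar>(norm (real_lin A B w))^2 - R^2 * (norm w)^2\<bar> \<le> 3 * \<eta> * (R^2 * (norm w)^2)"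
      using flat_triangle_metric[OF pos(1-3) _ \<eta>(1,2) sq[OF pos(1,4) cmp(1)] sq[OF pos(2,4) cmp(2)] c2] pos by auto
    have "comparable k (norm (real_lin A B w)) (R * norm w)" for w
      unfolding comparable_def
    proof
      let ?n = "norm (real_lin A B w)" and ?S = "R^2 * (norm w)^2"
      have S: "?S \<ge> 0" by simp
      have n: "?n^2 \<le> (1 + 3 * \<eta>) * ?S" "(1 - 3 * \<eta>) * ?S \<le> ?n^2"
        using AB(4)[of w] by (simp_all add: algebra_simps abs_le_iff)
      have "?n^2 \<le> k^2 * ?S" using n(1) mult_right_mono[OF k4 S] by linarith
      then have "?n^2 \<le> (k * (R * norm w))^2" by (simp add: power_mult_distrib)
      then show "?n \<le> k * (R * norm w)" by (rule power2_le_imp_le) (use assms pos in auto)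
      have "?S \<le> k^2 * (1 - 3 * \<eta>) * ?S" using mult_right_mono[OF k3 S] by simp
      also have "\<dots> \<le> k^2 * ?n^2" using n(2) k2
        by (simp only: mult.assoc) (intro mult_left_mono, auto)
      finally have "(R * norm w)^2 \<le> (k * ?n)^2" by (simp add: power_mult_distrib)
      then show "R * norm w \<le> k * ?n" by (rule power2_le_imp_le) (use assms pos in auto)
    qed
    then show "\<exists>A B :: complex. norm A = a \<and> norm B = b \<and> norm (A + B) = c \<and>
        (\<forall>w. comparable k (norm (real_lin A B w)) (R * norm w))"
      using AB(1-3) by blast
  qed
qed

text \<open>Nearby points only: shortness arises inside small cells and is carried from cell to cell
  along segments on which \<open>weight\<close> is nearly constant. Distant points are compared
  later, along great circles.\<close>

definition locally_short :: "real \<Rightarrow> (complex \<Rightarrow> complex) \<Rightarrow> bool" where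
  "locally_short L f \<longleftrightarrow>
     (\<exists>r>0. \<forall>p\<in>square. \<forall>q\<in>square. dist p q \<le> r \<longrightarrow> dist (f p) (f q) \<le> L * cdist p q)"

definition almost_expanding :: "real \<Rightarrow> (complex \<Rightarrow> complex) \<Rightarrow> complex set set \<Rightarrow> bool" where
  "almost_expanding \<epsilon> f \<C> \<longleftrightarrow> finite \<C> \<and> square \<subseteq> \<Union>\<C> \<and>
     (\<forall>C\<in>\<C>. closed C \<and> (\<forall>x\<in>C. \<forall>y\<in>C. (1 - \<epsilon>) * cdist x y \<le> dist (f x) (f y)))"

lemma cdist_pos: "p \<noteq> q \<Longrightarrow> cdist p q > 0" and cdist_nonneg: "cdist p q \<ge> 0"
  using weight_pos by (simp_all add: cdist_def less_imp_le)

lemma exists_power_less_one: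
  fixes L :: real
  assumes "0 < L" "L < 1"
  obtains k where "1 < k" "k \<le> 2" "k ^ 7 * L < 1"
proof -
  have "((\<lambda>k. k ^ 7 * L) \<longlongrightarrow> 1 ^ 7 * L) (at_right 1)" by (intro tendsto_intros)
  then have "\<forall>\<^sub>F k in at_right 1. k ^ 7 * L < 1" using assms by (intro order_tendstoD(2)) auto
  moreover have "\<forall>\<^sub>F k in at_right (1::real). k < 2"
    by (rule order_tendstoD(2)[OF tendsto_ident_at]) simp
  ultimately have "\<forall>\<^sub>F k in at_right 1. k ^ 7 * L < 1 \<and> k < 2 \<and> 1 < k"
    using eventually_at_right_less[of 1] by (simp add: eventually_conj_iff)
  then obtain k where "k ^ 7 * L < 1 \<and> k < 2 \<and> 1 < k"
    using eventually_happens trivial_limit_at_right_real by blast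
  then show thesis using that by auto
qed

text \<open>The flat model of a cell is within \<open>k^2\<close> of the chordal metric, so
  \<open>f\<close> stays short for it, and \<open>grid_fill\<close> raises the ratio to
  \<open>\<mu>\<close>. The result is again strictly short, which permits iteration.\<close>

lemma folding_step:
  assumes f: "locally_short L f" and L: "0 \<le> L" "L < 1" and \<epsilon>: "0 < \<epsilon>" "\<epsilon> < 1"
  shows "\<exists>f' L' \<C>. 0 \<le> L' \<and> L' < 1 \<and> locally_short L' f' \<and>
     (\<forall>p\<in>square. dist (f p) (f' p) \<le> \<epsilon>) \<and> almost_expanding \<epsilon> f' \<C>"
proof -
  \<comment> \<open>Raising the constant to \<open>1 - \<epsilon>\<close> makes the final ratio
    large enough for the expansion bound.\<close>
  define L0 where "L0 = max L (1 - \<epsilon>)"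
  have L0: "0 < L0" "L0 < 1" "L \<le> L0" "1 - \<epsilon> \<le> L0" using L \<epsilon> by (auto simp: L0_def)
  \<comment> \<open>Budget for \<open>k\<close>: 2 powers compare \<open>cdist\<close> with the
    models and 1 is slack for \<open>grid_fill\<close>, giving \<open>\<mu> = L0 * k ^ 3\<close>;
    going back to \<open>cdist\<close> costs 2, and freezing the metric along a segment 1 each
    way.\<close>
  obtain k where k: "1 < k" "k \<le> 2" "k ^ 7 * L0 < 1" using exists_power_less_one[OF L0(1,2)] .
  obtain \<kappa> where \<kappa>: "\<kappa> > 1" "\<kappa>^2 \<le> k" and flat:
    "\<And>a b c R. a > 0 \<Longrightarrow> b > 0 \<Longrightarrow> c > 0 \<Longrightarrow> R > 0 \<Longrightarrow>
      comparable (\<kappa>^2) a R \<Longrightarrow> comparable (\<kappa>^2) b R \<Longrightarrow> comparable (\<kappa>^2) c (sqrt 2 * R) \<Longrightarrow>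
      \<exists>A B :: complex. norm A = a \<and> norm B = b \<and> norm (A + B) = c \<and>
        (\<forall>w. comparable k (norm (real_lin A B w)) (R * norm w))"
    using flat_triangle_metric_close[OF k(1)] by blast
  obtain h0 where h0: "h0 > 0" "\<And>c p q. c \<in> square \<Longrightarrow> p \<in> square \<Longrightarrow> q \<in> square \<Longrightarrow>
      dist c p \<le> h0 \<Longrightarrow> dist c q \<le> h0 \<Longrightarrow>
      comparable (\<kappa>^2) (cdist p q) (weight c ^2 * dist p q)"
    using cdist_uniform[OF \<kappa>(1)] by blast
  obtain r where r: "r > 0" "\<And>p q. p \<in> square \<Longrightarrow> q \<in> square \<Longrightarrow> dist p q \<le> r \<Longrightarrow>
      dist (f p) (f q) \<le> L * cdist p q"
    using f unfolding locally_short_def by blast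
  \<comment> \<open>\<open>h0\<close> keeps \<open>weight\<close> nearly constant on a cell, and
    \<open>r\<close> makes \<open>f\<close> short there. Points of a cell are within
    \<open>2 * h \<le> \<delta>\<close>, and the map will move by at most \<open>16 * h\<close>,
    hence \<open>\<epsilon> / 8\<close>.\<close>
  define \<delta> where "\<delta> = Min {h0, r, \<epsilon> / 8}"
  have \<delta>: "\<delta> > 0" "\<delta> \<le> h0" "\<delta> \<le> r" "\<delta> \<le> \<epsilon> / 8"
    using h0 r \<epsilon> by (auto simp: \<delta>_def)
  define m where "m = \<lceil>4 / \<delta>\<rceil>"
  have m: "m > 0" "4 / \<delta> \<le> of_int m" using \<delta> by (auto simp: m_def)
  define h where "h = 2 / real_of_int m"
  have h: "h > 0" "of_int m * h = 2" using m by (auto simp: h_def)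
  have h2: "2 * h \<le> \<delta>" using m \<delta> by (simp add: h_def field_simps)
  define P where "P z = h *\<^sub>R z - (1 + \<i>)" for z
  define N where "N p = (p + (1 + \<i>)) /\<^sub>R h" for p
  have NP: "N (P z) = z" and PN: "P (N p) = p" for z p using h by (simp_all add: P_def N_def)
  have dP: "dist (P z) (P w) = h * dist z w" for z w
    using h by (simp add: P_def dist_norm flip: scaleR_diff_right)
  define I :: "cell set" where "I = {0..<m} \<times> {0..<m} \<times> UNIV"
  have finI: "finite I" by (simp add: I_def)
  have Psq: "P z \<in> square" if "T \<in> I" "z \<in> tri T" for T z
  proof -
    obtain i j b where T: "T = (i, j, b)" by (cases T)
    have ij: "0 \<le> i" "i + 1 \<le> m" "0 \<le> j" "j + 1 \<le> m" using that by (auto simp: T I_def)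
    have "0 \<le> real_of_int i" "of_int i + 1 \<le> real_of_int m" "0 \<le> real_of_int j" "of_int j + 1 \<le> real_of_int m"
      using ij by linarith+
    then have "0 \<le> Re z" "Re z \<le> of_int m" "0 \<le> Im z" "Im z \<le> of_int m"
      using that(2) by (auto simp: T tri_def Let_def split: if_splits)
    from mult_left_mono[OF this(1), of h] mult_left_mono[OF this(2), of h]
      mult_left_mono[OF this(3), of h] mult_left_mono[OF this(4), of h]
    have "0 \<le> h * Re z" "h * Re z \<le> 2" "0 \<le> h * Im z" "h * Im z \<le> 2"
      using h(1) h(2)[unfolded mult.commute[of _ h]] by linarith+
    then show ?thesis by (simp add: P_def square_def abs_le_iff)
  qed
  have cover: "\<exists>T\<in>I. N p \<in> tri T" if p: "p \<in> square" for p
  proof -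
    have fl: "\<exists>i\<in>{0..<m}. of_int i \<le> x \<and> x \<le> of_int i + 1"
      if "0 \<le> x" "x \<le> of_int m" for x :: real
    proof (cases "x = of_int m")
      case True then show ?thesis using m by (intro bexI[of _ "m - 1"]) auto
    next
      case False
      then have "\<lfloor>x\<rfloor> < m" using that by (simp add: floor_less_iff)
      then show ?thesis using that by (intro bexI[of _ "\<lfloor>x\<rfloor>"]) (auto, linarith?)
    qed
    have "0 \<le> Re (N p)" "Re (N p) \<le> of_int m" "0 \<le> Im (N p)" "Im (N p) \<le> of_int m"
      using p h by (auto simp: N_def square_def abs_le_iff field_simps)
    then obtain i j where ij: "i \<in> {0..<m}" "of_int i \<le> Re (N p)" "Re (N p) \<le> of_int i + 1"
      "j \<in> {0..<m}" "of_int j \<le> Im (N p)" "Im (N p) \<le> of_int j + 1"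
      using fl by meson
    let ?T = "(i, j, Re (N p) - of_int i \<le> Im (N p) - of_int j)"
    have "?T \<in> I" using ij by (simp add: I_def)
    moreover have "N p \<in> tri ?T" using ij by (auto simp: tri_def Let_def)
    ultimately show ?thesis by blast
  qed
  have corner_tri: "corner T \<in> tri T" for T using edge_in_tri[of "corner T" "1 + \<i>" T 0]
    by (simp add: edges_def)
  have tri_diam: "dist z w \<le> 2" if "z \<in> tri T" "w \<in> tri T" for T z w
    using that cmod_le[of "z - w"] by (auto simp: tri_def Let_def dist_norm split: if_splits)
  have close: "dist (P z) (P w) \<le> \<delta>" if "z \<in> tri T" "w \<in> tri T" for T z w
    using mult_left_mono[OF tri_diam[OF that] less_imp_le[OF h(1)]] h2 unfolding dP by linarith
  \<comment> \<open>Conformal factor at the corner times mesh size: the scale of the flat model. By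
    \<open>k \<le> 2\<close> the model has the factor-2 bounds that \<open>grid_fill\<close> asks
    for.\<close>
  define \<rho> where "\<rho> T = weight (P (corner T)) ^2 * h" for T
  have \<rho>: "\<rho> T > 0" for T unfolding \<rho>_def by (intro mult_pos_pos zero_less_power weight_pos h)
  have \<rho>2: "\<rho> T \<le> 2 * h" for T unfolding \<rho>_def using weight_le h
    by (intro mult_right_mono) auto
  have cd: "cdist (P z) (P w) \<le> \<kappa>^2 * (\<rho> T * dist z w)" "\<rho> T * dist z w \<le> \<kappa>^2 * cdist (P z) (P w)"
    if "T \<in> I" "z \<in> tri T" "w \<in> tri T" for T z w
  proof -
    have "comparable (\<kappa>^2) (cdist (P z) (P w)) (weight (P (corner T)) ^2 * dist (P z) (P w))"
      by (rule h0(2)[OF Psq[OF that(1) corner_tri] Psq[OF that(1,2)] Psq[OF that(1,3)]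
            order_trans[OF close[OF corner_tri that(2)] \<delta>(2)] order_trans[OF close[OF corner_tri that(3)] \<delta>(2)]])
    then show "cdist (P z) (P w) \<le> \<kappa>^2 * (\<rho> T * dist z w)" "\<rho> T * dist z w \<le> \<kappa>^2 * cdist (P z) (P w)"
      by (simp_all add: comparable_def dP \<rho>_def mult_ac)
  qed
  have cdk: "cdist (P z) (P w) \<le> k * (\<rho> T * dist z w)" "\<rho> T * dist z w \<le> k * cdist (P z) (P w)"
    if "T \<in> I" "z \<in> tri T" "w \<in> tri T" for T z w
  proof -
    have "0 \<le> \<rho> T * dist z w" using \<rho>[of T] by simp
    from mult_right_mono[OF \<kappa>(2) this] mult_right_mono[OF \<kappa>(2) cdist_nonneg[of "P z" "P w"]] cd[OF that]
    show "cdist (P z) (P w) \<le> k * (\<rho> T * dist z w)" "\<rho> T * dist z w \<le> k * cdist (P z) (P w)" by linarith+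
  qed
  define len where "len v d = cdist (P v) (P (v + d))" for v d
  have "\<exists>A B :: complex. (\<forall>v d. (v, d) \<in> edges T \<longrightarrow> norm (real_lin A B d) = len v d) \<and>
        (\<forall>w. comparable k (norm (real_lin A B w)) (\<rho> T * norm w))" if T: "T \<in> I" for T
  proof -
    have E: "0 < len v d" "len v d \<le> \<kappa>^2 * (norm d * \<rho> T)" "norm d * \<rho> T \<le> \<kappa>^2 * len v d"
      if e: "(v, d) \<in> edges T" for v d
    proof -
      have d: "d \<noteq> 0" using edges_lattice(2)[OF e] by (auto simp: complex_eq_iff)
      have vt: "v \<in> tri T" "v + d \<in> tri T" using edge_in_tri[OF e, of 0] edge_in_tri[OF e, of 1]
        by simp_all
      have "P v \<noteq> P (v + d)" using NP d by (metis add_cancel_left_right)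
      then show "0 < len v d" unfolding len_def by (rule cdist_pos)
      show "len v d \<le> \<kappa>^2 * (norm d * \<rho> T)" "norm d * \<rho> T \<le> \<kappa>^2 * len v d"
        using cd[OF T vt] by (simp_all add: len_def dist_norm mult.commute)
    qed
    have nd: "norm (1 + \<i>) = sqrt 2" by (simp add: cmod_def)
    obtain i j b where ijb: "T = (i, j, b)" by (cases T)
    let ?v = "corner T"
    \<comment> \<open>The model fixes the images of \<open>1\<close> and \<open>\<i>\<close>, so the
      horizontal and the vertical edge are singled out; which of them starts at the corner depends
      on the half \<open>b\<close>.\<close>
    define eh ev where "eh = (if b then ?v + \<i> else ?v)" and "ev = (if b then ?v else ?v + 1)"
    have ed: "edges T = {(eh, 1), (ev, \<i>), (?v, 1 + \<i>)}"
      by (auto simp: edges_def leg1_def leg2_def ijb eh_def ev_def)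
    have e: "(eh, 1) \<in> edges T" "(ev, \<i>) \<in> edges T" "(?v, 1 + \<i>) \<in> edges T"
      by (simp_all add: ed)
    obtain A B :: complex where "norm A = len eh 1" "norm B = len ev \<i>" "norm (A + B) = len ?v (1 + \<i>)"
       and AB: "\<forall>w. comparable k (norm (real_lin A B w)) (\<rho> T * norm w)"
      using flat[of "len eh 1" "len ev \<i>" "len ?v (1 + \<i>)" "\<rho> T"] E[OF e(1)] E[OF e(2)] E[OF e(3)] \<rho>[of T]
      unfolding nd by (auto simp: comparable_def mult.commute)
    then have "\<forall>v d. (v, d) \<in> edges T \<longrightarrow> norm (real_lin A B d) = len v d"
      by (auto simp: ed real_lin_def)
    with AB show ?thesis by blast
  qed
  then obtain A B :: "cell \<Rightarrow> complex" where AB: "\<And>T v d. T \<in> I \<Longrightarrow> (v, d) \<in> edges T \<Longrightarrow> norm (real_lin (A T) (B T) d) = len v d"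
    "\<And>T w. T \<in> I \<Longrightarrow> comparable k (norm (real_lin (A T) (B T) w)) (\<rho> T * norm w)"
    by metis
  define M where "M T w = real_lin (A T) (B T) w" for T w
  have linM: "linear (M T)" for T
    by (rule linearI) (simp_all add: M_def real_lin_def algebra_simps)
  note M = AB(1)[folded M_def] AB(2)[folded M_def, unfolded comparable_def, THEN conjunct1]
    AB(2)[folded M_def, unfolded comparable_def, THEN conjunct2]
  have Mc: "norm (M T (z - w)) \<le> k^2 * cdist (P z) (P w)" "cdist (P z) (P w) \<le> k^2 * norm (M T (z - w))"
    if T: "T \<in> I" "z \<in> tri T" "w \<in> tri T" for T z w
  proof -
    have "k * (\<rho> T * dist z w) \<le> k * (k * cdist (P z) (P w))" using cdk(2)[OF T] k
      by (intro mult_left_mono) auto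
    then show "norm (M T (z - w)) \<le> k^2 * cdist (P z) (P w)"
      using M(2)[OF T(1), of "z - w"] by (simp add: power2_eq_square dist_norm mult.assoc)
    have "k * (\<rho> T * dist z w) \<le> k * (k * norm (M T (z - w)))"
      using M(3)[OF T(1), of "z - w"] k by (intro mult_left_mono) (auto simp: dist_norm)
    then show "cdist (P z) (P w) \<le> k^2 * norm (M T (z - w))"
      using cdk(1)[OF T] by (simp add: power2_eq_square mult.assoc)
  qed
  define \<mu> where "\<mu> = L0 * k ^ 3"
  have kk: "k ^ 2 \<le> k ^ 7" "k ^ 3 \<le> k ^ 7" "k ^ 2 < k ^ 3" using k
    by (auto intro!: power_increasing power_strict_increasing)
  have \<mu>: "L0 * k^2 < \<mu>" "0 < \<mu>" "\<mu> < 1"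
  proof -
    show "L0 * k^2 < \<mu>" unfolding \<mu>_def by (rule mult_strict_left_mono[OF kk(3) L0(1)])
    show "0 < \<mu>" using L0 k by (simp add: \<mu>_def)
    have "\<mu> \<le> L0 * k ^ 7" unfolding \<mu>_def by (rule mult_left_mono[OF kk(2) less_imp_le[OF L0(1)]])
    then show "\<mu> < 1" using k(3) by (simp add: mult.commute)
  qed
  have gL: "dist (f (P z)) (f (P w)) \<le> L0 * k^2 * norm (M T (z - w))"
    if T: "T \<in> I" "z \<in> tri T" "w \<in> tri T" for T z w
  proof -
    have "dist (f (P z)) (f (P w)) \<le> L * cdist (P z) (P w)"
      using close[OF T(2,3)] \<delta>(3) Psq T by (intro r(2)) auto
    also have "\<dots> \<le> L0 * (k^2 * norm (M T (z - w)))"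
      using Mc(2)[OF T] L0 cdist_nonneg by (intro mult_mono) auto
    finally show ?thesis by (simp add: mult.assoc)
  qed
  obtain G where G: "\<And>T. T \<in> I \<Longrightarrow> G (corner T) = (f \<circ> P) (corner T)"
    "\<And>T x y. T \<in> I \<Longrightarrow> x \<in> tri T \<Longrightarrow> y \<in> tri T \<Longrightarrow> dist (G x) (G y) \<le> \<mu> * norm (M T (x - y))"
    "\<And>T. T \<in> I \<Longrightarrow> \<exists>\<C>. finite \<C> \<and> tri T = \<Union>\<C> \<and> (\<forall>C\<in>\<C>. closed C \<and>
        (\<forall>x\<in>C. \<forall>y\<in>C. dist (G x) (G y) = \<mu> * norm (M T (x - y))))"
  proof (rule grid_fill[OF finI _ \<mu>(1), of M \<rho> len "f \<circ> P"])
    show "\<rho> T / 2 * norm w \<le> norm (M T w)" if "T \<in> I" for T w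
      using M(3)[OF that, of w] mult_right_mono[OF k(2) norm_ge_zero[of "M T w"]] by linarith
    show "norm (M T w) \<le> 2 * \<rho> T * norm w" if "T \<in> I" for T w
    proof -
      have "0 \<le> \<rho> T * norm w" using \<rho>[of T] by simp
      from mult_right_mono[OF k(2) this] M(2)[OF that, of w] show ?thesis by linarith
    qed
  qed (use L0 k linM \<rho> M(1) gL in auto)
  define f' where "f' p = G (N p)" for p
  define L' where "L' = L0 * k ^ 7"
  have L': "0 \<le> L'" "L' < 1" using L0 k by (simp_all add: L'_def mult.commute)
  have Gc: "dist (G z) (G w) \<le> \<mu> * (k^2 * cdist (P z) (P w))"
    if T: "T \<in> I" "z \<in> tri T" "w \<in> tri T" for T z w
    using G(2)[OF T] mult_left_mono[OF Mc(1)[OF T], of \<mu>] \<mu> by linarith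
  have contN: "continuous_on S N" for S unfolding N_def by (intro continuous_intros)
  have short: "locally_short L' f'"
    unfolding locally_short_def
  proof (intro exI[of _ h0] conjI ballI impI)
    fix p q assume pq: "p \<in> square" "q \<in> square" "dist p q \<le> h0"
    define R where "R = weight p ^2"
    have R: "R \<ge> 0" by (simp add: R_def)
    define s where "s t = p + t *\<^sub>R (q - p)" for t
    have st: "s t \<in> square" "dist p (s t) \<le> h0" if "t \<in> {0..1}" for t
    proof -
      have "s t = (1 - t) *\<^sub>R p + t *\<^sub>R q" by (simp add: s_def algebra_simps)
      then show "s t \<in> square" using convexD_alt[OF convex_square pq(1,2), of t] that by simp
      have "dist p (s t) = t * dist p q" using that by (simp add: s_def dist_norm norm_minus_commute)
      also have "\<dots> \<le> 1 * dist p q" using that by (intro mult_right_mono) auto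
      finally show "dist p (s t) \<le> h0" using pq by simp
    qed
    have ds: "dist (s t) (s u) = \<bar>t - u\<bar> * dist p q" for t u
      by (simp add: s_def dist_norm norm_minus_commute flip: scaleR_diff_left)
    define U where "U T = {t \<in> {0..1}. N (s t) \<in> tri T}" for T
    \<comment> \<open>\<open>f'\<close> is controlled on single cells. They cut the segment into
      finitely many closed parameter sets, over which Lipschitz bounds glue. Meanwhile the metric is
      frozen at \<open>p\<close>, because Euclidean distance is additive along the segment and
      \<open>cdist\<close> in general is not.\<close>
    have "(\<mu> * k ^ 3 * R * dist p q)-lipschitz_on {0..1} (\<lambda>t. f' (s t))"
    proof (rule lipschitz_on_closed_Union[of I _ U])
      show "{0..1} \<subseteq> (\<Union>T\<in>I. U T)" using cover st(1) by (fastforce simp: U_def)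
      show "closed (U T)" for T
      proof -
        have "continuous_on {0..1} (\<lambda>t. N (s t))"
          unfolding s_def by (intro continuous_on_compose2[OF contN[of UNIV]] continuous_intros) auto
        then show ?thesis unfolding U_def
          using continuous_closed_preimage[of "{0..1}" "\<lambda>t. N (s t)" "tri T"] closed_tri
          by (simp add: Int_def vimage_def)
      qed
      show "0 \<le> \<mu> * k ^ 3 * R * dist p q" using \<mu> k R by simp
      show "(\<mu> * k ^ 3 * R * dist p q)-lipschitz_on (U T) (\<lambda>t. f' (s t))" if T: "T \<in> I" for T
      proof (rule lipschitz_onI)
        fix t u assume tu: "t \<in> U T" "u \<in> U T"
        have "dist (f' (s t)) (f' (s u)) \<le> \<mu> * (k^2 * cdist (s t) (s u))"
          using Gc[OF T, of "N (s t)" "N (s u)"] tu by (simp add: f'_def U_def PN)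
        also have "cdist (s t) (s u) \<le> \<kappa>^2 * (R * dist (s t) (s u))"
          unfolding R_def using h0(2)[of p "s t" "s u"] st tu pq by (simp add: U_def comparable_def)
        also have "\<dots> \<le> k * (R * dist (s t) (s u))" using \<kappa>(2) R
          by (intro mult_right_mono) auto
        also have "\<mu> * (k^2 * (k * (R * dist (s t) (s u)))) = \<mu> * k ^ 3 * R * dist p q * dist t u"
          unfolding ds by (simp add: dist_real_def power2_eq_square power3_eq_cube mult_ac)
        finally show "dist (f' (s t)) (f' (s u)) \<le> \<mu> * k ^ 3 * R * dist p q * dist t u"
          using \<mu> k by (simp add: mult_left_mono)
      qed (use \<mu> k R in simp)
    qed (rule finI)
    from lipschitz_onD[OF this, of 0 1] have "dist (f' p) (f' q) \<le> \<mu> * k ^ 3 * (R * dist p q)"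
      by (simp add: s_def mult_ac)
    also have "R * dist p q \<le> \<kappa>^2 * cdist p q" using h0(2)[of p p q] pq h0(1)
      by (simp add: R_def comparable_def)
    also have "\<dots> \<le> k * cdist p q" using \<kappa>(2) cdist_nonneg by (intro mult_right_mono) auto
    also have "\<mu> * k ^ 3 * (k * cdist p q) = L' * cdist p q"
      by (simp add: \<mu>_def L'_def power_numeral_reduce mult_ac)
    finally show "dist (f' p) (f' q) \<le> L' * cdist p q" using \<mu> k by (simp add: mult_left_mono)
  qed (rule h0(1))
  have near: "dist (f p) (f' p) \<le> \<epsilon>" if p: "p \<in> square" for p
  proof -
    obtain T where T: "T \<in> I" "N p \<in> tri T" using cover[OF p] by blast
    let ?c = "corner T"
    have n: "norm (M T (N p - ?c)) \<le> 8 * h"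
    proof -
      have "norm (M T (N p - ?c)) \<le> k * (\<rho> T * dist (N p) ?c)" using M(2)[OF T(1)]
        by (simp add: dist_norm)
      also have "\<dots> \<le> 2 * (2 * h * 2)"
        using k \<rho>[of T] \<rho>2[of T] tri_diam[OF T(2) corner_tri] h by (intro mult_mono) auto
      finally show ?thesis by simp
    qed
    have "dist (f p) (G ?c) \<le> L0 * k^2 * norm (M T (N p - ?c))"
      using gL[OF T corner_tri] G(1)[OF T(1)] by (simp add: PN)
    also have "\<dots> \<le> 1 * norm (M T (N p - ?c))" using \<mu> by (intro mult_right_mono) auto
    finally have 1: "dist (f p) (G ?c) \<le> norm (M T (N p - ?c))" by simp
    have "dist (G (N p)) (G ?c) \<le> \<mu> * norm (M T (N p - ?c))" by (rule G(2)[OF T corner_tri])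
    also have "\<dots> \<le> 1 * norm (M T (N p - ?c))" using \<mu> by (intro mult_right_mono) auto
    finally have "dist (f p) (f' p) \<le> 16 * h"
      using 1 n dist_triangle2[of "f p" "f' p" "G ?c"] by (simp add: f'_def)
    then show ?thesis using h2 \<delta>(4) by simp
  qed
  obtain \<D> where \<D>: "\<And>T. T \<in> I \<Longrightarrow> finite (\<D> T)" "\<And>T. T \<in> I \<Longrightarrow> tri T = \<Union>(\<D> T)"
    "\<And>T C. T \<in> I \<Longrightarrow> C \<in> \<D> T \<Longrightarrow> closed C"
    "\<And>T C x y. T \<in> I \<Longrightarrow> C \<in> \<D> T \<Longrightarrow> x \<in> C \<Longrightarrow> y \<in> C \<Longrightarrow> dist (G x) (G y) = \<mu> * norm (M T (x - y))"
    using G(3) by metis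
  define \<C> where "\<C> = (\<Union>T\<in>I. (\<lambda>C. N -` C) ` \<D> T)"
  have "almost_expanding \<epsilon> f' \<C>"
    unfolding almost_expanding_def
  proof (intro conjI ballI)
    show "finite \<C>" unfolding \<C>_def using finI \<D>(1) by auto
    show "square \<subseteq> \<Union>\<C>"
    proof
      fix p assume "p \<in> square"
      then obtain T where T: "T \<in> I" "N p \<in> tri T" using cover by blast
      then obtain C where "C \<in> \<D> T" "N p \<in> C" using \<D>(2)[OF T(1)] by blast
      then show "p \<in> \<Union>\<C>" using T by (auto simp: \<C>_def)
    qed
    fix E assume "E \<in> \<C>"
    then obtain T C where C: "T \<in> I" "C \<in> \<D> T" "E = N -` C" by (auto simp: \<C>_def)
    show "closed E" unfolding C(3) by (rule closed_vimage[OF \<D>(3)[OF C(1,2)] contN])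
    fix x y assume xy: "x \<in> E" "y \<in> E"
    then have t: "N x \<in> tri T" "N y \<in> tri T" using C \<D>(2)[OF C(1)] by auto
    have "(1 - \<epsilon>) * cdist x y \<le> L0 * (k^2 * norm (M T (N x - N y)))"
      using Mc(2)[OF C(1) t] L0 \<epsilon> cdist_nonneg by (intro mult_mono) (auto simp: PN)
    also have "\<dots> \<le> \<mu> * norm (M T (N x - N y))"
      using mult_right_mono[OF less_imp_le[OF \<mu>(1)] norm_ge_zero] by (simp only: mult.assoc)
    also have "\<dots> = dist (f' x) (f' y)" using \<D>(4)[OF C(1,2), of "N x" "N y"] xy C(3)
      by (simp add: f'_def)
    finally show "(1 - \<epsilon>) * cdist x y \<le> dist (f' x) (f' y)" .
  qed
  then show ?thesis using short near L' by blast
qed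

section \<open>The limit map\<close>

text \<open>Inverse of the stereographic projection from the south pole; the closed unit disk goes
  to the upper hemisphere.\<close>

definition stereo :: "complex \<Rightarrow> real ^ 3" where
  "stereo p = (1 / (1 + (norm p)^2)) *\<^sub>R vector [2 * Re p, 2 * Im p, 1 - (norm p)^2]"

lemma inner_real3: "(x :: real ^ 3) \<bullet> y = x $ 1 * y $ 1 + x $ 2 * y $ 2 + x $ 3 * y $ 3"
  by (simp add: inner_vec_def sum_3)

lemma dist_unit_inner:
  fixes x y :: "'a::real_inner"
  assumes "norm x = 1" "norm y = 1" shows "(dist x y)^2 = 2 - 2 * (x \<bullet> y)"
  using assms by (simp add: dist_norm power2_norm_eq_inner inner_diff inner_commute norm_eq_1)

lemma inner_stereo:
  "stereo p \<bullet> stereo q = (4 * (p \<bullet> q) + (1 - (norm p)^2) * (1 - (norm q)^2)) / ((1 + (norm p)^2) * (1 + (norm q)^2))"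
  by (simp add: stereo_def inner_real3 inner_complex_def algebra_simps add_divide_distrib diff_divide_distrib)

lemma norm_stereo: "norm (stereo p) = 1"
proof -
  have "0 < 1 + (norm p)^2" by (simp add: add_pos_nonneg)
  moreover have "4 * (norm p)^2 + (1 - (norm p)^2) * (1 - (norm p)^2) = (1 + (norm p)^2) * (1 + (norm p)^2)"
    by (simp add: algebra_simps)
  ultimately have "stereo p \<bullet> stereo p = 1"
    unfolding inner_stereo by (simp add: power2_norm_eq_inner[symmetric])
  then show ?thesis by (simp add: norm_eq_1)
qed

text \<open>This also supplies the triangle inequality for \<open>cdist\<close>, which
  \<open>chain_cover\<close> demands.\<close>

lemma cdist_stereo: "cdist p q = dist (stereo p) (stereo q)"
proof (rule power2_eq_imp_eq)
  have pos: "0 < 1 + (norm z)^2" for z :: complex by (simp add: add_pos_nonneg)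
  have pq: "(dist p q)^2 = (norm p)^2 + (norm q)^2 - 2 * (p \<bullet> q)"
    by (simp add: dist_norm power2_norm_eq_inner inner_diff inner_commute)
  have "(cdist p q)^2 = 4 * (dist p q)^2 / ((1 + (norm p)^2) * (1 + (norm q)^2))"
    using pos[of p] pos[of q] by (simp add: cdist_def weight_def power_mult_distrib power_divide)
  also have "\<dots> = 2 - 2 * (stereo p \<bullet> stereo q)"
  proof -
    let ?K = "(1 + (norm p)^2) * (1 + (norm q)^2)"
    have "?K \<noteq> 0" using pos[of p] pos[of q] by (metis less_irrefl mult_eq_0_iff)
    moreover have "4 * (dist p q)^2 = 2 * ?K - 2 * (4 * (p \<bullet> q) + (1 - (norm p)^2) * (1 - (norm q)^2))"
      unfolding pq by (simp add: algebra_simps)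
    moreover have "(2 * K - 2 * N) / K = 2 - 2 * (N / K)" if "K \<noteq> 0" for K N :: real
      using that by (simp add: diff_divide_distrib)
    ultimately show ?thesis unfolding inner_stereo by presburger
  qed
  finally show "(cdist p q)^2 = (dist (stereo p) (stereo q))^2"
    by (simp add: dist_unit_inner norm_stereo)
qed (simp_all add: cdist_nonneg)

lemma almost_expanding_mono:
  "almost_expanding e f \<C> \<Longrightarrow> e \<le> e' \<Longrightarrow> almost_expanding e' f \<C>"
  unfolding almost_expanding_def
  by (meson cdist_nonneg diff_left_mono mult_right_mono order_trans)

text \<open>After the \<open>n\<close>th step the total displacement still to come is kept below \<open>e\<close>, where \<open>e\<close> times the
  number of pieces is small: the lower length bound of the \<open>n\<close>th map survives in the limit.\<close>

lemma limit_map_exists: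
  obtains F :: "complex \<Rightarrow> complex" where
    "\<And>e. e > 0 \<Longrightarrow> \<exists>g L. L < 1 \<and> locally_short L g \<and> (\<forall>p\<in>square. dist (F p) (g p) \<le> e)"
    "\<And>e. e > 0 \<Longrightarrow> \<exists>g \<C> (\<delta>::real). almost_expanding e g \<C> \<and> (\<forall>p\<in>square. dist (F p) (g p) \<le> \<delta>) \<and> card \<C> * \<delta> \<le> e"
proof -
  define P where "P n = (\<lambda>(f, L, e :: real, \<C>). 0 \<le> L \<and> L < 1 \<and> locally_short L f \<and> 0 < e \<and> e \<le> 1 / real (Suc n) \<and>
      almost_expanding (1 / real (Suc n)) f \<C> \<and> card \<C> * e \<le> 1 / real (Suc n))" for n
  \<comment> \<open>Each step uses at most half of the budget \<open>e\<close> and leaves at most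
    half for all later ones, so displacements telescope to at most
    \<open>e n - e (n + k)\<close>.\<close>
  define Q where "Q = (\<lambda>(f :: complex \<Rightarrow> complex, L :: real, e :: real, \<C> :: complex set set)
      (f' :: complex \<Rightarrow> complex, L' :: real, e' :: real, \<C>' :: complex set set).
      (\<forall>p\<in>square. dist (f p) (f' p) \<le> e / 2) \<and> e' \<le> e / 2)"
  have "\<exists>x. \<forall>n. P n (x n) \<and> Q (x n) (x (Suc n))"
  proof (rule dependent_nat_choice)
    have "closed square" using compact_square compact_imp_closed by blast
    \<comment> \<open>A constant map is short with \<open>L = 0\<close>, and with error 1 the
      expansion bound is void.\<close>
    then have "P 0 (\<lambda>_. 0, 0, 1, {square})"
      unfolding P_def by (auto simp: locally_short_def almost_expanding_def intro!: exI[of _ 1])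
    then show "\<exists>x. P 0 x" by blast
  next
    fix x n assume x: "P n x"
    obtain f L e \<C> where fx: "x = (f, L, e, \<C>)" by (metis prod_cases4)
    define \<epsilon> where "\<epsilon> = min (e / 2) (1 / real (Suc (Suc n)))"
    have f: "locally_short L f" "0 \<le> L" "L < 1" "0 < e" "e \<le> 1 / real (Suc n)" using x
      by (auto simp: P_def fx)
    have "1 / real (Suc (Suc n)) < 1" by simp
    then have \<epsilon>: "0 < \<epsilon>" "\<epsilon> < 1" "\<epsilon> \<le> e / 2" "\<epsilon> \<le> 1 / real (Suc (Suc n))" using f unfolding \<epsilon>_def by (auto simp: min_less_iff_disj)
    obtain f' L' \<C>' where f': "0 \<le> L'" "L' < 1" "locally_short L' f'"
      "\<forall>p\<in>square. dist (f p) (f' p) \<le> \<epsilon>" "almost_expanding \<epsilon> f' \<C>'"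
      using folding_step[OF f(1-3) \<epsilon>(1,2)] by blast
    \<comment> \<open>With budget at most \<open>1 / c\<close>, the number of pieces times the
      budget is at most \<open>1 / (n + 2)\<close>; the successor of the cardinality keeps
      \<open>c\<close> positive.\<close>
    define c where "c = real (Suc (card \<C>')) * real (Suc (Suc n))"
    have "1 * real (Suc (Suc n)) \<le> c" unfolding c_def by (intro mult_right_mono) auto
    then have c: "c > 0" "c \<ge> real (Suc (Suc n))" by auto
    define e' where "e' = min (e / 2) (1 / c)"
    have e': "0 < e'" "e' \<le> e / 2" "e' \<le> 1 / c" using f c by (auto simp: e'_def)
    have "card \<C>' * e' \<le> real (Suc (card \<C>')) * (1 / c)" using e' by (intro mult_mono) auto
    also have "\<dots> = 1 / real (Suc (Suc n))" unfolding c_def by (simp del: of_nat_Suc)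
    finally have e'1: "card \<C>' * e' \<le> 1 / real (Suc (Suc n))" .
    have "1 / c \<le> 1 / real (Suc (Suc n))" using c by (intro divide_left_mono) auto
    then have e'2: "e' \<le> 1 / real (Suc (Suc n))" using e'(3) by linarith
    have "P (Suc n) (f', L', e', \<C>')"
      unfolding P_def using f' e' e'1 e'2 almost_expanding_mono[OF f'(5) \<epsilon>(4)] by simp
    moreover have "Q x (f', L', e', \<C>')" unfolding Q_def fx using f'(4) \<epsilon>(3) e'(2)
      by (auto intro: order_trans)
    ultimately show "\<exists>y. P (Suc n) y \<and> Q x y" by blast
  qed
  then obtain x where x: "\<And>n. P n (x n)" "\<And>n. Q (x n) (x (Suc n))" by blast
  define f L e \<C> where "f n = fst (x n)" and "L n = fst (snd (x n))"
    and "e n = fst (snd (snd (x n)))" and "\<C> n = snd (snd (snd (x n)))" for n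
  have P: "L n < 1" "locally_short (L n) (f n)" "0 < e n" "e n \<le> 1 / real (Suc n)"
    "almost_expanding (1 / real (Suc n)) (f n) (\<C> n)" "card (\<C> n) * e n \<le> 1 / real (Suc n)" for n
    using x(1)[of n] by (auto simp: P_def f_def L_def e_def \<C>_def case_prod_beta)
  have Q: "dist (f n p) (f (Suc n) p) \<le> e n / 2" "e (Suc n) \<le> e n / 2" if "p \<in> square" for n p
    using x(2)[of n] that by (auto simp: Q_def f_def e_def case_prod_beta)
  have tele: "dist (f n p) (f (n + k) p) \<le> e n - e (n + k)" if "p \<in> square" for n k p
  proof (induction k)
    case (Suc k)
    then show ?case
      using Q[OF that, of "n + k"] dist_triangle[of "f n p" "f (Suc (n + k)) p" "f (n + k) p"] by simp
  qed simp
  have near: "dist (f n p) (f m p) \<le> e n" if "p \<in> square" "n \<le> m" for n m p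
    using tele[OF that(1), of n "m - n"] P(3)[of m] that(2) by simp
  have e0: "\<exists>n. 1 / real (Suc n) < d" if "d > 0" for d using nat_approx_posE[OF that] by blast
  define F where "F p = lim (\<lambda>n. f n p)" for p
  have lim: "(\<lambda>n. f n p) \<longlonglongrightarrow> F p" if p: "p \<in> square" for p
  proof -
    have "Cauchy (\<lambda>n. f n p)"
    proof (rule metric_CauchyI)
      fix d :: real assume "d > 0"
      then obtain n where n: "1 / real (Suc n) < d / 2" using e0[of "d/2"] by auto
      have "dist (f m p) (f k p) < d" if "m \<ge> n" "k \<ge> n" for m k
        using near[OF p that(1)] near[OF p that(2)] P(4)[of n] n dist_triangle3[of "f m p" "f k p" "f n p"]
          by linarith
      then show "\<exists>M. \<forall>m\<ge>M. \<forall>n\<ge>M. dist (f m p) (f n p) < d" by blast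
    qed
    then show ?thesis unfolding F_def using Cauchy_convergent convergent_LIMSEQ_iff by blast
  qed
  have nearF: "dist (F p) (f n p) \<le> e n" if p: "p \<in> square" for n p
  proof (rule tendsto_le[OF sequentially_bot tendsto_const])
    show "(\<lambda>m. dist (f m p) (f n p)) \<longlonglongrightarrow> dist (F p) (f n p)"
      by (intro tendsto_intros lim[OF p])
    show "\<forall>\<^sub>F m in sequentially. dist (f m p) (f n p) \<le> e n"
      using eventually_ge_at_top[of n] by eventually_elim (metis near[OF p] dist_commute)
  qed
  show thesis
  proof (rule that)
    fix d :: real assume "d > 0"
    then obtain n where n: "1 / real (Suc n) < d" using e0 by blast
    then have "e n \<le> d" using P(4)[of n] by linarith
    then have "\<forall>p\<in>square. dist (F p) (f n p) \<le> d" using nearF order_trans by blast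
    then show "\<exists>g L. L < 1 \<and> locally_short L g \<and> (\<forall>p\<in>square. dist (F p) (g p) \<le> d)" using P(1,2) by blast
    have "almost_expanding d (f n) (\<C> n)" using almost_expanding_mono[OF P(5)[of n]] n by simp
    moreover have "card (\<C> n) * e n \<le> d" using P(6)[of n] n by linarith
    ultimately show "\<exists>g \<C> (\<delta>::real). almost_expanding d g \<C> \<and> (\<forall>p\<in>square. dist (F p) (g p) \<le> \<delta>) \<and> card \<C> * \<delta> \<le> d"
      using nearF by blast
  qed
qed

text \<open>On a piece of the approximating \<open>g\<close>, passing to \<open>F\<close> costs
  \<open>\<delta>\<close> at either end; \<open>chain_cover\<close> charges this once per piece, in
  total at most \<open>2 * d\<close>.\<close>

lemma limit_map_length:
  assumes F: "\<And>e. e > 0 \<Longrightarrow> \<exists>g \<C> (\<delta>::real). almost_expanding e g \<C> \<and> (\<forall>p\<in>square. dist (F p) (g p) \<le> \<delta>) \<and> card \<C> * \<delta> \<le> e"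
    and "s \<le> t" "continuous_on {s..t} \<alpha>" "\<alpha> ` {s..t} \<subseteq> square"
  shows "length_ge (F \<circ> \<alpha>) s t (cdist (\<alpha> s) (\<alpha> t))"
  unfolding length_ge_def
proof (intro allI impI)
  fix e :: real assume "e > 0"
  define D where "D = cdist (\<alpha> s) (\<alpha> t)"
  have D: "D \<ge> 0" by (simp add: D_def cdist_nonneg)
  \<comment> \<open>The loss is \<open>d * D\<close> from the factor \<open>1 - d\<close> and
    \<open>2 * d\<close> from the pieces, so \<open>d * (D + 2) \<le> e\<close> suffices.\<close>
  define d where "d = min (1/2) (e / (D + 2))"
  have d: "0 < d" "d < 1" "d * (D + 2) \<le> e"
  proof -
    show "0 < d" "d < 1" using \<open>e > 0\<close> D by (auto simp: d_def)
    have "d * (D + 2) \<le> e / (D + 2) * (D + 2)" using D by (intro mult_right_mono) (auto simp: d_def)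
    then show "d * (D + 2) \<le> e" using D by simp
  qed
  obtain g \<C> and \<delta> :: real where g: "almost_expanding d g \<C>" "\<And>p. p \<in> square \<Longrightarrow> dist (F p) (g p) \<le> \<delta>" "card \<C> * \<delta> \<le> d"
    using F[OF d(1)] by blast
  \<comment> \<open>Pieces are cut down to the square, where alone \<open>F\<close> is known to be
    near \<open>g\<close>.\<close>
  define \<D> where "\<D> = (\<lambda>C. C \<inter> square) ` \<C>"
  have "0 \<in> square" by (simp add: square_def)
  from g(2)[OF this] have \<delta>: "\<delta> \<ge> 0" using zero_le_dist order_trans by blast
  have fin: "finite \<C>" "square \<subseteq> \<Union>\<C>" "\<And>C. C \<in> \<C> \<Longrightarrow> closed C"
    "\<And>C x y. C \<in> \<C> \<Longrightarrow> x \<in> C \<Longrightarrow> y \<in> C \<Longrightarrow> (1 - d) * cdist x y \<le> dist (g x) (g y)"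
    using g(1) by (auto simp: almost_expanding_def)
  have "\<exists>c. chain (F \<circ> \<alpha>) s t c \<and> (1 - d) * cdist (\<alpha> s) (\<alpha> t) \<le> c + card \<D> * (2 * \<delta>)"
  proof (rule chain_cover[of \<D> s t \<alpha> "\<lambda>x y. (1 - d) * cdist x y" F])
    show "finite \<D>" using fin by (simp add: \<D>_def)
    show "\<alpha> ` {s..t} \<subseteq> \<Union>\<D>" using assms(4) fin(2) by (auto simp: \<D>_def)
    show "closed C" if "C \<in> \<D>" for C
      using that fin(3) compact_imp_closed[OF compact_square] by (auto simp: \<D>_def)
    show "(1 - d) * cdist x y \<le> dist (F x) (F y) + 2 * \<delta>"
      if "C \<in> \<D>" "x \<in> C" "y \<in> C" for C x y
    proof -
      obtain C' where C': "C' \<in> \<C>" "C = C' \<inter> square" using \<open>C \<in> \<D>\<close>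
        by (auto simp: \<D>_def)
      have "dist (g x) (g y) \<le> dist (F x) (F y) + dist (F x) (g x) + dist (F y) (g y)"
        using dist_triangle[of "g x" "g y" "F x"] dist_triangle[of "F x" "g y" "F y"]
          by (simp add: dist_commute)
      then show ?thesis using fin(4)[OF C'(1), of x y] g(2)[of x] g(2)[of y] that C' by auto
    qed
    show "(1 - d) * cdist x z \<le> (1 - d) * cdist x y + (1 - d) * cdist y z" for x y z
      using mult_left_mono[OF dist_triangle[of "stereo x" "stereo z" "stereo y"], of "1 - d"] d
      by (simp add: cdist_stereo distrib_left)
  qed (use assms \<delta> in auto)
  then obtain c where c: "chain (F \<circ> \<alpha>) s t c" "(1 - d) * D \<le> c + card \<D> * (2 * \<delta>)" by (auto simp: D_def)
  have "card \<D> * \<delta> \<le> card \<C> * \<delta>" using card_image_le[OF fin(1)] \<delta>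
    by (intro mult_right_mono) (auto simp: \<D>_def)
  then have "card \<D> * (2 * \<delta>) \<le> 2 * d" using g(3) by simp
  then have "D \<le> c + e" using c(2) d(3) by (simp add: algebra_simps)
  then show "\<exists>c. chain (F \<circ> \<alpha>) s t c \<and> cdist (\<alpha> s) (\<alpha> t) \<le> c + e" using c(1) by (auto simp: D_def)
qed

section \<open>From the square to the sphere\<close>

lemma unit_sphere_sq:
  fixes x :: "real ^ 3"
  assumes "norm x = 1" shows "(x $ 1)^2 + (x $ 2)^2 + (x $ 3)^2 = 1"
proof -
  have "x \<bullet> x = 1" using assms by (simp add: norm_eq_1)
  then show ?thesis by (simp add: inner_real3 power2_eq_square)
qed

lemma norm_sq_real3: "(norm (x :: real ^ 3))^2 = (x $ 1)^2 + (x $ 2)^2 + (x $ 3)^2"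
  unfolding power2_norm_eq_inner inner_real3 by (simp add: power2_eq_square)

text \<open>Fold the sphere onto the upper hemisphere and project stereographically from the south
  pole; the image is the closed unit disk.\<close>

definition fold3 :: "real ^ 3 \<Rightarrow> real ^ 3" where
  "fold3 x = vector [x $ 1, x $ 2, \<bar>x $ 3\<bar>]"

definition chart :: "real ^ 3 \<Rightarrow> complex" where
  "chart x = Complex (x $ 1 / (1 + \<bar>x $ 3\<bar>)) (x $ 2 / (1 + \<bar>x $ 3\<bar>))"

lemma norm_chart_sq:
  assumes "norm x = 1" shows "(norm (chart x))^2 = (1 - \<bar>x $ 3\<bar>) / (1 + \<bar>x $ 3\<bar>)"
proof -
  let ?z = "\<bar>x $ 3\<bar>"
  have "(norm (chart x))^2 = ((x $ 1)^2 + (x $ 2)^2) / (1 + ?z)^2"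
    by (simp add: chart_def cmod_power2 power_divide add_divide_distrib)
  also have "(x $ 1)^2 + (x $ 2)^2 = (1 - ?z) * (1 + ?z)"
    using unit_sphere_sq[OF assms] by (simp add: algebra_simps power2_eq_square)
  also have "(1 - ?z) * (1 + ?z) / (1 + ?z)^2 = (1 - ?z) / (1 + ?z)"
    by (simp add: power2_eq_square)
  finally show ?thesis .
qed

lemma stereo_chart:
  assumes "norm x = 1" shows "stereo (chart x) = fold3 x"
proof -
  let ?z = "\<bar>x $ 3\<bar>"
  have z: "1 + ?z > 0" by simp
  have a: "1 + (norm (chart x))^2 = 2 / (1 + ?z)" "1 - (norm (chart x))^2 = 2 * ?z / (1 + ?z)"
    unfolding norm_chart_sq[OF assms] using z by (simp_all add: field_simps)
  show ?thesis
    unfolding stereo_def a vec_eq_iff forall_3 fold3_def using z by (simp add: chart_def)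
qed

text \<open>The chart has values in the closed unit disk. The square around it serves as domain
  because a grid triangulates it without remainder.\<close>

lemma chart_in_square:
  assumes "norm x = 1" shows "chart x \<in> square"
proof -
  have "(norm (chart x))^2 \<le> 1" unfolding norm_chart_sq[OF assms] by simp
  then have "norm (chart x) \<le> 1" by (simp add: power_le_one_iff)
  then show ?thesis
    using abs_Re_le_cmod[of "chart x"] abs_Im_le_cmod[of "chart x"] by (simp add: square_def)
qed

lemma cdist_chart:
  assumes "norm x = 1" "norm y = 1" shows "cdist (chart x) (chart y) = dist (fold3 x) (fold3 y)"
  by (simp add: cdist_stereo stereo_chart assms)

lemma dist_fold3_le: "dist (fold3 x) (fold3 y) \<le> dist x y"
proof (rule power2_le_imp_le)
  have "(\<bar>x $ 3\<bar> - \<bar>y $ 3\<bar>)^2 \<le> (x $ 3 - y $ 3)^2"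
    by (simp add: abs_le_square_iff[symmetric])
  then show "(dist (fold3 x) (fold3 y))^2 \<le> (dist x y)^2"
    by (simp add: dist_norm norm_sq_real3 fold3_def)
qed simp

lemma dist_fold3_eq:
  assumes "x $ 3 \<ge> 0 \<and> y $ 3 \<ge> 0 \<or> x $ 3 \<le> 0 \<and> y $ 3 \<le> 0"
  shows "dist (fold3 x) (fold3 y) = dist x y"
proof (rule power2_eq_imp_eq)
  have "(\<bar>x $ 3\<bar> - \<bar>y $ 3\<bar>)^2 = (x $ 3 - y $ 3)^2"
    using assms by (auto simp: power2_commute)
  then show "(dist (fold3 x) (fold3 y))^2 = (dist x y)^2"
    by (simp add: dist_norm norm_sq_real3 fold3_def)
qed simp_all

text \<open>On the square \<open>(norm p)^2 \<le> 2\<close>, so both weights are at least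
  \<open>sqrt (2/3)\<close>. This turns small chords into the small coordinate distances that
  \<open>locally_short\<close> asks for.\<close>

lemma dist_square_le_cdist:
  assumes "p \<in> square" "q \<in> square" shows "dist p q \<le> 3/2 * cdist p q"
proof -
  have w: "sqrt (2/3) \<le> weight p" if "p \<in> square" for p
  proof -
    have "(norm p)^2 \<le> 1 + 1"
      unfolding cmod_power2 using that by (intro add_mono) (auto simp: square_def abs_square_le_1)
    then have "2 / 3 \<le> 2 / (1 + (norm p)^2)" by (intro divide_left_mono) (auto simp: add_pos_nonneg)
    then show ?thesis unfolding weight_def real_sqrt_divide[symmetric] by (rule real_sqrt_le_mono)
  qed
  have "sqrt (2/3) * sqrt (2/3) \<le> weight p * weight q"
    using w[OF assms(1)] w[OF assms(2)] weight_pos[of p] by (intro mult_mono) auto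
  then have "2/3 * dist p q \<le> cdist p q"
    unfolding cdist_def by (intro mult_right_mono) auto
  then show ?thesis by simp
qed

lemma continuous_on_chart: "continuous_on S chart"
proof -
  have "1 + \<bar>x $ 3\<bar> \<noteq> 0" for x :: "real ^ 3" by (metis abs_add_one_gt_zero less_irrefl)
  then show ?thesis unfolding chart_def Complex_eq
    by (intro continuous_intros) auto
qed

section \<open>Chords, angles and great circles\<close>

lemma dist_le_angle:
  fixes x y :: "'a::real_inner"
  assumes "norm x = 1" "norm y = 1" shows "dist x y \<le> arccos (x \<bullet> y)"
proof -
  note b = inner_unit_bounds[OF assms]
  define \<theta> where "\<theta> = arccos (x \<bullet> y)"
  have \<theta>: "0 \<le> \<theta>" "cos \<theta> = x \<bullet> y" using b
    by (auto simp: \<theta>_def arccos_lbound)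
  have "(dist x y)^2 = 2 - 2 * cos (2 * (\<theta> / 2))" using \<theta> by (simp add: dist_unit_inner assms)
  also have "\<dots> = 4 * (sin (\<theta> / 2))^2" unfolding cos_double_sin by simp
  also have "\<dots> \<le> 4 * (\<theta> / 2)^2"
    using abs_le_square_iff[THEN iffD1, OF abs_sin_x_le_abs_x[of "\<theta> / 2"]] by linarith
  finally have "(dist x y)^2 \<le> \<theta>^2" by (simp add: power_divide)
  then show ?thesis unfolding \<theta>_def[symmetric] by (rule power2_le_imp_le[OF _ \<theta>(1)])
qed

lemma great_circle:
  fixes x y :: "real ^ 3"
  assumes "norm x = 1" "norm y = 1"
  obtains w where "norm w = 1" "x \<bullet> w = 0" "y = cos (arccos (x \<bullet> y)) *\<^sub>R x + sin (arccos (x \<bullet> y)) *\<^sub>R w"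
proof -
  note b = inner_unit_bounds[OF assms]
  define c where "c = x \<bullet> y"
  have c: "cos (arccos c) = c" "sin (arccos c) = sqrt (1 - c^2)"
    using b by (auto simp: c_def sin_arccos)
  have xx: "x \<bullet> x = 1" "y \<bullet> y = 1" using assms by (simp_all add: norm_eq_1)
  define v where "v = y - c *\<^sub>R x"
  have vv: "v \<bullet> v = 1 - c^2" "x \<bullet> v = 0"
    using xx by (simp_all add: v_def inner_diff inner_commute c_def power2_eq_square)
  then have nv: "norm v = sqrt (1 - c^2)" by (simp add: norm_eq_sqrt_inner)
  show thesis
  proof (cases "v = 0")
    case True
    \<comment> \<open>\<open>y\<close> is \<open>x\<close> or its antipode and determines no
      direction; any unit vector orthogonal to \<open>x\<close> will do.\<close>
    obtain w0 :: "real ^ 3" where w0: "w0 \<noteq> 0" "orthogonal x w0"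
      using orthogonal_to_vector_exists[of x] by (auto simp: orthogonal_commute)
    show thesis
    proof (rule that[of "sgn w0"])
      show "norm (sgn w0) = 1" "x \<bullet> sgn w0 = 0"
        using w0 by (simp_all add: norm_sgn sgn_div_norm orthogonal_def)
      show "y = cos (arccos (x \<bullet> y)) *\<^sub>R x + sin (arccos (x \<bullet> y)) *\<^sub>R sgn w0"
        unfolding c_def[symmetric] c nv[symmetric] using True by (simp add: v_def)
    qed
  next
    case False
    show thesis
    proof (rule that[of "sgn v"])
      show "norm (sgn v) = 1" using False by (simp add: norm_sgn)
      show "x \<bullet> sgn v = 0" using vv by (simp add: sgn_div_norm)
      have "norm v *\<^sub>R sgn v = v" using False by (simp add: sgn_div_norm)
      then show "y = cos (arccos (x \<bullet> y)) *\<^sub>R x + sin (arccos (x \<bullet> y)) *\<^sub>R sgn v"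
        unfolding c_def[symmetric] c nv[symmetric] by (simp add: v_def)
    qed
  qed
qed

text \<open>Cut the arc from \<open>x\<close> to \<open>y\<close> into equal steps so short that
  local shortness applies to each. Folding onto the hemisphere does not lengthen them, so the images
  add up to at most the angle.\<close>

lemma short_along_great_circle:
  assumes "L < 1" "locally_short L g" "norm x = 1" "norm y = 1"
  shows "dist (g (chart x)) (g (chart y)) \<le> arccos (x \<bullet> y)"
proof -
  define \<theta> where "\<theta> = arccos (x \<bullet> y)"
  have \<theta>: "0 \<le> \<theta>" using inner_unit_bounds[OF assms(3,4)]
    by (simp add: \<theta>_def arccos_lbound)
  obtain w where w: "norm w = 1" "x \<bullet> w = 0" "y = cos \<theta> *\<^sub>R x + sin \<theta> *\<^sub>R w"
    using great_circle[OF assms(3,4)] unfolding \<theta>_def by blast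
  define X where "X t = cos t *\<^sub>R x + sin t *\<^sub>R w" for t
  have xx: "x \<bullet> x = 1" "w \<bullet> w = 1" using assms w by (simp_all add: norm_eq_1)
  have inn: "X s \<bullet> X t = cos (s - t)" for s t
    using xx w(2) by (simp add: X_def inner_add inner_commute cos_diff)
  have nX: "norm (X t) = 1" for t using inn[of t t] by (simp add: norm_eq_1)
  have dX: "dist (X s) (X t) \<le> \<bar>s - t\<bar>" if "\<bar>s - t\<bar> \<le> pi" for s t
    using dist_le_angle[OF nX nX, of s t] that arccos_cos2[of "s - t"] arccos_cos[of "s - t"]
    by (cases "s - t \<ge> 0") (auto simp: inn)
  obtain r where r: "r > 0" "\<And>p q. p \<in> square \<Longrightarrow> q \<in> square \<Longrightarrow> dist p q \<le> r \<Longrightarrow>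
      dist (g p) (g q) \<le> L * cdist p q"
    using assms(2) unfolding locally_short_def by blast
  \<comment> \<open>A step has chordal length at most \<open>\<theta> / N\<close>, hence coordinate
    distance at most \<open>3/2 * (\<theta> / N)\<close>, which must not exceed
    \<open>r\<close>.\<close>
  define N where "N = nat \<lceil>3/2 * \<theta> / r\<rceil> + 1"
  have "real N \<ge> 3/2 * \<theta> / r" and N: "real N \<ge> 1" unfolding N_def by linarith+
  then have Nr: "3/2 * (\<theta> / N) \<le> r" using r(1) by (simp add: field_simps)
  have "\<theta> \<le> pi" using inner_unit_bounds[OF assms(3,4)] by (simp add: \<theta>_def arccos_ubound)
  moreover have "\<theta> / N \<le> \<theta> / 1" using \<theta> N by (intro divide_left_mono) auto
  ultimately have Npi: "\<theta> / N \<le> pi" by linarith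
  define T where "T k = real k * (\<theta> / N)" for k
  have TS: "T (Suc k) = T k + \<theta> / N" for k by (simp add: T_def distrib_right add_divide_distrib)
  have step: "dist (g (chart (X (T k)))) (g (chart (X (T (Suc k))))) \<le> \<theta> / N" for k
  proof -
    let ?p = "chart (X (T k))" and ?q = "chart (X (T (Suc k)))"
    have "\<bar>T k - T (Suc k)\<bar> = \<theta> / N" using \<theta> by (simp add: TS)
    then have "dist (X (T k)) (X (T (Suc k))) \<le> \<theta> / N" using dX Npi by metis
    then have c: "cdist ?p ?q \<le> \<theta> / N" unfolding cdist_chart[OF nX nX]
      by (rule order_trans[OF dist_fold3_le])
    then have "dist ?p ?q \<le> r"
      using dist_square_le_cdist[OF chart_in_square[OF nX] chart_in_square[OF nX], of "T k" "T (Suc k)"] Nr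
        by simp
    then have "dist (g ?p) (g ?q) \<le> L * cdist ?p ?q" by (intro r(2) chart_in_square nX)
    also have "\<dots> \<le> 1 * cdist ?p ?q" using assms(1) cdist_nonneg by (intro mult_right_mono) auto
    finally show ?thesis using c by simp
  qed
  have "dist (g (chart (X (T 0)))) (g (chart (X (T k)))) \<le> T k" for k
  proof (induction k)
    case 0 then show ?case by (simp add: T_def)
  next
    case (Suc k)
    then show ?case
      using step[of k] dist_triangle[of "g (chart (X (T 0)))" "g (chart (X (T (Suc k))))" "g (chart (X (T k)))"]
      by (simp add: TS)
  qed
  moreover have "T N = \<theta>" "X (T 0) = x" "X \<theta> = y" using N w(3) by (simp_all add: T_def X_def)
  ultimately show ?thesis unfolding \<theta>_def[symmetric] by metis
qed

text \<open>Chord over angle is \<open>sin (\<theta> / 2) / (\<theta> / 2)\<close>, which tends to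
  1; continuity of \<open>arccos\<close> at 1 gives a short chord a small angle.\<close>

lemma angle_le_chord:
  fixes e :: real
  assumes "0 < e" "e < 1"
  obtains d where "d > 0" "\<And>x y :: 'a::real_inner. norm x = 1 \<Longrightarrow> norm y = 1 \<Longrightarrow> dist x y < d \<Longrightarrow>
     (1 - e) * arccos (x \<bullet> y) \<le> dist x y"
proof -
  have "((\<lambda>t::real. sin t / t) \<longlongrightarrow> 1) (at 0)" using DERIV_sin[of 0]
    by (simp add: DERIV_def)
  then have "\<forall>\<^sub>F t in at (0::real). 1 - e < sin t / t" using assms
    by (intro order_tendstoD(1)) auto
  then obtain a where a: "a > 0" "\<And>t::real. t \<noteq> 0 \<Longrightarrow> \<bar>t\<bar> < a \<Longrightarrow> 1 - e < sin t / t"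
    unfolding eventually_at by (auto simp: dist_real_def)
  have cont: "continuous_on {-1..1} arccos" by (rule continuous_on_arccos')
  have "(1::real) \<in> {-1..1}" "0 < 2 * a" using a(1) by auto
  then have "\<exists>b>0. \<forall>v\<in>{-1..1}. dist v 1 < b \<longrightarrow> dist (arccos v) (arccos 1) < 2 * a"
    using cont[unfolded continuous_on_iff] by blast
  then obtain b where b: "b > 0" "\<And>v. v \<in> {-1..1} \<Longrightarrow> \<bar>v - 1\<bar> < b \<Longrightarrow> \<bar>arccos v - arccos 1\<bar> < 2 * a"
    by (auto simp: dist_real_def)
  show thesis
  proof (rule that[of "sqrt b"])
    show "sqrt b > 0" using b by simp
    fix x y :: 'a assume xy: "norm x = 1" "norm y = 1" "dist x y < sqrt b"
    note bd = inner_unit_bounds[OF xy(1,2)]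
    define \<theta> where "\<theta> = arccos (x \<bullet> y)"
    have \<theta>: "0 \<le> \<theta>" "\<theta> \<le> pi" "cos \<theta> = x \<bullet> y" using bd
      by (auto simp: \<theta>_def arccos_lbound arccos_ubound)
    have "(dist x y)^2 < b" using xy(3) real_less_rsqrt[of "dist x y" b] power_strict_mono[OF xy(3), of 2] b
      by simp
    then have "\<bar>x \<bullet> y - 1\<bar> < b" using bd b by (simp add: dist_unit_inner xy)
    then have th: "\<theta> < 2 * a" using b(2)[of "x \<bullet> y"] bd \<theta> by (simp add: \<theta>_def)
    have s: "0 \<le> sin (\<theta> / 2)" using \<theta> by (intro sin_ge_zero) auto
    have "(dist x y)^2 = 2 - 2 * cos (2 * (\<theta> / 2))" using \<theta> by (simp add: dist_unit_inner xy)
    also have "\<dots> = (2 * sin (\<theta> / 2))^2" unfolding cos_double_sin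
      by (simp add: power_mult_distrib)
    finally have d: "dist x y = 2 * sin (\<theta> / 2)" by (rule power2_eq_imp_eq) (use s in auto)
    show "(1 - e) * arccos (x \<bullet> y) \<le> dist x y"
    proof (cases "\<theta> = 0")
      case False
      then have "1 - e < sin (\<theta> / 2) / (\<theta> / 2)" using a(2)[of "\<theta> / 2"] th \<theta>
        by simp
      then have "(1 - e) * (\<theta> / 2) < sin (\<theta> / 2)" using False \<theta>
        by (simp add: pos_less_divide_eq)
      then show ?thesis unfolding d \<theta>_def[symmetric] by simp
    qed (simp add: \<theta>_def)
  qed
qed

lemma length_ge_isometry:
  assumes "\<And>x y. dist (h x) (h y) = dist x y" "length_ge g s t l"
  shows "length_ge (h \<circ> g) s t l"
proof -
  have "chain (h \<circ> g) s t c" if "chain g s t c" for s t c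
    using that
  proof (induction rule: chain.induct)
    case (step s u c t)
    show ?case using chain.step[OF step.IH step.hyps(2)] by (simp add: assms(1))
  qed (rule chain.refl)
  then show ?thesis using assms(2) unfolding length_ge_def by blast
qed

text \<open>If the end points lie in one closed hemisphere, folding keeps their distance, wherever
  the curve goes in between. Otherwise it crosses the equator, and a crossing point belongs to both
  hemispheres: add the two parts.\<close>

lemma length_ge_chord:
  assumes F: "\<And>s t \<alpha>. s \<le> t \<Longrightarrow> continuous_on {s..t} \<alpha> \<Longrightarrow> \<alpha> ` {s..t} \<subseteq> square \<Longrightarrow>
      length_ge (F \<circ> \<alpha>) s t (cdist (\<alpha> s) (\<alpha> t))"
    and st: "s \<le> t" and cont: "continuous_on {s..t} \<alpha>" and unit: "\<And>x. x \<in> {s..t} \<Longrightarrow> norm (\<alpha> x) = 1"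
  shows "length_ge (F \<circ> chart \<circ> \<alpha>) s t (dist (\<alpha> s) (\<alpha> t))"
proof -
  have *: "length_ge (F \<circ> chart \<circ> \<alpha>) a b (dist (\<alpha> a) (\<alpha> b))"
    if ab: "s \<le> a" "a \<le> b" "b \<le> t" and sgn: "\<alpha> a $ 3 \<ge> 0 \<and> \<alpha> b $ 3 \<ge> 0 \<or> \<alpha> a $ 3 \<le> 0 \<and> \<alpha> b $ 3 \<le> 0" for a b
  proof -
    have u: "norm (\<alpha> x) = 1" if "x \<in> {a..b}" for x using unit that ab by auto
    have "continuous_on {a..b} \<alpha>" by (rule continuous_on_subset[OF cont]) (use ab in auto)
    then have "continuous_on {a..b} (chart \<circ> \<alpha>)"
      by (rule continuous_on_compose) (rule continuous_on_chart)
    moreover have "(chart \<circ> \<alpha>) ` {a..b} \<subseteq> square" using chart_in_square u by auto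
    ultimately have "length_ge (F \<circ> (chart \<circ> \<alpha>)) a b (cdist ((chart \<circ> \<alpha>) a) ((chart \<circ> \<alpha>) b))"
      by (intro F ab)
    then show ?thesis using ab u dist_fold3_eq[OF sgn] by (simp add: cdist_chart o_assoc)
  qed
  show ?thesis
  proof (cases "\<alpha> s $ 3 \<ge> 0 \<and> \<alpha> t $ 3 \<ge> 0 \<or> \<alpha> s $ 3 \<le> 0 \<and> \<alpha> t $ 3 \<le> 0")
    case True
    then show ?thesis using * st by blast
  next
    case False
    have c3: "continuous_on {s..t} (\<lambda>x. \<alpha> x $ 3)" by (intro continuous_intros cont)
    have "\<exists>x. s \<le> x \<and> x \<le> t \<and> \<alpha> x $ 3 = 0"
    proof (cases "\<alpha> s $ 3 \<le> 0")
      case True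
      then show ?thesis using False IVT'[of "\<lambda>x. \<alpha> x $ 3" s 0 t] st c3 by auto
    next
      case ns: False
      then show ?thesis using False IVT2'[of "\<lambda>x. \<alpha> x $ 3" t 0 s] st c3 by auto
    qed
    then obtain x where x: "s \<le> x" "x \<le> t" "\<alpha> x $ 3 = 0" by blast
    have "length_ge (F \<circ> chart \<circ> \<alpha>) s x (dist (\<alpha> s) (\<alpha> x))" "length_ge (F \<circ> chart \<circ> \<alpha>) x t (dist (\<alpha> x) (\<alpha> t))"
      using x st by (auto intro!: *)
    from length_ge_trans[OF this] show ?thesis
      by (rule length_ge_mono) (rule dist_triangle)
  qed
qed

text \<open>On a fine partition chords are nearly angles, and the triangle inequality for angles
  sums them up.\<close>

lemma length_ge_angle:
  fixes \<alpha> :: "real \<Rightarrow> 'a::real_inner"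
  assumes chord: "\<And>a b. s \<le> a \<Longrightarrow> a \<le> b \<Longrightarrow> b \<le> t \<Longrightarrow> length_ge g a b (dist (\<alpha> a) (\<alpha> b))"
    and st: "s < t" and cont: "continuous_on {s..t} \<alpha>" and unit: "\<And>x. x \<in> {s..t} \<Longrightarrow> norm (\<alpha> x) = 1"
  shows "length_ge g s t (arccos (\<alpha> s \<bullet> \<alpha> t))"
  unfolding length_ge_def
proof (intro allI impI)
  fix e :: real assume "e > 0"
  define A where "A = arccos (\<alpha> s \<bullet> \<alpha> t)"
  have A: "A \<ge> 0" using inner_unit_bounds[of "\<alpha> s" "\<alpha> t"] unit st
    by (simp add: A_def arccos_lbound)
  define d where "d = min (1/2) (e / (2 * (A + 1)))"
  have d: "0 < d" "d < 1" "d * A \<le> e / 2"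
  proof -
    show "0 < d" "d < 1" using \<open>e > 0\<close> A by (auto simp: d_def)
    have "d * A \<le> e / (2 * (A + 1)) * (A + 1)" using A \<open>0 < d\<close> \<open>e > 0\<close>
      by (intro mult_mono) (auto simp: d_def)
    also have "\<dots> = e / 2"
    proof -
      have "e / (2 * c) * c = e / 2" if "c \<noteq> 0" for c :: real using that by simp
      moreover have "A + 1 \<noteq> 0" using A by simp
      ultimately show ?thesis by blast
    qed
    finally show "d * A \<le> e / 2" .
  qed
  obtain r where r: "r > 0" "\<And>x y :: 'a. norm x = 1 \<Longrightarrow> norm y = 1 \<Longrightarrow> dist x y < r \<Longrightarrow>
     (1 - d) * arccos (x \<bullet> y) \<le> dist x y"
    using angle_le_chord[OF d(1,2)] by blast
  have "uniformly_continuous_on {s..t} \<alpha>" by (rule compact_uniformly_continuous[OF cont]) simp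
  then obtain h where h: "h > 0" "\<And>x y. x \<in> {s..t} \<Longrightarrow> y \<in> {s..t} \<Longrightarrow> dist y x < h \<Longrightarrow> dist (\<alpha> y) (\<alpha> x) < r"
    using r(1) unfolding uniformly_continuous_on_def by metis
  define N where "N = nat \<lceil>(t - s) / h\<rceil> + 1"
  have N: "real N > 0" "(t - s) / h < real N" unfolding N_def by linarith+
  then have Nh: "(t - s) / N < h" using h(1) by (simp add: field_simps)
  define \<tau> where "\<tau> i = s + real i * ((t - s) / N)" for i
  have \<tau>0: "\<tau> 0 = s" "\<tau> N = t" using N by (simp_all add: \<tau>_def)
  have \<tau>S: "\<tau> (Suc i) = \<tau> i + (t - s) / N" for i
    by (simp add: \<tau>_def distrib_right add_divide_distrib)
  have step: "0 < (t - s) / N" using N st by simp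
  have mono: "\<tau> i \<le> \<tau> j" if "i \<le> j" for i j
    using that step unfolding \<tau>_def by (intro add_left_mono mult_right_mono) auto
  have rng: "\<tau> i \<in> {s..t}" if "i \<le> N" for i using mono[of 0 i] mono[OF that] \<tau>0 by simp
  have un: "norm (\<alpha> (\<tau> i)) = 1" if "i \<le> N" for i using unit rng that by blast
  define L where "L i = (1 - d) * arccos (\<alpha> (\<tau> i) \<bullet> \<alpha> (\<tau> (Suc i)))" for i
  have "length_ge g (\<tau> 0) (\<tau> N) (\<Sum>i<N. L i)"
  proof (rule length_ge_sum)
    fix i assume i: "i < N"
    have "dist (\<alpha> (\<tau> i)) (\<alpha> (\<tau> (Suc i))) < r"
      using i Nh step by (intro h(2) rng) (auto simp: \<tau>S dist_real_def)
    then have "L i \<le> dist (\<alpha> (\<tau> i)) (\<alpha> (\<tau> (Suc i)))" unfolding L_def using i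
      by (intro r(2) un) auto
    moreover have "length_ge g (\<tau> i) (\<tau> (Suc i)) (dist (\<alpha> (\<tau> i)) (\<alpha> (\<tau> (Suc i))))"
      using rng[of i] rng[of "Suc i"] mono[of i "Suc i"] i by (intro chord) auto
    ultimately show "length_ge g (\<tau> i) (\<tau> (Suc i)) (L i)" using length_ge_mono by blast
  qed
  moreover have "(1 - d) * A \<le> (\<Sum>i<N. L i)"
  proof -
    have "arccos (\<alpha> (\<tau> 0) \<bullet> \<alpha> (\<tau> n)) \<le> (\<Sum>i<n. arccos (\<alpha> (\<tau> i) \<bullet> \<alpha> (\<tau> (Suc i))))" if "n \<le> N" for n
      using that
    proof (induction n)
      case 0
      have "\<alpha> (\<tau> 0) \<bullet> \<alpha> (\<tau> 0) = 1" using un[of 0] by (simp add: norm_eq_1)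
      then show ?case by simp
    next
      case (Suc n)
      then show ?case using angle_triangle[OF un[of 0] un[of n] un[of "Suc n"]] by simp
    qed
    from mult_left_mono[OF this[of N], of "1 - d"] show ?thesis
      using d by (simp add: L_def A_def \<tau>0 sum_distrib_left)
  qed
  ultimately have "length_ge g s t ((1 - d) * A)" using length_ge_mono \<tau>0 by metis
  then obtain c where c: "chain g s t c" "(1 - d) * A \<le> c + e / 2"
    using \<open>e > 0\<close> unfolding length_ge_def by (meson half_gt_zero)
  have "A \<le> c + e" using c(2) d(3) by (simp add: algebra_simps)
  then show "\<exists>c. chain g s t c \<and> arccos (\<alpha> s \<bullet> \<alpha> t) \<le> c + e"
    using c(1) by (auto simp: A_def)
qed

lemma curve_length_plane_ge:
  fixes g :: "real \<Rightarrow> 'a::metric_space"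
  assumes "length_ge g a b l" "a < b" "{a..b} \<subseteq> I"
  shows "ennreal l \<le> curve_length euclidean_metric I g"
proof (rule ennreal_le_epsilon)
  fix e :: real assume "0 < e"
  then obtain c where c: "chain g a b c" "l \<le> c + e" using assms(1) unfolding length_ge_def by blast
  obtain k \<tau> where k: "k \<ge> 1" "\<forall>i\<le>k. a \<le> \<tau> i \<and> \<tau> i \<le> b" "\<forall>i<k. \<tau> i < \<tau> (Suc i)"
    "c = (\<Sum>i=1..k. dist (g (\<tau> (i - 1))) (g (\<tau> i)))"
    using chain_partition[OF c(1)] assms(2) by blast
  have "ennreal c \<le> curve_length euclidean_metric I g"
    unfolding curve_length_def
    by (rule SUP_upper2[of "(k, \<tau>)"]) (use k assms(3) in auto)
  have "ennreal l \<le> ennreal (c + e)" using c(2) by (rule ennreal_leI)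
  also have "\<dots> = ennreal c + ennreal e" using k(4) \<open>0 < e\<close>
    by (intro ennreal_plus) (auto intro: sum_nonneg)
  also have "\<dots> \<le> curve_length euclidean_metric I g + ennreal e"
    using \<open>ennreal c \<le> _\<close> by (rule add_right_mono)
  finally show "ennreal l \<le> curve_length euclidean_metric I g + ennreal e" .
qed

theorem theorem4p1:
  shows "\<exists>f :: real ^ 3 \<Rightarrow> real ^ 2. length_preserving sphere2 plane f"
proof -
  obtain F :: "complex \<Rightarrow> complex" where
    F1: "\<And>e. e > 0 \<Longrightarrow> \<exists>g L. L < 1 \<and> locally_short L g \<and> (\<forall>p\<in>square. dist (F p) (g p) \<le> e)" and
    F2: "\<And>e. e > 0 \<Longrightarrow> \<exists>g \<C> (\<delta>::real). almost_expanding e g \<C> \<and> (\<forall>p\<in>square. dist (F p) (g p) \<le> \<delta>) \<and> card \<C> * \<delta> \<le> e"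
    using limit_map_exists by metis
  define \<iota> :: "complex \<Rightarrow> real ^ 2" where "\<iota> z = vector [Re z, Im z]" for z
  have \<iota>: "dist (\<iota> z) (\<iota> w) = dist z w" for z w
    by (simp add: \<iota>_def dist_vec_def L2_set_def sum_2 dist_real_def dist_norm cmod_def)
  define f where "f x = \<iota> (F (chart x))" for x
  have short: "dist (f x) (f y) \<le> arccos (x \<bullet> y)" if xy: "norm x = 1" "norm y = 1" for x y
  proof (rule field_le_epsilon)
    fix e :: real assume "0 < e"
    then obtain g L where g: "L < 1" "locally_short L g" "\<forall>p\<in>square. dist (F p) (g p) \<le> e / 2"
      using F1[of "e / 2"] by auto
    have "dist (g (chart x)) (g (chart y)) \<le> arccos (x \<bullet> y)"
      by (rule short_along_great_circle[OF g(1,2) xy])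
    moreover have "dist (F (chart x)) (g (chart x)) \<le> e / 2" "dist (F (chart y)) (g (chart y)) \<le> e / 2"
      using g(3) chart_in_square xy by blast+
    moreover have "dist (F (chart x)) (F (chart y)) \<le> dist (F (chart x)) (g (chart x)) +
       dist (g (chart x)) (g (chart y)) + dist (F (chart y)) (g (chart y))"
      using dist_triangle[of "F (chart x)" "F (chart y)" "g (chart x)"]
        dist_triangle[of "g (chart x)" "F (chart y)" "g (chart y)"] by (simp add: dist_commute)
    ultimately show "dist (f x) (f y) \<le> arccos (x \<bullet> y) + e" by (simp add: f_def \<iota>)
  qed
  have contf: "continuous_map (mtopology_of sphere2) (mtopology_of plane) f"
  proof (rule Lipschitz_continuous_imp_continuous_map)
    show "Lipschitz_continuous_map sphere2 plane f"
      unfolding Lipschitz_continuous_map_def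
      by (intro conjI exI[of _ 1]) (auto simp: mdist_sphere2 short)
  qed
  have "curve_length sphere2 I \<alpha> = curve_length plane I (f \<circ> \<alpha>)"
    if "is_curve sphere2 I \<alpha>" for I \<alpha>
  proof -
    have cI: "convex I" and cm: "continuous_map (top_of_set I) (mtopology_of sphere2) \<alpha>"
      using that by (auto simp: is_curve_def nontrivial_interval_def)
    have unit: "norm (\<alpha> x) = 1" if "x \<in> I" for x
    proof -
      have "\<alpha> x \<in> topspace (mtopology_of sphere2)"
        using continuous_map_image_subset_topspace[OF cm] that by auto
      then show ?thesis by simp
    qed
    \<comment> \<open>Chords are at most angles, so the identity is Lipschitz; this turns continuity
      for \<open>sphere2\<close> into ordinary continuity of \<open>\<alpha>\<close>.\<close>
    have "Lipschitz_continuous_map sphere2 (euclidean_metric :: (real ^ 3) metric) (\<lambda>x. x)"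
      unfolding Lipschitz_continuous_map_def
      by (intro conjI exI[of _ 1]) (auto simp: mdist_sphere2 dist_le_angle)
    from continuous_map_compose[OF cm Lipschitz_continuous_imp_continuous_map[OF this]]
    have cont: "continuous_on I \<alpha>" by (simp add: o_def)
    have low: "length_ge (f \<circ> \<alpha>) a b (arccos (\<alpha> a \<bullet> \<alpha> b))"
      if ab: "a \<in> I" "b \<in> I" "a < b" for a b
    proof -
      have sub: "{a..b} \<subseteq> I" using cI ab
        by (meson atLeastAtMost_iff convex_real_interval is_interval_convex_1 mem_is_interval_1_I subsetI)
      have "length_ge (F \<circ> chart \<circ> \<alpha>) x y (dist (\<alpha> x) (\<alpha> y))"
        if "a \<le> x" "x \<le> y" "y \<le> b" for x y
      proof (rule length_ge_chord[OF limit_map_length[OF F2] that(2)])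
        have xy: "{x..y} \<subseteq> I" using sub that by auto
        show "continuous_on {x..y} \<alpha>" by (rule continuous_on_subset[OF cont xy])
        show "norm (\<alpha> z) = 1" if "z \<in> {x..y}" for z using unit that xy by blast
      qed
      then have "length_ge (F \<circ> chart \<circ> \<alpha>) a b (arccos (\<alpha> a \<bullet> \<alpha> b))"
        by (rule length_ge_angle) (use ab sub unit continuous_on_subset[OF cont sub] in auto)
      moreover have "f \<circ> \<alpha> = \<iota> \<circ> (F \<circ> chart \<circ> \<alpha>)"
        by (auto simp: f_def)
      ultimately show ?thesis using length_ge_isometry[of \<iota>] \<iota> by metis
    qed
    show ?thesis
    proof (rule antisym)
      show "curve_length plane I (f \<circ> \<alpha>) \<le> curve_length sphere2 I \<alpha>"
        unfolding curve_length_def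
      proof (rule SUP_mono, safe)
        fix k :: nat and t assume t: "k \<ge> 1" "\<forall>i\<le>k. t i \<in> I" "\<forall>i<k. t i < t (Suc i)"
        have "(\<Sum>i=1..k. mdist plane ((f \<circ> \<alpha>) (t (i - 1))) ((f \<circ> \<alpha>) (t i)))
            \<le> (\<Sum>i=1..k. mdist sphere2 (\<alpha> (t (i - 1))) (\<alpha> (t i)))"
          by (intro sum_mono) (use t(2) unit short in \<open>auto simp: mdist_sphere2\<close>)
        then show "\<exists>m\<in>{(k, t). 1 \<le> k \<and> (\<forall>i\<le>k. t i \<in> I) \<and> (\<forall>i<k. t i < t (Suc i))}.
             ennreal (\<Sum>i=1..k. mdist plane ((f \<circ> \<alpha>) (t (i - 1))) ((f \<circ> \<alpha>) (t i)))
             \<le> (case m of (k, t) \<Rightarrow> ennreal (\<Sum>i=1..k. mdist sphere2 (\<alpha> (t (i - 1))) (\<alpha> (t i))))"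
          using t by (intro bexI[of _ "(k, t)"]) (auto intro!: ennreal_leI)
      qed
      show "curve_length sphere2 I \<alpha> \<le> curve_length plane I (f \<circ> \<alpha>)"
        unfolding curve_length_def[of sphere2]
      proof (rule SUP_least, safe)
        fix k :: nat and t assume t: "k \<ge> 1" "\<forall>i\<le>k. t i \<in> I" "\<forall>i<k. t i < t (Suc i)"
        \<comment> \<open>Each term of the spherical sum bounds the length of the image over its own
          interval from below, and lengths over consecutive intervals add.\<close>
        have "length_ge (f \<circ> \<alpha>) (t 0) (t k) (\<Sum>i<k. arccos (\<alpha> (t i) \<bullet> \<alpha> (t (Suc i))))"
          by (intro length_ge_sum low) (use t in auto)
        also have "(\<Sum>i<k. arccos (\<alpha> (t i) \<bullet> \<alpha> (t (Suc i)))) = (\<Sum>i=1..k. mdist sphere2 (\<alpha> (t (i - 1))) (\<alpha> (t i)))"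
          by (rule sum.reindex_bij_witness[of _ "\<lambda>i. i - 1" Suc]) (use t(2) unit in \<open>auto simp: mdist_sphere2\<close>)
        finally have len: "length_ge (f \<circ> \<alpha>) (t 0) (t k) (\<Sum>i=1..k. mdist sphere2 (\<alpha> (t (i - 1))) (\<alpha> (t i)))" .
        have lt: "t 0 < t j" if "1 \<le> j" "j \<le> k" for j
          using that
        proof (induction j)
          case (Suc j)
          then show ?case using t(3) by (cases "j = 0") (auto intro: less_trans)
        qed simp
        have sub: "{t 0..t k} \<subseteq> I"
          using cI t(2) by (meson atLeastAtMost_iff is_interval_convex_1 le0 mem_is_interval_1_I order_refl subsetI)
        show "ennreal (\<Sum>i=1..k. mdist sphere2 (\<alpha> (t (i - 1))) (\<alpha> (t i))) \<le> curve_length plane I (f \<circ> \<alpha>)"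
          by (rule curve_length_plane_ge[OF len lt sub]) (use t(1) in auto)
      qed
    qed
  qed
  then show ?thesis using contf unfolding length_preserving_def by blast
qed

end
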